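(* Let $(A,\sigma,f)$ be a central simple $F$-algebra of degree $2n$ with quadratic pair, let $(L,\sigma_L)$ be an étale $F$-algebra of dimension $2n$ with involution, and let $\varepsilon\colon(L,\sigma_L)\hookrightarrow(A,\sigma,f)$ be an embedding of algebras with involution. Then the map $$\varepsilon_*(\xi)=\{x\in A_s\mid (1\otimes\xi(\ell))\cdot x=(\varepsilon(\ell)\otimes1)\cdot x\ \text{ for all }\ell\in L\}\qquad(\xi\in\mathbf{X}(L))$$ defines an embedding of quadrics $$\varepsilon_*\colon\mathbf{Y}(L,\sigma_L)\hookrightarrow\mathbf{Q}(\sigma,f).$$
   Context: $F$ is an arbitrary field, $F_s$ a separable closure, $\Gamma=\operatorname{Gal}(F_s/F)$, $n\ge1$, and the subscript $s$ denotes scalar extension to $F_s$. Étale algebras with involution. An étale $F$-algebra of dimension $m$ is a commutative $F$-algebra $L$ with $L\otimes_FF_s\cong F_s^m$; $\mathbf{X}(L)=\operatorname{Hom}_{F\text{-alg}}(L,F_s)$ with $\Gamma$-action $({}^\gamma\xi)(\ell)=\gamma(\xi(\ell))$. An involution on $L$ is an $F$-algebra automorphism $\sigma_L$ of order 2 such that the induced permutation $\xi\mapsto\xi\circ\sigma_L$ of $\mathbf{X}(L)$ has no fixed points. Quadratic pairs. For an $F$-algebra $B$ with $F$-linear involution $\sigma$: $\operatorname{Sym}(B,\sigma)=\{x\mid\sigma(x)=x\}$, $\operatorname{Skew}(B,\sigma)=\{x\mid\sigma(x)=-x\}$. A quadratic pair on a central simple $F$-algebra $A$ of degree $2n$ is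 a pair $(\sigma,f)$ with $\sigma$ an $F$-linear involution on $A$ and $f\colon\operatorname{Sym}(A,\sigma)\to F$ linear such that $\dim_F\operatorname{Sym}(A,\sigma)=n(2n+1)$, $\operatorname{Trd}_A(\operatorname{Skew}(A,\sigma))=\{0\}$, and $f(x+\sigma(x))=\operatorname{Trd}_A(x)$ for all $x\in A$. Embeddings of algebras with involution. $\varepsilon\colon(L,\sigma_L)\hookrightarrow(A,\sigma,f)$ (with $\dim L=\deg A=2n$) is an $F$-algebra embedding $\varepsilon\colon L\hookrightarrow A$ such that (a) $\varepsilon\circ\sigma_L=\sigma\circ\varepsilon$, and (b) $f(x)=\operatorname{Trd}_A(\varepsilon(\ell)x)$ for all $x\in\operatorname{Sym}(A,\sigma)$ and all $\ell\in L$ with $\ell+\sigma_L(\ell)=1$. The quadric $\mathbf{Q}(\sigma,f)$. $\mathcal{SB}(A)$ is the $(2n-1)$-dimensional projective space over $F_s$ whose $(k-1)$-dimensional linear varieties are the right ideals of $A_s$ of dimension $2nk$, with the natural $\Gamma$-action. A right ideal $I\subset A_s$ is isotropic if $\sigma_s(I)\cdot I=\{0\}$ and $f_s(I\cap\operatorname{Sym}(A_s,\sigma_s))=\{0\}$. $\mathbf{Q}(\sigma,f)\subset\mathcal{SB}(A)$ is the quadric whose points are the isotropic right ideals of dimension $2n$; the linear subvarieties of $\mathcal{SB}(A)$ lying in it are the isotropic right ideals. Thin quadrics. A thin $2(n-1)$-dimensional $\Gamma$-quadric is a pair $(Y,\sigma)$ with $Y$ a finite set of $2n$ elements with continuous $\Gamma$-action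 and $\sigma$ a $\Gamma$-equivariant permutation of order 2 without fixed points. An isotropic linear subvariety of dimension $k-1$ is a $k$-element subset of $Y$ containing no pair $\{y,y^\sigma\}$; the maximal ones have $n$ elements. $\mathbf{Y}(L,\sigma_L)$ is the thin quadric $\mathbf{X}(L)$ with the involution $\xi\mapsto\xi\circ\sigma_L$. Embedding of quadrics. An embedding of quadrics $(Y,\sigma)\hookrightarrow\mathbf{Q}(\sigma,f)$ is an injective $\Gamma$-equivariant map from $Y$ to the set of points of $\mathcal{SB}(A)$ whose image consists of $2n$ points in general position (not contained in a proper linear subspace) and which carries isotropic linear subvarieties to isotropic ones, i.e. the linear variety spanned by the image of any isotropic subset of $Y$ lies in $\mathbf{Q}(\sigma,f)$ (it is enough to require this for maximal isotropic subsets). *)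

theory Defs
  imports
    "HOL-Algebra.QuotRing"
    "HOL-Algebra.Embedded_Algebras"
    "HOL-Algebra.Group_Action"
    "HOL-Algebra.Algebraic_Closure_Type"
    "HOL-Library.Poly_Mapping"
    "HOL-Analysis.Function_Topology"
    "HOL-Analysis.Product_Topology"
    "Jordan_Normal_Form.Matrix"
begin

section \<open>Algebras over a field\<close>

text \<open>
  Fields are types of class \<open>field\<close>; an algebra over the field \<open>'f\<close> is a HOL-Algebra record of
  type \<open>('f, 'a) module\<close>, which carries both a ring structure and a scalar multiplication.
  The library locale \<open>algebra\<close> is restricted to commutative algebras.
\<close>

locale assoc_algebra =
  Module.module "ring_of_type_algebra :: 'f::field ring" A + ring A
  for A :: "('f::field, 'a) module" (structure) +
  assumes smult_mult_left:
      "\<lbrakk>x \<in> carrier A; y \<in> carrier A\<rbrakk> \<Longrightarrow> (c \<odot> x) \<otimes> y = c \<odot> (x \<otimes> y)"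
    and smult_mult_right:
      "\<lbrakk>x \<in> carrier A; y \<in> carrier A\<rbrakk> \<Longrightarrow> x \<otimes> (c \<odot> y) = c \<odot> (x \<otimes> y)"

definition algebra_hom :: "('f, 'a) module \<Rightarrow> ('f, 'b) module \<Rightarrow> ('a \<Rightarrow> 'b) \<Rightarrow> bool" where
  "algebra_hom A B h \<longleftrightarrow>
     h \<in> Ring.ring_hom A B \<and> (\<forall>c. \<forall>x\<in>carrier A. h (c \<odot>\<^bsub>A\<^esub> x) = c \<odot>\<^bsub>B\<^esub> h x)"

definition algebra_iso :: "('f, 'a) module \<Rightarrow> ('f, 'b) module \<Rightarrow> ('a \<Rightarrow> 'b) \<Rightarrow> bool" where
  "algebra_iso A B h \<longleftrightarrow> algebra_hom A B h \<and> bij_betw h (carrier A) (carrier B)"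

definition scalars :: "('f, 'a) module \<Rightarrow> 'a set" where
  "scalars A = range (\<lambda>c. c \<odot>\<^bsub>A\<^esub> \<one>\<^bsub>A\<^esub>)"

text \<open>
  The library measures dimensions over a subfield of a ring. For a nonzero algebra over \<open>'f\<close> this
  subfield is the copy \<open>scalars A\<close> of \<open>'f\<close>.
\<close>

abbreviation has_dim :: "('f, 'a) module \<Rightarrow> nat \<Rightarrow> 'a set \<Rightarrow> bool" where
  "has_dim A d V \<equiv> ring.dimension A d (scalars A) V"

definition center :: "('f, 'a) module \<Rightarrow> 'a set" where
  "center A = {z \<in> carrier A. \<forall>x\<in>carrier A. z \<otimes>\<^bsub>A\<^esub> x = x \<otimes>\<^bsub>A\<^esub> z}"

definition central_simple :: "nat \<Rightarrow> ('f::field, 'a) module \<Rightarrow> bool" where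
  "central_simple d A \<longleftrightarrow>
     assoc_algebra A \<and> \<one>\<^bsub>A\<^esub> \<noteq> \<zero>\<^bsub>A\<^esub> \<and>
     center A = scalars A \<and>
     (\<forall>I. ideal I A \<longrightarrow> I = {\<zero>\<^bsub>A\<^esub>} \<or> I = carrier A) \<and>
     has_dim A (d\<^sup>2) (carrier A)"

definition right_ideal :: "'a set \<Rightarrow> ('f, 'a) module \<Rightarrow> bool" where
  "right_ideal I A \<longleftrightarrow>
     additive_subgroup I A \<and> (\<forall>x\<in>I. \<forall>a\<in>carrier A. x \<otimes>\<^bsub>A\<^esub> a \<in> I)"

definition split_algebra :: "nat \<Rightarrow> ('k::field, nat \<Rightarrow> 'k) module" where
  "split_algebra m =
     \<lparr>carrier = {..<m} \<rightarrow>\<^sub>E UNIV,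
      monoid.mult = (\<lambda>x y. \<lambda>i\<in>{..<m}. x i * y i),
      one = (\<lambda>i\<in>{..<m}. 1),
      zero = (\<lambda>i\<in>{..<m}. 0),
      add = (\<lambda>x y. \<lambda>i\<in>{..<m}. x i + y i),
      module.smult = (\<lambda>c x. \<lambda>i\<in>{..<m}. c * x i)\<rparr>"

section \<open>Separable closure and absolute Galois group\<close>

definition separable_closure :: "('f::field \<Rightarrow> 'k::field) \<Rightarrow> bool" where
  "separable_closure \<iota> \<longleftrightarrow>
     field_hom \<iota> \<and>
     (\<forall>x. \<exists>p. p \<noteq> 0 \<and> coprime p (pderiv p) \<and> poly (map_poly \<iota> p) x = 0) \<and>
     (\<forall>q::'k poly. Polynomial.degree q > 0 \<and> coprime q (pderiv q) \<longrightarrow> (\<exists>x. poly q x = 0))"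

definition extension_algebra :: "('f::field \<Rightarrow> 'k::field) \<Rightarrow> ('f, 'k) module" where
  "extension_algebra \<iota> =
     \<lparr>carrier = UNIV, monoid.mult = (*), one = 1, zero = 0, add = (+), module.smult = (\<lambda>c x. \<iota> c * x)\<rparr>"

definition galois_group :: "('f::field \<Rightarrow> 'k::field) \<Rightarrow> ('k \<Rightarrow> 'k) monoid" where
  "galois_group \<iota> =
     \<lparr>carrier = {\<gamma>. algebra_iso (extension_algebra \<iota>) (extension_algebra \<iota>) \<gamma>},
      monoid.mult = (\<circ>), one = id\<rparr>"

text \<open>The Krull topology is the topology of pointwise convergence, with \<open>'k\<close> discrete.\<close>

definition krull_topology :: "('f::field \<Rightarrow> 'k::field) \<Rightarrow> ('k \<Rightarrow> 'k) topology" where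
  "krull_topology \<iota> =
     subtopology (product_topology (\<lambda>_. discrete_topology UNIV) UNIV) (carrier (galois_group \<iota>))"

definition continuous_action ::
  "('f::field \<Rightarrow> 'k::field) \<Rightarrow> 'y set \<Rightarrow> (('k \<Rightarrow> 'k) \<Rightarrow> 'y \<Rightarrow> 'y) \<Rightarrow> bool" where
  "continuous_action \<iota> Y act \<longleftrightarrow>
     group_action (galois_group \<iota>) Y act \<and>
     continuous_map (prod_topology (krull_topology \<iota>) (discrete_topology Y)) (discrete_topology Y)
       (\<lambda>(\<gamma>, y). act \<gamma> y)"

section \<open>Scalar extension\<close>

text \<open>
  For an algebra \<open>A\<close> over \<open>'f\<close>, the tensor product of \<open>A\<close> and \<open>'k\<close> over \<open>'f\<close> is the free abelian
  group on the pairs \<open>(a, k)\<close> modulo the subgroup generated by the bilinearity and balancing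
  relations. The multiplication \<open>(a, k) (b, l) = (a b, k l)\<close> of generators turns the free abelian
  group into a ring, and the subgroup of relations into an ideal of it.
\<close>

definition free_ring :: "('f, 'a) module \<Rightarrow> (('a \<times> 'k::field) \<Rightarrow>\<^sub>0 int) ring" where
  "free_ring A =
     \<lparr>carrier = {u. Poly_Mapping.keys u \<subseteq> carrier A \<times> UNIV},
      monoid.mult = (\<lambda>u v. frag_extend (\<lambda>(a, k). frag_extend (\<lambda>(b, l).
                frag_of (a \<otimes>\<^bsub>A\<^esub> b, k * l)) v) u),
      one = frag_of (\<one>\<^bsub>A\<^esub>, 1),
      zero = 0,
      add = (+)\<rparr>"

definition tensor_relations ::
  "('f::field \<Rightarrow> 'k::field) \<Rightarrow> ('f, 'a) module \<Rightarrow> (('a \<times> 'k) \<Rightarrow>\<^sub>0 int) set" where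
  "tensor_relations \<iota> A =
     {frag_of (a \<oplus>\<^bsub>A\<^esub> b, k) - frag_of (a, k) - frag_of (b, k) | a b k.
        a \<in> carrier A \<and> b \<in> carrier A} \<union>
     {frag_of (a, k + l) - frag_of (a, k) - frag_of (a, l) | a k l. a \<in> carrier A} \<union>
     {frag_of (c \<odot>\<^bsub>A\<^esub> a, k) - frag_of (a, \<iota> c * k) | a c k. a \<in> carrier A}"

definition tensor_null ::
  "('f::field \<Rightarrow> 'k::field) \<Rightarrow> ('f, 'a) module \<Rightarrow> (('a \<times> 'k) \<Rightarrow>\<^sub>0 int) set" where
  "tensor_null \<iota> A = generate (add_monoid (free_ring A)) (tensor_relations \<iota> A)"

type_synonym ('a, 'k) tensor = "(('a \<times> 'k) \<Rightarrow>\<^sub>0 int) set"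

definition tensor ::
  "('f::field \<Rightarrow> 'k::field) \<Rightarrow> ('f, 'a) module \<Rightarrow> 'a \<Rightarrow> 'k \<Rightarrow> ('a, 'k) tensor" where
  "tensor \<iota> A a k = tensor_null \<iota> A +>\<^bsub>free_ring A\<^esub> frag_of (a, k)"

definition scalar_ext ::
  "('f::field \<Rightarrow> 'k::field) \<Rightarrow> ('f, 'a) module \<Rightarrow> ('k, ('a, 'k) tensor) module" where
  "scalar_ext \<iota> A =
     (let Q = free_ring A Quot tensor_null \<iota> A
      in \<lparr>carrier = carrier Q, monoid.mult = monoid.mult Q, one = one Q, zero = zero Q, add = add Q,
          module.smult = (\<lambda>k x. tensor \<iota> A \<one>\<^bsub>A\<^esub> k \<otimes>\<^bsub>Q\<^esub> x)\<rparr>)"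

text \<open>
  The additive map of the tensor product induced by a map \<open>h\<close> of generators, provided that \<open>h\<close>
  respects the relations; for such \<open>h\<close> the union ranges over a single coset.
\<close>

definition tensor_map ::
  "('f::field \<Rightarrow> 'k::field) \<Rightarrow> ('f, 'a) module \<Rightarrow> ('a \<times> 'k \<Rightarrow> 'a \<times> 'k)
     \<Rightarrow> ('a, 'k) tensor \<Rightarrow> ('a, 'k) tensor" where
  "tensor_map \<iota> A h x =
     (\<Union>u\<in>x. tensor_null \<iota> A +>\<^bsub>free_ring A\<^esub> frag_extend (\<lambda>g. frag_of (h g)) u)"

definition ext_map ::
  "('f::field \<Rightarrow> 'k::field) \<Rightarrow> ('f, 'a) module \<Rightarrow> ('a \<Rightarrow> 'a)
     \<Rightarrow> ('a, 'k) tensor \<Rightarrow> ('a, 'k) tensor" where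
  "ext_map \<iota> A \<sigma> = tensor_map \<iota> A (\<lambda>(a, k). (\<sigma> a, k))"

definition galois_map ::
  "('f::field \<Rightarrow> 'k::field) \<Rightarrow> ('f, 'a) module \<Rightarrow> ('k \<Rightarrow> 'k)
     \<Rightarrow> ('a, 'k) tensor \<Rightarrow> ('a, 'k) tensor" where
  "galois_map \<iota> A \<gamma> = tensor_map \<iota> A (\<lambda>(a, k). (a, \<gamma> k))"

section \<open>Etale algebras with involution\<close>

definition etale :: "('f::field \<Rightarrow> 'k::field) \<Rightarrow> nat \<Rightarrow> ('f, 'l) module \<Rightarrow> bool" where
  "etale \<iota> m L \<longleftrightarrow>
     assoc_algebra L \<and> cring L \<and> (\<exists>\<phi>. algebra_iso (scalar_ext \<iota> L) (split_algebra m) \<phi>)"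

definition X_homs :: "('f::field \<Rightarrow> 'k::field) \<Rightarrow> ('f, 'l) module \<Rightarrow> ('l \<Rightarrow> 'k) set" where
  "X_homs \<iota> L = {\<xi> \<in> extensional (carrier L). algebra_hom L (extension_algebra \<iota>) \<xi>}"

definition X_action ::
  "('f::field \<Rightarrow> 'k::field) \<Rightarrow> ('f, 'l) module \<Rightarrow> ('k \<Rightarrow> 'k) \<Rightarrow> ('l \<Rightarrow> 'k) \<Rightarrow> ('l \<Rightarrow> 'k)" where
  "X_action \<iota> L \<gamma> = (\<lambda>\<xi>\<in>X_homs \<iota> L. compose (carrier L) \<gamma> \<xi>)"

definition X_involution :: "('f, 'l) module \<Rightarrow> ('l \<Rightarrow> 'l) \<Rightarrow> ('l \<Rightarrow> 'k) \<Rightarrow> ('l \<Rightarrow> 'k)" where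
  "X_involution L \<sigma>\<^sub>L \<xi> = compose (carrier L) \<xi> \<sigma>\<^sub>L"

definition etale_with_involution ::
  "('f::field \<Rightarrow> 'k::field) \<Rightarrow> nat \<Rightarrow> ('f, 'l) module \<Rightarrow> ('l \<Rightarrow> 'l) \<Rightarrow> bool" where
  "etale_with_involution \<iota> m L \<sigma>\<^sub>L \<longleftrightarrow>
     etale \<iota> m L \<and>
     algebra_iso L L \<sigma>\<^sub>L \<and>
     (\<forall>x\<in>carrier L. \<sigma>\<^sub>L (\<sigma>\<^sub>L x) = x) \<and> (\<exists>x\<in>carrier L. \<sigma>\<^sub>L x \<noteq> x) \<and>
     (\<forall>\<xi>\<in>X_homs \<iota> L. X_involution L \<sigma>\<^sub>L \<xi> \<noteq> \<xi>)"

section \<open>Quadratic pairs\<close>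

text \<open>
  The reduced trace of \<open>a\<close> is the trace of the image of \<open>a \<otimes> 1\<close> under any isomorphism of the scalar
  extension with a matrix algebra; this trace does not depend on the isomorphism and lies in the
  base field.
\<close>

definition mat_trace :: "'k::comm_monoid_add mat \<Rightarrow> 'k" where
  "mat_trace M = (\<Sum>i<dim_row M. M $$ (i, i))"

definition reduced_trace :: "('f::field \<Rightarrow> 'k::field) \<Rightarrow> ('f, 'a) module \<Rightarrow> 'a \<Rightarrow> 'f" where
  "reduced_trace \<iota> A a =
     (THE t. \<exists>d \<phi>. algebra_iso (scalar_ext \<iota> A) (module_mat TYPE('k) d d) \<phi> \<and>
                   mat_trace (\<phi> (tensor \<iota> A a 1)) = \<iota> t)"

definition linear_involution :: "('f, 'a) module \<Rightarrow> ('a \<Rightarrow> 'a) \<Rightarrow> bool" where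
  "linear_involution A \<sigma> \<longleftrightarrow>
     \<sigma> \<in> carrier A \<rightarrow> carrier A \<and>
     (\<forall>x\<in>carrier A. \<forall>y\<in>carrier A. \<sigma> (x \<oplus>\<^bsub>A\<^esub> y) = \<sigma> x \<oplus>\<^bsub>A\<^esub> \<sigma> y) \<and>
     (\<forall>x\<in>carrier A. \<forall>y\<in>carrier A. \<sigma> (x \<otimes>\<^bsub>A\<^esub> y) = \<sigma> y \<otimes>\<^bsub>A\<^esub> \<sigma> x) \<and>
     (\<forall>c. \<forall>x\<in>carrier A. \<sigma> (c \<odot>\<^bsub>A\<^esub> x) = c \<odot>\<^bsub>A\<^esub> \<sigma> x) \<and>
     (\<forall>x\<in>carrier A. \<sigma> (\<sigma> x) = x)"

definition Sym :: "('f, 'a) module \<Rightarrow> ('a \<Rightarrow> 'a) \<Rightarrow> 'a set" where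
  "Sym A \<sigma> = {x \<in> carrier A. \<sigma> x = x}"

definition Skew :: "('f, 'a) module \<Rightarrow> ('a \<Rightarrow> 'a) \<Rightarrow> 'a set" where
  "Skew A \<sigma> = {x \<in> carrier A. \<sigma> x = \<ominus>\<^bsub>A\<^esub> x}"

definition quadratic_pair ::
  "('f::field \<Rightarrow> 'k::field) \<Rightarrow> nat \<Rightarrow> ('f, 'a) module \<Rightarrow> ('a \<Rightarrow> 'a) \<Rightarrow> ('a \<Rightarrow> 'f) \<Rightarrow> bool" where
  "quadratic_pair \<iota> n A \<sigma> f \<longleftrightarrow>
     linear_involution A \<sigma> \<and>
     (\<forall>x\<in>Sym A \<sigma>. \<forall>y\<in>Sym A \<sigma>. f (x \<oplus>\<^bsub>A\<^esub> y) = f x + f y) \<and>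
     (\<forall>c. \<forall>x\<in>Sym A \<sigma>. f (c \<odot>\<^bsub>A\<^esub> x) = c * f x) \<and>
     has_dim A (n * (2 * n + 1)) (Sym A \<sigma>) \<and>
     reduced_trace \<iota> A ` Skew A \<sigma> = {0} \<and>
     (\<forall>x\<in>carrier A. f (x \<oplus>\<^bsub>A\<^esub> \<sigma> x) = reduced_trace \<iota> A x)"

text \<open>
  The extension of a linear form \<open>f\<close> on \<open>Sym A \<sigma>\<close> to the symmetric elements of the scalar extension:
  a sum of tensors \<open>x \<otimes> k\<close> with all \<open>x\<close> in \<open>Sym A \<sigma>\<close> is sent to the sum of the \<open>k \<iota>(f x)\<close>.
\<close>

definition ext_form ::
  "('f::field \<Rightarrow> 'k::field) \<Rightarrow> ('f, 'a) module \<Rightarrow> ('a \<Rightarrow> 'a) \<Rightarrow> ('a \<Rightarrow> 'f)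
     \<Rightarrow> ('a, 'k) tensor \<Rightarrow> 'k" where
  "ext_form \<iota> A \<sigma> f y =
     (THE t. \<exists>u\<in>y. Poly_Mapping.keys u \<subseteq> Sym A \<sigma> \<times> UNIV \<and>
        t = (\<Sum>(x, k)\<in>Poly_Mapping.keys u.
               of_int (Poly_Mapping.lookup u (x, k)) * (k * \<iota> (f x))))"

definition algebra_inv_embedding ::
  "('f::field \<Rightarrow> 'k::field) \<Rightarrow> ('f, 'l) module \<Rightarrow> ('l \<Rightarrow> 'l)
     \<Rightarrow> ('f, 'a) module \<Rightarrow> ('a \<Rightarrow> 'a) \<Rightarrow> ('a \<Rightarrow> 'f) \<Rightarrow> ('l \<Rightarrow> 'a) \<Rightarrow> bool" where
  "algebra_inv_embedding \<iota> L \<sigma>\<^sub>L A \<sigma> f \<epsilon> \<longleftrightarrow>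
     algebra_hom L A \<epsilon> \<and> inj_on \<epsilon> (carrier L) \<and>
     (\<forall>l\<in>carrier L. \<epsilon> (\<sigma>\<^sub>L l) = \<sigma> (\<epsilon> l)) \<and>
     (\<forall>x\<in>Sym A \<sigma>. \<forall>l\<in>carrier L. l \<oplus>\<^bsub>L\<^esub> \<sigma>\<^sub>L l = \<one>\<^bsub>L\<^esub> \<longrightarrow>
        f x = reduced_trace \<iota> A (\<epsilon> l \<otimes>\<^bsub>A\<^esub> x))"

section \<open>The Severi-Brauer variety and the quadric of a quadratic pair\<close>

text \<open>
  \<open>linear_variety \<iota> n A k\<close> holds of the linear varieties of dimension \<open>k - 1\<close> in the
  projective space of dimension \<open>2n - 1\<close> attached to \<open>A\<close>. Points are the case \<open>k = 1\<close>, and the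
  case \<open>k = 0\<close> is the empty variety. Inclusion of varieties is inclusion of right ideals.
\<close>

definition linear_variety ::
  "('f::field \<Rightarrow> 'k::field) \<Rightarrow> nat \<Rightarrow> ('f, 'a) module \<Rightarrow> nat \<Rightarrow> ('a, 'k) tensor set \<Rightarrow> bool" where
  "linear_variety \<iota> n A k I \<longleftrightarrow>
     right_ideal I (scalar_ext \<iota> A) \<and> has_dim (scalar_ext \<iota> A) (2 * n * k) I"

definition spanned_variety ::
  "('f::field \<Rightarrow> 'k::field) \<Rightarrow> nat \<Rightarrow> ('f, 'a) module
     \<Rightarrow> ('a, 'k) tensor set set \<Rightarrow> ('a, 'k) tensor set" where
  "spanned_variety \<iota> n A P = \<Inter>{J. (\<exists>k. linear_variety \<iota> n A k J) \<and> (\<forall>I\<in>P. I \<subseteq> J)}"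

definition general_position ::
  "('f::field \<Rightarrow> 'k::field) \<Rightarrow> nat \<Rightarrow> ('f, 'a) module \<Rightarrow> ('a, 'k) tensor set set \<Rightarrow> bool" where
  "general_position \<iota> n A P \<longleftrightarrow>
     \<not> (\<exists>k J. linear_variety \<iota> n A k J \<and> J \<noteq> carrier (scalar_ext \<iota> A) \<and> (\<forall>I\<in>P. I \<subseteq> J))"

text \<open>
  The linear varieties contained in the quadric \<open>Q(\<sigma>, f)\<close> are the isotropic right ideals; its
  points are those of them with \<open>k = 1\<close>.
\<close>

definition isotropic ::
  "('f::field \<Rightarrow> 'k::field) \<Rightarrow> ('f, 'a) module \<Rightarrow> ('a \<Rightarrow> 'a) \<Rightarrow> ('a \<Rightarrow> 'f)
     \<Rightarrow> ('a, 'k) tensor set \<Rightarrow> bool" where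
  "isotropic \<iota> A \<sigma> f I \<longleftrightarrow>
     right_ideal I (scalar_ext \<iota> A) \<and>
     (ext_map \<iota> A \<sigma> ` I) <#>\<^bsub>scalar_ext \<iota> A\<^esub> I = {\<zero>\<^bsub>scalar_ext \<iota> A\<^esub>} \<and>
     ext_form \<iota> A \<sigma> f ` (I \<inter> Sym (scalar_ext \<iota> A) (ext_map \<iota> A \<sigma>)) = {0}"

section \<open>Thin quadrics and their embeddings\<close>

definition thin_quadric ::
  "('f::field \<Rightarrow> 'k::field) \<Rightarrow> nat \<Rightarrow> 'y set \<Rightarrow> (('k \<Rightarrow> 'k) \<Rightarrow> 'y \<Rightarrow> 'y) \<Rightarrow> ('y \<Rightarrow> 'y) \<Rightarrow> bool" where
  "thin_quadric \<iota> n Y act s \<longleftrightarrow>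
     finite Y \<and> card Y = 2 * n \<and>
     continuous_action \<iota> Y act \<and>
     bij_betw s Y Y \<and> (\<forall>y\<in>Y. s (s y) = y) \<and> (\<forall>y\<in>Y. s y \<noteq> y) \<and>
     (\<forall>\<gamma>\<in>carrier (galois_group \<iota>). \<forall>y\<in>Y. s (act \<gamma> y) = act \<gamma> (s y))"

definition thin_isotropic :: "'y set \<Rightarrow> ('y \<Rightarrow> 'y) \<Rightarrow> 'y set \<Rightarrow> bool" where
  "thin_isotropic Y s S \<longleftrightarrow> S \<subseteq> Y \<and> (\<forall>y\<in>S. s y \<notin> S)"

definition quadric_embedding ::
  "('f::field \<Rightarrow> 'k::field) \<Rightarrow> nat \<Rightarrow> 'y set \<Rightarrow> (('k \<Rightarrow> 'k) \<Rightarrow> 'y \<Rightarrow> 'y) \<Rightarrow> ('y \<Rightarrow> 'y)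
     \<Rightarrow> ('f, 'a) module \<Rightarrow> ('a \<Rightarrow> 'a) \<Rightarrow> ('a \<Rightarrow> 'f) \<Rightarrow> ('y \<Rightarrow> ('a, 'k) tensor set) \<Rightarrow> bool" where
  "quadric_embedding \<iota> n Y act s A \<sigma> f \<phi> \<longleftrightarrow>
     thin_quadric \<iota> n Y act s \<and>
     (\<forall>y\<in>Y. linear_variety \<iota> n A 1 (\<phi> y)) \<and>
     inj_on \<phi> Y \<and>
     (\<forall>\<gamma>\<in>carrier (galois_group \<iota>). \<forall>y\<in>Y. \<phi> (act \<gamma> y) = galois_map \<iota> A \<gamma> ` \<phi> y) \<and>
     card (\<phi> ` Y) = 2 * n \<and> general_position \<iota> n A (\<phi> ` Y) \<and>
     (\<forall>S. thin_isotropic Y s S \<longrightarrow> isotropic \<iota> A \<sigma> f (spanned_variety \<iota> n A (\<phi> ` S)))"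

definition induced_map ::
  "('f::field \<Rightarrow> 'k::field) \<Rightarrow> ('f, 'l) module \<Rightarrow> ('f, 'a) module \<Rightarrow> ('l \<Rightarrow> 'a)
     \<Rightarrow> ('l \<Rightarrow> 'k) \<Rightarrow> ('a, 'k) tensor set" where
  "induced_map \<iota> L A \<epsilon> \<xi> =
     {x \<in> carrier (scalar_ext \<iota> A). \<forall>l\<in>carrier L.
        tensor \<iota> A \<one>\<^bsub>A\<^esub> (\<xi> l) \<otimes>\<^bsub>scalar_ext \<iota> A\<^esub> x =
        tensor \<iota> A (\<epsilon> l) 1 \<otimes>\<^bsub>scalar_ext \<iota> A\<^esub> x}"

end

theory Submission
  imports Defs "HOL-Algebra.Free_Abelian_Groups"
begin

text \<open>
  Write \<open>S\<close> for the scalar extension of \<open>A\<close>. The minimal idempotents of the split algebra obtained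
  from \<open>L\<close> map to \<open>2n\<close> nonzero orthogonal idempotents \<open>e i\<close> of \<open>S\<close> with sum \<open>1\<close>. Since \<open>A\<close> is central
  simple, \<open>S\<close> is prime, so all \<open>(2n)\<^sup>2\<close> corners \<open>e i S e j\<close> are nonzero; as \<open>S\<close> has dimension
  \<open>(2n)\<^sup>2\<close>, they are lines. Hence \<open>S\<close> is a matrix algebra whose diagonal units are the \<open>e i\<close>, the right
  ideal attached to the \<open>i\<close>-th homomorphism is \<open>e i S\<close>, and a set \<open>T\<close> of homomorphisms spans
  \<open>e\<^sub>T S\<close>, where \<open>e\<^sub>T\<close> is the sum of the \<open>e i\<close> over \<open>T\<close>.

  The involution sends \<open>e i\<close> to the idempotent of the conjugate homomorphism, so
  \<open>\<sigma>(e\<^sub>T) e\<^sub>T = 0\<close> for isotropic \<open>T\<close>. If \<open>y = e\<^sub>T y\<close> is symmetric, then \<open>y e\<^sub>T = \<sigma>(y) \<sigma>(e\<^sub>T) e\<^sub>T = 0\<close>,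
  and \<open>f(y) = Trd(l y)\<close> for some \<open>l\<close> in \<open>L\<close> with \<open>l + \<sigma>(l) = 1\<close>; since \<open>l\<close> commutes with \<open>e\<^sub>T\<close>, this
  equals \<open>Trd(l y e\<^sub>T) = 0\<close>.
\<close>

section \<open>The scalar extension of an algebra\<close>

text \<open>Two steps need descent to the base field. The definition of the reduced trace
  presupposes that traces of elements of \<open>A\<close> lie there. And the condition on
  \<open>f\<close> in an embedding has content only if some \<open>l\<close> in \<open>L\<close>
  satisfies \<open>l + \<sigma>(l) = 1\<close>; in characteristic 2 there is no element 1/2 to take,
  and choosing one homomorphism from each conjugate pair solves the equation only over the extension
  field. Both descents use coordinates: a basis of the extension field that contains
  \<open>1\<close> writes each element of the scalar extension as a finite sum of tensors
  \<open>a \<otimes> b\<close> with \<open>b\<close> in the basis, and the coordinate maps respect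
  multiplication by \<open>A\<close> and maps induced from \<open>A\<close>. The same coordinates
  carry the induction behind primeness and the preservation of injectivity and dimension.

  Traces are compared through a uniqueness statement: up to a factor, only one linear form on a
  matrix algebra vanishes on commutators. The factor cannot be read off at the unit, whose trace may
  be zero in positive characteristic; it is found at a minimal idempotent or at an element of
  \<open>L\<close> with nonzero trace.\<close>

lemma frag_keys_induct [consumes 1, case_names zero gen add uminus]:
  assumes "Poly_Mapping.keys u \<subseteq> G"
    and "P 0" and "\<And>g. g \<in> G \<Longrightarrow> P (frag_of g)"
    and "\<And>u v. P u \<Longrightarrow> P v \<Longrightarrow> P (u + v)" and "\<And>u. P u \<Longrightarrow> P (- u)"
  shows "P u"
  using assms(1)
proof (induction rule: frag_induction)
  case (diff a b)
  then show ?case using assms(4)[of a "- b"] assms(5)[of b] by simp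
qed (use assms in auto)

context assoc_algebra
begin

lemma smult_carrier [simp]: "x \<in> carrier A \<Longrightarrow> c \<odot> x \<in> carrier A"
  by (simp add: smult_closed ring_of_type_algebra_def)

lemma smult_add_scalar: "x \<in> carrier A \<Longrightarrow> (c + d) \<odot> x = c \<odot> x \<oplus> d \<odot> x"
  using smult_l_distr[of c d x] by (simp add: ring_of_type_algebra_def)

lemma smult_add_vector: "x \<in> carrier A \<Longrightarrow> y \<in> carrier A \<Longrightarrow> c \<odot> (x \<oplus> y) = c \<odot> x \<oplus> c \<odot> y"
  using smult_r_distr[of c x y] by (simp add: ring_of_type_algebra_def)

lemma smult_smult: "x \<in> carrier A \<Longrightarrow> c \<odot> (d \<odot> x) = (c * d) \<odot> x"
  using smult_assoc1[of c d x] by (simp add: ring_of_type_algebra_def)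

lemma smult_1 [simp]: "x \<in> carrier A \<Longrightarrow> 1 \<odot> x = x"
  using smult_one[of x] by (simp add: ring_of_type_algebra_def)

lemma smult_zero_scalar [simp]: "x \<in> carrier A \<Longrightarrow> 0 \<odot> x = \<zero>"
  using smult_l_null[of x] by (simp add: ring_of_type_algebra_def)

lemma smult_zero_vector [simp]: "c \<odot> \<zero> = \<zero>"
  using smult_r_null[of c] by (simp add: ring_of_type_algebra_def)

end

locale scalar_extension = field_hom \<iota> + assoc_algebra A
  for \<iota> :: "'f::field \<Rightarrow> 'k::field" and A :: "('f, 'a) module" (structure)
begin

abbreviation "R \<equiv> (free_ring A :: (('a \<times> 'k) \<Rightarrow>\<^sub>0 int) ring)"
abbreviation "N \<equiv> tensor_null \<iota> A"
abbreviation "S \<equiv> scalar_ext \<iota> A"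
abbreviation "tens \<equiv> tensor \<iota> A"

section \<open>The ring structure on the free abelian group of pairs\<close>

lemma carrier_R: "carrier R = {u. Poly_Mapping.keys u \<subseteq> carrier A \<times> UNIV}"
  and zero_R: "\<zero>\<^bsub>R\<^esub> = 0" and add_R: "x \<oplus>\<^bsub>R\<^esub> y = x + y" and one_R: "\<one>\<^bsub>R\<^esub> = frag_of (\<one>, 1)"
  and mult_R: "x \<otimes>\<^bsub>R\<^esub> y =
    frag_extend (\<lambda>(a, k). frag_extend (\<lambda>(b, l). frag_of (a \<otimes> b, k * l)) y) x"
  by (simp_all add: free_ring_def)

lemma mult_R_add_left: "(x + y) \<otimes>\<^bsub>R\<^esub> z = x \<otimes>\<^bsub>R\<^esub> z + y \<otimes>\<^bsub>R\<^esub> z"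
  by (simp add: mult_R frag_extend_add)

lemma mult_R_minus_left: "(- x) \<otimes>\<^bsub>R\<^esub> z = - (x \<otimes>\<^bsub>R\<^esub> z)"
  by (simp add: mult_R frag_extend_minus)

lemma mult_R_zero: "0 \<otimes>\<^bsub>R\<^esub> z = 0" "z \<otimes>\<^bsub>R\<^esub> 0 = 0"
  by (auto simp: mult_R frag_extend_eq_0)

text \<open>The product is the additive extension in its left argument, so additivity on the right
  is an induction on the left factor.\<close>

lemma mult_R_add_right: "z \<otimes>\<^bsub>R\<^esub> (x + y) = z \<otimes>\<^bsub>R\<^esub> x + z \<otimes>\<^bsub>R\<^esub> y"
proof -
  have "Poly_Mapping.keys z \<subseteq> UNIV" by simp
  then show ?thesis
    by (induction z rule: frag_keys_induct)
      (auto simp: mult_R_zero mult_R_add_left mult_R_minus_left,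
       auto simp: mult_R frag_extend_add)
qed

lemma mult_R_minus_right: "z \<otimes>\<^bsub>R\<^esub> (- x) = - (z \<otimes>\<^bsub>R\<^esub> x)"
  by (metis add.right_inverse add_eq_0_iff mult_R_add_right mult_R_zero(2))

lemma mult_R_of: "frag_of (a, k) \<otimes>\<^bsub>R\<^esub> frag_of (b, l) = frag_of (a \<otimes> b, k * l)"
  by (simp add: mult_R)

lemmas mult_R_simps = mult_R_add_left mult_R_add_right mult_R_minus_left mult_R_minus_right
  mult_R_zero mult_R_of

lemma R_induct [consumes 1, case_names zero gen add uminus]:
  assumes "u \<in> carrier R"
    and "P 0" and "\<And>a k. a \<in> carrier A \<Longrightarrow> P (frag_of (a, k))"
    and "\<And>u v. P u \<Longrightarrow> P v \<Longrightarrow> P (u + v)" and "\<And>u. P u \<Longrightarrow> P (- u)"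
  shows "P u"
proof -
  from assms(1) have "Poly_Mapping.keys u \<subseteq> carrier A \<times> UNIV" by (simp add: carrier_R)
  then show ?thesis by (induction rule: frag_keys_induct) (use assms in auto)
qed

lemma R_closed: "frag_of (a, k) \<in> carrier R \<longleftrightarrow> a \<in> carrier A"
  "u \<in> carrier R \<Longrightarrow> v \<in> carrier R \<Longrightarrow> u + v \<in> carrier R"
  "u \<in> carrier R \<Longrightarrow> - u \<in> carrier R" "0 \<in> carrier R"
  "u \<in> carrier R \<Longrightarrow> v \<in> carrier R \<Longrightarrow> u - v \<in> carrier R"
  using keys_add[of u v] keys_diff[of u v] by (auto simp: carrier_R keys_frag_of)

lemma R_mult_closed: "u \<in> carrier R \<Longrightarrow> v \<in> carrier R \<Longrightarrow> u \<otimes>\<^bsub>R\<^esub> v \<in> carrier R"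
proof (induction u rule: R_induct)
  case (gen a k)
  from gen(2) show ?case
    by (induction v rule: R_induct) (auto simp: mult_R_simps R_closed gen)
qed (auto simp: mult_R_simps R_closed)

lemma R_mult_assoc:
  assumes "u \<in> carrier R" "v \<in> carrier R" "w \<in> carrier R"
  shows "(u \<otimes>\<^bsub>R\<^esub> v) \<otimes>\<^bsub>R\<^esub> w = u \<otimes>\<^bsub>R\<^esub> (v \<otimes>\<^bsub>R\<^esub> w)"
  using assms
proof (induction u rule: R_induct)
  case (gen a k)
  from gen(2) show ?case
  proof (induction v rule: R_induct)
    case (gen b l)
    from \<open>w \<in> carrier R\<close> show ?case
      by (induction w rule: R_induct) (auto simp: mult_R_simps gen \<open>a \<in> carrier A\<close> m_assoc mult.assoc)
  qed (auto simp: mult_R_simps)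
qed (auto simp: mult_R_simps)

lemma ring_R: "ring R"
proof (rule ringI)
  show "abelian_group R"
  proof (rule abelian_groupI)
    fix x assume "x \<in> carrier R"
    then show "\<exists>y\<in>carrier R. y \<oplus>\<^bsub>R\<^esub> x = \<zero>\<^bsub>R\<^esub>"
      by (intro bexI[of _ "- x"]) (auto simp: zero_R add_R R_closed)
  qed (auto simp: zero_R add_R R_closed algebra_simps)
  show "Group.monoid R"
  proof (rule monoidI)
    fix x assume "x \<in> carrier R"
    then show "\<one>\<^bsub>R\<^esub> \<otimes>\<^bsub>R\<^esub> x = x"
      by (induction x rule: R_induct) (auto simp: one_R mult_R_simps)
  next
    fix x assume "x \<in> carrier R"
    then show "x \<otimes>\<^bsub>R\<^esub> \<one>\<^bsub>R\<^esub> = x"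
      by (induction x rule: R_induct) (auto simp: one_R mult_R_simps)
  qed (auto simp: R_mult_closed R_mult_assoc, auto simp: one_R R_closed)
qed (auto simp: add_R mult_R_simps)

sublocale free: ring R by (rule ring_R)

lemma add_monoid_R: "add_monoid R = free_Abelian_group (carrier A \<times> UNIV)"
  by (simp add: free_ring_def free_Abelian_group_def)

section \<open>The ideal of tensor relations\<close>

lemma relations_cases [consumes 1, case_names left right balance]:
  assumes "r \<in> tensor_relations \<iota> A"
  obtains a b k where "a \<in> carrier A" "b \<in> carrier A"
      "r = frag_of (a \<oplus> b, k) - frag_of (a, k) - frag_of (b, k)"
    | a k l where "a \<in> carrier A" "r = frag_of (a, k + l) - frag_of (a, k) - frag_of (a, l)"
    | a c k where "a \<in> carrier A" "r = frag_of (c \<odot> a, k) - frag_of (a, \<iota> c * k)"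
  using assms unfolding tensor_relations_def by blast

lemma relations_intros:
  "a \<in> carrier A \<Longrightarrow> b \<in> carrier A \<Longrightarrow>
    frag_of (a \<oplus> b, k) - frag_of (a, k) - frag_of (b, k) \<in> tensor_relations \<iota> A"
  "a \<in> carrier A \<Longrightarrow> frag_of (a, k + l) - frag_of (a, k) - frag_of (a, l) \<in> tensor_relations \<iota> A"
  "a \<in> carrier A \<Longrightarrow> frag_of (c \<odot> a, k) - frag_of (a, \<iota> c * k) \<in> tensor_relations \<iota> A"
  unfolding tensor_relations_def by blast+

lemma relations_subset: "tensor_relations \<iota> A \<subseteq> carrier R"
  by (auto elim!: relations_cases simp: R_closed)

text \<open>A relation times a generator is a relation of the same kind, so the subgroup generated
  by the relations absorbs products by induction on both factors.\<close>

lemma relations_mult: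
  assumes "r \<in> tensor_relations \<iota> A" "a \<in> carrier A"
  shows "r \<otimes>\<^bsub>R\<^esub> frag_of (a, k) \<in> tensor_relations \<iota> A \<and>
    frag_of (a, k) \<otimes>\<^bsub>R\<^esub> r \<in> tensor_relations \<iota> A"
  using assms(1)
proof (cases rule: relations_cases)
  case (left x y l)
  then show ?thesis
    using assms(2) relations_intros(1)[of "x \<otimes> a" "y \<otimes> a" "l * k"]
      relations_intros(1)[of "a \<otimes> x" "a \<otimes> y" "k * l"]
    by (simp add: diff_conv_add_uminus mult_R_simps l_distr r_distr del: add_uminus_conv_diff)
next
  case (right x l m)
  then show ?thesis
    using assms(2) relations_intros(2)[of "x \<otimes> a" "l * k" "m * k"]
      relations_intros(2)[of "a \<otimes> x" "k * l" "k * m"]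
    by (simp add: diff_conv_add_uminus mult_R_simps distrib_left distrib_right
        del: add_uminus_conv_diff)
next
  case (balance x c l)
  then show ?thesis
    using assms(2) relations_intros(3)[of "x \<otimes> a" c "l * k"]
      relations_intros(3)[of "a \<otimes> x" c "k * l"]
    by (simp add: diff_conv_add_uminus mult_R_simps smult_mult_left smult_mult_right mult.assoc
        mult.left_commute del: add_uminus_conv_diff)
qed

lemma subgroup_N: "subgroup N (add_monoid R)"
  unfolding tensor_null_def
  by (rule free.add.generate_is_subgroup) (use relations_subset in simp)

lemma N_closed: "0 \<in> N" "u \<in> N \<Longrightarrow> v \<in> N \<Longrightarrow> u + v \<in> N" "u \<in> N \<Longrightarrow> - u \<in> N"
proof -
  interpret N: subgroup N "add_monoid R" by (rule subgroup_N)
  show "0 \<in> N" "u \<in> N \<Longrightarrow> v \<in> N \<Longrightarrow> u + v \<in> N"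
    using N.one_closed N.m_closed[of u v] by (simp_all add: zero_R add_R)
  assume u: "u \<in> N"
  then have "u \<in> carrier R" using N.subset by auto
  then have "inv\<^bsub>add_monoid R\<^esub> u = - u"
    by (subst add_monoid_R) (simp add: carrier_R)
  with u show "- u \<in> N" using N.m_inv_closed[of u] by simp
qed

lemma N_induct [consumes 1, case_names zero rel add uminus]:
  assumes "u \<in> N" "P 0" "\<And>r. r \<in> tensor_relations \<iota> A \<Longrightarrow> P r"
    "\<And>u v. P u \<Longrightarrow> P v \<Longrightarrow> P (u + v)" "\<And>u. P u \<Longrightarrow> P (- u)"
  shows "P u"
  using assms(1) unfolding tensor_null_def
proof (induction rule: generate.induct)
  case (inv h)
  then have "h \<in> carrier R" using relations_subset by auto
  then have "inv\<^bsub>add_monoid R\<^esub> h = - h"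
    by (subst add_monoid_R) (simp add: carrier_R)
  with inv show ?case using assms by simp
qed (use assms in \<open>auto simp: zero_R add_R\<close>)

lemma ideal_N: "ideal N R"
proof (rule idealI[OF ring_R subgroup_N])
  fix u w assume u: "u \<in> N" and w: "w \<in> carrier R"
  have rel: "r \<in> N" if "r \<in> tensor_relations \<iota> A" for r
    using that by (simp add: tensor_null_def generate.incl)
  have "w \<otimes>\<^bsub>R\<^esub> r \<in> N \<and> r \<otimes>\<^bsub>R\<^esub> w \<in> N" if "r \<in> tensor_relations \<iota> A" for r
    using w
    by (induction w rule: R_induct) (auto simp: mult_R_simps N_closed that rel relations_mult)
  with u have "w \<otimes>\<^bsub>R\<^esub> u \<in> N \<and> u \<otimes>\<^bsub>R\<^esub> w \<in> N"
    by (induction u rule: N_induct) (auto simp: mult_R_simps N_closed)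
  then show "w \<otimes>\<^bsub>R\<^esub> u \<in> N" "u \<otimes>\<^bsub>R\<^esub> w \<in> N" by auto
qed

sublocale null: ideal N R by (rule ideal_N)

section \<open>The quotient ring and its algebra structure\<close>

definition coset where "coset u = N +>\<^bsub>R\<^esub> u"

lemma coset_conv: "coset u = (\<lambda>m. m + u) ` N"
  by (auto simp: coset_def a_r_coset_def r_coset_def add_R)

lemma carrier_S: "carrier S = coset ` carrier R"
  by (auto simp: scalar_ext_def Let_def FactRing_def A_RCOSETS_defs coset_def a_r_coset_def)

lemma tens_eq: "tens a k = coset (frag_of (a, k))"
  by (simp add: tensor_def coset_def)

lemma coset_ops:
  "u \<in> carrier R \<Longrightarrow> v \<in> carrier R \<Longrightarrow> coset u \<oplus>\<^bsub>S\<^esub> coset v = coset (u + v)"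
  "u \<in> carrier R \<Longrightarrow> v \<in> carrier R \<Longrightarrow> coset u \<otimes>\<^bsub>S\<^esub> coset v = coset (u \<otimes>\<^bsub>R\<^esub> v)"
  "\<zero>\<^bsub>S\<^esub> = coset 0" "\<one>\<^bsub>S\<^esub> = coset (frag_of (\<one>, 1))"
  "k \<odot>\<^bsub>S\<^esub> x = tens \<one> k \<otimes>\<^bsub>S\<^esub> x"
     apply (simp add: scalar_ext_def Let_def FactRing_def coset_def null.a_rcos_sum add_R)
    apply (simp add: scalar_ext_def Let_def FactRing_def coset_def null.rcoset_mult_add)
   apply (simp add: scalar_ext_def Let_def FactRing_def coset_conv)
  apply (simp add: scalar_ext_def Let_def FactRing_def coset_def one_R)
  apply (simp add: scalar_ext_def Let_def)
  done

lemma mem_coset: "v \<in> coset u \<longleftrightarrow> v - u \<in> N"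
  unfolding coset_conv by (metis (no_types, lifting) add_diff_cancel diff_add_cancel image_iff)

lemma coset_self: "u \<in> coset u"
  by (simp add: mem_coset N_closed)

lemma coset_eq_iff: "coset u = coset v \<longleftrightarrow> u - v \<in> N"
proof
  assume "coset u = coset v"
  then show "u - v \<in> N" using coset_self[of u] by (simp add: mem_coset)
next
  assume uv: "u - v \<in> N"
  have "w - u \<in> N \<longleftrightarrow> w - v \<in> N" for w
    using N_closed(2)[OF _ uv, of "w - u"] N_closed(2)[OF _ N_closed(3)[OF uv], of "w - v"] by auto
  then show "coset u = coset v" by (auto simp: mem_coset)
qed

lemma ring_S: "ring S"
proof (rule ringI)
  show "abelian_group S"
  proof (rule abelian_groupI)
    fix x assume "x \<in> carrier S"
    then obtain u where u: "u \<in> carrier R" "x = coset u" by (auto simp: carrier_S)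
    then have "coset (- u) \<in> carrier S" "coset (- u) \<oplus>\<^bsub>S\<^esub> x = \<zero>\<^bsub>S\<^esub>"
      by (auto simp: carrier_S coset_ops R_closed)
    then show "\<exists>y\<in>carrier S. y \<oplus>\<^bsub>S\<^esub> x = \<zero>\<^bsub>S\<^esub>" by blast
  qed (auto simp: carrier_S coset_ops R_closed algebra_simps)
  show "Group.monoid S"
    using free.l_one free.r_one
    by (intro monoidI)
      (auto simp: carrier_S coset_ops R_closed R_mult_closed R_mult_assoc simp flip: one_R)
qed (auto simp: carrier_S coset_ops R_closed mult_R_simps R_mult_closed)

sublocale ext: ring S by (rule ring_S)

lemma tens_closed [simp]: "a \<in> carrier A \<Longrightarrow> tens a k \<in> carrier S"
  by (auto simp: tens_eq carrier_S R_closed)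

lemma relation_coset: "u - v \<in> tensor_relations \<iota> A \<Longrightarrow> coset u = coset v"
  by (simp add: coset_eq_iff tensor_null_def generate.incl)

lemma tens_add_left:
  "a \<in> carrier A \<Longrightarrow> b \<in> carrier A \<Longrightarrow> tens (a \<oplus> b) k = tens a k \<oplus>\<^bsub>S\<^esub> tens b k"
  using relations_intros(1)[of a b k]
  by (auto simp: tens_eq coset_ops R_closed diff_diff_eq intro!: relation_coset)

lemma tens_add_right: "a \<in> carrier A \<Longrightarrow> tens a (k + l) = tens a k \<oplus>\<^bsub>S\<^esub> tens a l"
  using relations_intros(2)[of a k l]
  by (auto simp: tens_eq coset_ops R_closed diff_diff_eq intro!: relation_coset)

lemma tens_smult: "a \<in> carrier A \<Longrightarrow> tens (c \<odot> a) k = tens a (\<iota> c * k)"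
  using relations_intros(3)[of a c k]
  by (auto simp: tens_eq intro!: relation_coset)

lemma tens_mult:
  "a \<in> carrier A \<Longrightarrow> b \<in> carrier A \<Longrightarrow> tens a k \<otimes>\<^bsub>S\<^esub> tens b l = tens (a \<otimes> b) (k * l)"
  by (simp add: tens_eq coset_ops R_closed mult_R_of)

lemma tens_one: "tens \<one> 1 = \<one>\<^bsub>S\<^esub>"
  by (simp add: tens_eq coset_ops)

lemma tens_zero_left [simp]: "tens \<zero> k = \<zero>\<^bsub>S\<^esub>"
  using tens_add_left[of \<zero> \<zero> k] by (simp add: ext.add.l_cancel_one')

lemma tens_zero_right [simp]: "a \<in> carrier A \<Longrightarrow> tens a 0 = \<zero>\<^bsub>S\<^esub>"
  using tens_add_right[of a 0 0] by (simp add: ext.add.l_cancel_one')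

lemma ext_smult: "k \<odot>\<^bsub>S\<^esub> x = tens \<one> k \<otimes>\<^bsub>S\<^esub> x"
  by (rule coset_ops)

lemma smult_tens: "a \<in> carrier A \<Longrightarrow> k \<odot>\<^bsub>S\<^esub> tens a l = tens a (k * l)"
  by (simp add: ext_smult tens_mult)

lemma ext_induct [consumes 1, case_names tens add]:
  assumes "x \<in> carrier S"
    and tens: "\<And>a k. a \<in> carrier A \<Longrightarrow> P (tens a k)"
    and add: "\<And>x y. x \<in> carrier S \<Longrightarrow> y \<in> carrier S \<Longrightarrow> P x \<Longrightarrow> P y \<Longrightarrow> P (x \<oplus>\<^bsub>S\<^esub> y)"
  shows "P x"
proof -
  from assms(1) obtain u where u: "u \<in> carrier R" "x = coset u" by (auto simp: carrier_S)
  from u(1) have "u \<in> carrier R \<and> P (coset u) \<and> P (coset (- u))"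
  proof (induction u rule: R_induct)
    case zero
    then show ?case using tens[of \<zero> 0] by (simp add: coset_ops R_closed)
  next
    case (gen a k)
    have "\<ominus>\<^bsub>S\<^esub> tens a k = tens a (- k)"
      using gen tens_add_right[of a "- k" k] by (intro ext.minus_equality) auto
    moreover have "\<ominus>\<^bsub>S\<^esub> tens a k = coset (- frag_of (a, k))"
      using gen by (intro ext.minus_equality) (auto simp: tens_eq coset_ops R_closed carrier_S)
    ultimately have "coset (- frag_of (a, k)) = tens a (- k)" by simp
    with gen show ?case using tens by (auto simp: R_closed simp flip: tens_eq)
  next
    case (add u v)
    then show ?case
      using assms(3)[of "coset u" "coset v"] assms(3)[of "coset (- u)" "coset (- v)"]
      by (auto simp: coset_ops R_closed carrier_S)
  qed (auto simp: R_closed)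
  with u show ?thesis by simp
qed

lemma scalar_central:
  assumes "x \<in> carrier S"
  shows "tens \<one> k \<otimes>\<^bsub>S\<^esub> x = x \<otimes>\<^bsub>S\<^esub> tens \<one> k"
  using assms
  by (induction rule: ext_induct) (auto simp: tens_mult mult.commute ext.l_distr ext.r_distr)

lemma assoc_algebra_S: "assoc_algebra S"
proof -
  have "Module.module (ring_of_type_algebra :: 'k ring) S"
  proof (rule moduleI)
    show "cring (ring_of_type_algebra :: 'k ring)" by (rule cring_from_type_algebra)
    show "abelian_group S" by (rule ext.abelian_group_axioms)
  qed (auto simp: ext_smult ring_of_type_algebra_def tens_add_right ext.l_distr ext.r_distr
      tens_one ext.m_assoc[symmetric] tens_mult)
  moreover have "x \<otimes>\<^bsub>S\<^esub> (tens \<one> c \<otimes>\<^bsub>S\<^esub> y) = tens \<one> c \<otimes>\<^bsub>S\<^esub> (x \<otimes>\<^bsub>S\<^esub> y)"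
    if "x \<in> carrier S" "y \<in> carrier S" for x y c
  proof -
    have "x \<otimes>\<^bsub>S\<^esub> (tens \<one> c \<otimes>\<^bsub>S\<^esub> y) = (x \<otimes>\<^bsub>S\<^esub> tens \<one> c) \<otimes>\<^bsub>S\<^esub> y"
      using that by (simp add: ext.m_assoc)
    also have "\<dots> = tens \<one> c \<otimes>\<^bsub>S\<^esub> (x \<otimes>\<^bsub>S\<^esub> y)"
      using that by (simp add: ext.m_assoc flip: scalar_central)
    finally show ?thesis .
  qed
  ultimately show ?thesis
    by (intro assoc_algebra.intro assoc_algebra_axioms.intro ring_S)
      (auto simp: ext_smult ext.m_assoc)
qed

sublocale extm: assoc_algebra S by (rule assoc_algebra_S)

text \<open>The universal property of the tensor product, with values in any abelian group. It is
  the source of the linear forms on \<open>S\<close>, of the coordinate maps to \<open>A\<close>,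
  and of the extension of \<epsilon>.\<close>

lemma lift_exists:
  fixes M (structure)
  assumes "abelian_group M"
    and "\<And>a k. a \<in> carrier A \<Longrightarrow> h a k \<in> carrier M"
    and "\<And>a b k. a \<in> carrier A \<Longrightarrow> b \<in> carrier A \<Longrightarrow> h (a \<oplus>\<^bsub>A\<^esub> b) k = h a k \<oplus>\<^bsub>M\<^esub> h b k"
    and "\<And>a k l. a \<in> carrier A \<Longrightarrow> h a (k + l) = h a k \<oplus>\<^bsub>M\<^esub> h a l"
    and "\<And>a c k. a \<in> carrier A \<Longrightarrow> h (c \<odot>\<^bsub>A\<^esub> a) k = h a (\<iota> c * k)"
  obtains H where "\<And>a k. a \<in> carrier A \<Longrightarrow> H (tens a k) = h a k"
    "\<And>x. x \<in> carrier S \<Longrightarrow> H x \<in> carrier M"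
    "\<And>x y. x \<in> carrier S \<Longrightarrow> y \<in> carrier S \<Longrightarrow> H (x \<oplus>\<^bsub>S\<^esub> y) = H x \<oplus>\<^bsub>M\<^esub> H y"
proof -
  interpret Ab: abelian_group M by fact
  have "(\<lambda>(a, k). h a k) ` (carrier A \<times> UNIV) \<subseteq> carrier (add_monoid M)"
    using assms(2) by auto
  then obtain g where g: "g \<in> hom (free_Abelian_group (carrier A \<times> UNIV)) (add_monoid M)"
    and gen: "\<And>x. x \<in> carrier A \<times> UNIV \<Longrightarrow> g (frag_of x) = (\<lambda>(a, k). h a k) x"
    using comm_group.free_Abelian_group_universal[OF Ab.a_comm_group,
        of "\<lambda>(a, k). h a k" "carrier A \<times> UNIV"] by blast
  have gc: "g u \<in> carrier M" if "u \<in> carrier R" for u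
    using g that by (auto simp: hom_def carrier_R)
  have gadd: "g (u + v) = g u \<oplus>\<^bsub>M\<^esub> g v" if "u \<in> carrier R" "v \<in> carrier R" for u v
    using g that by (auto simp: hom_def carrier_R)
  have g0: "g 0 = \<zero>\<^bsub>M\<^esub>"
    using gadd[of 0 0] gc[of 0] by (simp add: R_closed Ab.add.l_cancel_one')
  have gminus: "g (- u) = \<ominus>\<^bsub>M\<^esub> g u" if "u \<in> carrier R" for u
    using gadd[of "- u" u] gc[of u] gc[of "- u"] that g0 Ab.minus_equality by (simp add: R_closed)
  have gdiff: "g (u - v) = g u \<ominus>\<^bsub>M\<^esub> g v" if "u \<in> carrier R" "v \<in> carrier R" for u v
    using gadd[of u "- v"] gminus[of v] that by (simp add: R_closed a_minus_def)
  have cancel: "x \<oplus>\<^bsub>M\<^esub> y \<ominus>\<^bsub>M\<^esub> x \<ominus>\<^bsub>M\<^esub> y = \<zero>\<^bsub>M\<^esub>" if "x \<in> carrier M" "y \<in> carrier M" for x y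
  proof -
    have "x \<oplus>\<^bsub>M\<^esub> y \<ominus>\<^bsub>M\<^esub> x \<ominus>\<^bsub>M\<^esub> y = y \<oplus>\<^bsub>M\<^esub> (x \<oplus>\<^bsub>M\<^esub> \<ominus>\<^bsub>M\<^esub> x) \<oplus>\<^bsub>M\<^esub> \<ominus>\<^bsub>M\<^esub> y"
      using that by (simp only: a_minus_def Ab.a_comm[of x y] Ab.a_assoc Ab.a_closed Ab.a_inv_closed)
    then show ?thesis using that by (simp add: Ab.r_neg)
  qed
  have N0: "u \<in> carrier R \<and> g u = \<zero>\<^bsub>M\<^esub>" if "u \<in> N" for u
    using that
  proof (induction u rule: N_induct)
    case (rel r)
    then have "r \<in> carrier R" using relations_subset by auto
    moreover from rel have "g r = \<zero>\<^bsub>M\<^esub>"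
      by (cases rule: relations_cases)
        (auto simp: gdiff R_closed gen assms(2-5) cancel, auto simp: a_minus_def Ab.r_neg assms(2))
    ultimately show ?case by simp
  qed (auto simp: gadd gminus g0 R_closed)
  \<comment> \<open>Any representative gives the same value, since \<open>g\<close> vanishes on
    \<open>N\<close>.\<close>
  define H where "H x = g (SOME u. u \<in> carrier R \<and> x = coset u)" for x
  have H: "H (coset u) = g u" if u: "u \<in> carrier R" for u
  proof -
    let ?v = "SOME v. v \<in> carrier R \<and> coset u = coset v"
    have v: "?v \<in> carrier R \<and> coset u = coset ?v" by (rule someI[of _ u]) (use u in simp)
    then have "g (u - ?v) = \<zero>\<^bsub>M\<^esub>" using N0 coset_eq_iff by blast
    with v u gc gadd[of "u - ?v" ?v] have "g u = g ?v" by (simp add: R_closed)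
    then show ?thesis by (simp add: H_def)
  qed
  show thesis
  proof (rule that[of H])
    show "H (tens a k) = h a k" if "a \<in> carrier A" for a k
      using that by (simp add: tens_eq H R_closed gen)
  qed (auto simp: carrier_S H gc coset_ops gadd R_closed)
qed

text \<open>The additive extension of \<open>g\<close> maps \<open>N\<close> into \<open>N\<close>,
  so all members of a coset are sent into one coset and the union defining \<open>tensor_map\<close>
  collapses to it.\<close>

lemma tensor_map:
  fixes g :: "'a \<times> 'k \<Rightarrow> 'a \<times> 'k"
  defines "h \<equiv> \<lambda>a k. tens (fst (g (a, k))) (snd (g (a, k)))"
  assumes cl: "\<And>a k. a \<in> carrier A \<Longrightarrow> fst (g (a, k)) \<in> carrier A"
    and h: "\<And>a b k. a \<in> carrier A \<Longrightarrow> b \<in> carrier A \<Longrightarrow> h (a \<oplus> b) k = h a k \<oplus>\<^bsub>S\<^esub> h b k"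
      "\<And>a k l. a \<in> carrier A \<Longrightarrow> h a (k + l) = h a k \<oplus>\<^bsub>S\<^esub> h a l"
      "\<And>a c k. a \<in> carrier A \<Longrightarrow> h (c \<odot> a) k = h a (\<iota> c * k)"
  shows "a \<in> carrier A \<Longrightarrow> tensor_map \<iota> A g (tens a k) = h a k"
    and "x \<in> carrier S \<Longrightarrow> tensor_map \<iota> A g x \<in> carrier S"
    and "x \<in> carrier S \<Longrightarrow> y \<in> carrier S \<Longrightarrow>
      tensor_map \<iota> A g (x \<oplus>\<^bsub>S\<^esub> y) = tensor_map \<iota> A g x \<oplus>\<^bsub>S\<^esub> tensor_map \<iota> A g y"
proof -
  let ?E = "frag_extend (\<lambda>p. frag_of (g p))"
  have gR: "frag_of (g (a, k)) \<in> carrier R" if "a \<in> carrier A" for a k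
    using cl[OF that, of k] by (cases "g (a, k)") (simp add: R_closed)
  have EN: "?E u \<in> N" if "u \<in> N" for u
    using that
  proof (induction u rule: N_induct)
    case (rel r)
    then show ?case
    proof (cases rule: relations_cases)
      case (left a b k)
      with h(1)[of a b k] cl[of a k] cl[of b k] cl[of "a \<oplus> b" k] show ?thesis
        by (simp add: h_def frag_extend_diff frag_extend_add tens_eq coset_ops gR coset_eq_iff diff_diff_eq)
    next
      case (right a k l)
      with h(2)[of a k l] cl[of a] show ?thesis
        by (simp add: h_def frag_extend_diff frag_extend_add tens_eq coset_ops gR coset_eq_iff diff_diff_eq)
    next
      case (balance a c k)
      with h(3)[of a c k] cl[of a] cl[of "c \<odot> a"] show ?thesis
        by (simp add: h_def frag_extend_diff tens_eq coset_ops R_closed coset_eq_iff)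
    qed
  qed (auto simp: N_closed frag_extend_add frag_extend_minus)
  have ER: "?E u \<in> carrier R" if "u \<in> carrier R" for u
    using that
  proof (induction u rule: R_induct)
    case (gen a k)
    then show ?case by (simp add: gR)
  qed (auto simp: R_closed frag_extend_add frag_extend_minus)
  have tm: "tensor_map \<iota> A g (coset u) = coset (?E u)" for u
  proof -
    have "coset (?E v) = coset (?E u)" if "v \<in> coset u" for v
      using EN[of "v - u"] that by (simp add: mem_coset coset_eq_iff frag_extend_diff)
    then show ?thesis
      unfolding tensor_map_def coset_def[symmetric] using coset_self[of u] by blast
  qed
  show "tensor_map \<iota> A g (tens a k) = h a k" if "a \<in> carrier A"
    using cl[OF that, of k] by (simp add: tens_eq tm h_def)
  show "tensor_map \<iota> A g x \<in> carrier S" if "x \<in> carrier S"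
    using that by (auto simp: carrier_S tm ER)
  show "tensor_map \<iota> A g (x \<oplus>\<^bsub>S\<^esub> y) = tensor_map \<iota> A g x \<oplus>\<^bsub>S\<^esub> tensor_map \<iota> A g y"
    if "x \<in> carrier S" "y \<in> carrier S"
    using that by (auto simp: carrier_S coset_ops tm ER R_closed frag_extend_add)
qed

end

section \<open>Coordinates over the base field\<close>

lemma additive_finsum:
  assumes "abelian_group G" "abelian_group M"
    and cl: "\<And>x. x \<in> carrier G \<Longrightarrow> h x \<in> carrier M"
    and add: "\<And>x y. x \<in> carrier G \<Longrightarrow> y \<in> carrier G \<Longrightarrow> h (x \<oplus>\<^bsub>G\<^esub> y) = h x \<oplus>\<^bsub>M\<^esub> h y"
  shows "h \<zero>\<^bsub>G\<^esub> = \<zero>\<^bsub>M\<^esub>"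
    and "x \<in> carrier G \<Longrightarrow> h (\<ominus>\<^bsub>G\<^esub> x) = \<ominus>\<^bsub>M\<^esub> h x"
    and "finite I \<Longrightarrow> g \<in> I \<rightarrow> carrier G \<Longrightarrow>
      h (\<Oplus>\<^bsub>G\<^esub>i\<in>I. g i) = (\<Oplus>\<^bsub>M\<^esub>i\<in>I. h (g i))"
proof -
  interpret G: abelian_group G by fact
  interpret Ab: abelian_group M by fact
  show 0: "h \<zero>\<^bsub>G\<^esub> = \<zero>\<^bsub>M\<^esub>"
    using add[of "\<zero>\<^bsub>G\<^esub>" "\<zero>\<^bsub>G\<^esub>"] cl[of "\<zero>\<^bsub>G\<^esub>"] by (simp add: Ab.add.l_cancel_one')
  show "h (\<ominus>\<^bsub>G\<^esub> x) = \<ominus>\<^bsub>M\<^esub> h x" if "x \<in> carrier G"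
    using add[of "\<ominus>\<^bsub>G\<^esub> x" x] that by (intro Ab.minus_equality[symmetric]) (auto simp: cl 0 G.l_neg)
  show "h (\<Oplus>\<^bsub>G\<^esub>i\<in>I. g i) = (\<Oplus>\<^bsub>M\<^esub>i\<in>I. h (g i))" if "finite I" "g \<in> I \<rightarrow> carrier G"
    using that
  proof (induction I rule: finite_induct)
    case (insert i I)
    then have "(\<lambda>i. h (g i)) \<in> I \<rightarrow> carrier M" using cl by auto
    with insert show ?case by (simp add: G.finsum_insert Ab.finsum_insert cl add G.finsum_closed Pi_def)
  qed (simp add: 0)
qed

text \<open>The parameter \<kappa> is the map on scalars: \<open>id\<close> for forms on a scalar
  extension, \<iota> for forms on an algebra over the base field with values in the extension
  field.\<close>

definition semilinear_form :: "('f \<Rightarrow> 'k::field) \<Rightarrow> ('f, 'a) module \<Rightarrow> ('a \<Rightarrow> 'k) \<Rightarrow> bool" where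
  "semilinear_form \<kappa> A g \<longleftrightarrow>
     (\<forall>x\<in>carrier A. \<forall>y\<in>carrier A. g (x \<oplus>\<^bsub>A\<^esub> y) = g x + g y) \<and>
     (\<forall>c. \<forall>x\<in>carrier A. g (c \<odot>\<^bsub>A\<^esub> x) = \<kappa> c * g x)"

lemma semilinear_form_finsum:
  assumes "abelian_group A" "semilinear_form \<kappa> A g"
  shows "g \<zero>\<^bsub>A\<^esub> = 0"
    and "x \<in> carrier A \<Longrightarrow> g (\<ominus>\<^bsub>A\<^esub> x) = - g x"
    and "finite I \<Longrightarrow> x' \<in> I \<rightarrow> carrier A \<Longrightarrow> g (\<Oplus>\<^bsub>A\<^esub>i\<in>I. x' i) = (\<Sum>i\<in>I. g (x' i))"
proof -
  interpret A: abelian_group A by fact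
  have add: "g (x \<oplus>\<^bsub>A\<^esub> y) = g x + g y" if "x \<in> carrier A" "y \<in> carrier A" for x y
    using that assms(2) by (simp add: semilinear_form_def)
  show 0: "g \<zero>\<^bsub>A\<^esub> = 0"
    using add[of "\<zero>\<^bsub>A\<^esub>" "\<zero>\<^bsub>A\<^esub>"] by (metis A.l_zero A.zero_closed add_cancel_right_right)
  show "g (\<ominus>\<^bsub>A\<^esub> x) = - g x" if "x \<in> carrier A"
    using add[of "\<ominus>\<^bsub>A\<^esub> x" x] that by (simp add: A.l_neg 0 eq_neg_iff_add_eq_0)
  show "g (\<Oplus>\<^bsub>A\<^esub>i\<in>I. x' i) = (\<Sum>i\<in>I. g (x' i))" if "finite I" "x' \<in> I \<rightarrow> carrier A"
    using that by (induction I rule: finite_induct) (auto simp: 0 A.finsum_insert add A.finsum_closed)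
qed

section \<open>A basis of the field extension and coordinates of tensors\<close>

context scalar_extension
begin

sublocale K: vector_space "\<lambda>c k. \<iota> c * k"
  by unfold_locales (simp_all add: algebra_simps hom_add hom_mult)

text \<open>The basis is made to contain \<open>1\<close> so that the coordinate at \<open>1\<close>
  is a linear retraction of \<iota> onto the base field.\<close>

definition "B = K.extend_basis {1}"

definition "\<kappa> b k = K.representation B k b"

lemma independent_B: "K.independent B"
  unfolding B_def by (rule K.independent_extend_basis) simp

lemma span_B [simp]: "k \<in> K.span B"
  unfolding B_def using K.span_extend_basis[of "{1}"] by simp

lemma one_B: "1 \<in> B"
  unfolding B_def using K.extend_basis_superset[of "{1}"] by simp

lemma kappa_add: "\<kappa> b (k + l) = \<kappa> b k + \<kappa> b l"
  by (simp add: \<kappa>_def K.representation_add[OF independent_B])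

lemma kappa_scale: "\<kappa> b (\<iota> c * k) = c * \<kappa> b k"
  by (simp add: \<kappa>_def K.representation_scale[OF independent_B])

lemma kappa_scale': "\<kappa> b (k * \<iota> c) = c * \<kappa> b k"
  by (simp add: kappa_scale mult.commute[of k])

lemma kappa_basis: "b' \<in> B \<Longrightarrow> \<kappa> b b' = (if b = b' then 1 else 0)"
  by (simp add: \<kappa>_def K.representation_basis[OF independent_B])

lemma kappa_support: "finite {b. \<kappa> b k \<noteq> 0}" "{b. \<kappa> b k \<noteq> 0} \<subseteq> B"
  using K.finite_representation[of B k] K.representation_ne_zero[of B k] by (auto simp: \<kappa>_def)

lemma kappa_expand:
  assumes "finite I" "{b. \<kappa> b k \<noteq> 0} \<subseteq> I"
  shows "k = (\<Sum>b\<in>I. \<iota> (\<kappa> b k) * b)"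
proof -
  have "k = (\<Sum>b | \<kappa> b k \<noteq> 0. \<iota> (\<kappa> b k) * b)"
    unfolding \<kappa>_def by (rule K.sum_nonzero_representation_eq[OF independent_B span_B, symmetric])
  also have "\<dots> = (\<Sum>b\<in>I. \<iota> (\<kappa> b k) * b)"
    by (rule sum.mono_neutral_left) (use assms in auto)
  finally show ?thesis .
qed

lemma kappa_one: "\<kappa> 1 (\<iota> c) = c"
  using kappa_scale[of 1 c 1] kappa_basis[OF one_B, of 1] by simp

lemma form_lift_exists:
  assumes "semilinear_form \<iota> A g"
  shows "\<exists>G. semilinear_form id S G \<and> (\<forall>a\<in>carrier A. \<forall>k. G (tens a k) = k * g a)"
proof -
  have "abelian_group (ring_of_type_algebra :: 'k ring)"
    using cring_from_type_algebra by (rule ring.is_abelian_group[OF cring.axioms(1)])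
  then obtain G where G: "\<And>a k. a \<in> carrier A \<Longrightarrow> G (tens a k) = k * g a"
    "\<And>x y. x \<in> carrier S \<Longrightarrow> y \<in> carrier S \<Longrightarrow> G (x \<oplus>\<^bsub>S\<^esub> y) = G x + G y"
    by (rule lift_exists[where h = "\<lambda>a k. k * g a"])
      (use assms in \<open>auto simp: semilinear_form_def ring_of_type_algebra_def algebra_simps\<close>)
  have "G (c \<odot>\<^bsub>S\<^esub> x) = c * G x" if "x \<in> carrier S" for c x
    using that by (induction rule: ext_induct)
      (simp_all add: smult_tens G extm.smult_add_vector algebra_simps)
  then show ?thesis by (intro exI[of _ G]) (auto simp: semilinear_form_def G)
qed

lemma forms_agree:
  assumes "semilinear_form id S G" "semilinear_form id S G'"
    and "\<And>a. a \<in> carrier A \<Longrightarrow> G (tens a 1) = G' (tens a 1)"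
    and "x \<in> carrier S"
  shows "G x = G' x"
  using assms(4)
proof (induction rule: ext_induct)
  case (tens a k)
  then have "tens a k = k \<odot>\<^bsub>S\<^esub> tens a 1" by (simp add: smult_tens)
  with tens assms show ?case by (simp add: semilinear_form_def)
qed (use assms in \<open>auto simp: semilinear_form_def\<close>)

text \<open>The map \<open>id \<otimes> \<kappa> b\<close> from the scalar extension back to
  \<open>A\<close>. Over all basis elements \<open>b\<close> these maps present \<open>S\<close> as
  a direct sum of copies of \<open>A\<close>.\<close>

definition slice_map :: "'k \<Rightarrow> (('a, 'k) tensor \<Rightarrow> 'a) \<Rightarrow> bool" where
  "slice_map b H \<longleftrightarrow> (\<forall>a\<in>carrier A. \<forall>k. H (tens a k) = \<kappa> b k \<odot> a) \<and>
     (\<forall>x\<in>carrier S. H x \<in> carrier A) \<and>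
     (\<forall>x\<in>carrier S. \<forall>y\<in>carrier S. H (x \<oplus>\<^bsub>S\<^esub> y) = H x \<oplus> H y)"

definition "slice b = (SOME H. slice_map b H)"

lemma slice_map: "slice_map b (slice b)"
proof -
  obtain H where "\<And>a k. a \<in> carrier A \<Longrightarrow> H (tens a k) = \<kappa> b k \<odot> a"
    "\<And>x. x \<in> carrier S \<Longrightarrow> H x \<in> carrier A"
    "\<And>x y. x \<in> carrier S \<Longrightarrow> y \<in> carrier S \<Longrightarrow> H (x \<oplus>\<^bsub>S\<^esub> y) = H x \<oplus> H y"
    by (rule lift_exists[OF is_abelian_group, of "\<lambda>a k. \<kappa> b k \<odot> a"])
      (auto simp: smult_add_vector smult_add_scalar kappa_add smult_smult kappa_scale
        kappa_scale' mult.commute)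
  then have "\<exists>H. slice_map b H" unfolding slice_map_def by blast
  then show ?thesis unfolding slice_def by (rule someI_ex)
qed

lemma slice_tens: "a \<in> carrier A \<Longrightarrow> slice b (tens a k) = \<kappa> b k \<odot> a"
  and slice_closed [simp]: "x \<in> carrier S \<Longrightarrow> slice b x \<in> carrier A"
  and slice_add: "x \<in> carrier S \<Longrightarrow> y \<in> carrier S \<Longrightarrow> slice b (x \<oplus>\<^bsub>S\<^esub> y) = slice b x \<oplus> slice b y"
  using slice_map[of b] by (auto simp: slice_map_def)

lemma abelian_group_S: "abelian_group S"
  by (rule ring.axioms(1)[OF ring_S])

lemmas slice_finsum = additive_finsum[OF abelian_group_S is_abelian_group slice_closed slice_add]

text \<open>Together with its right-hand counterpart this makes the slices maps of bimodules over
  \<open>A\<close>: multiplying a tensor by elements of \<open>A\<close> acts on each coordinate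
  separately.\<close>

lemma slice_mult_left:
  assumes "a \<in> carrier A" "x \<in> carrier S"
  shows "slice b (tens a 1 \<otimes>\<^bsub>S\<^esub> x) = a \<otimes> slice b x"
  using assms(2) by (induction rule: ext_induct)
    (use assms(1) in \<open>auto simp: tens_mult slice_tens smult_mult_right ext.r_distr slice_add r_distr\<close>)

lemma slice_mult_right:
  assumes "a \<in> carrier A" "x \<in> carrier S"
  shows "slice b (x \<otimes>\<^bsub>S\<^esub> tens a 1) = slice b x \<otimes> a"
  using assms(2) by (induction rule: ext_induct)
    (use assms(1) in \<open>auto simp: tens_mult slice_tens smult_mult_left ext.l_distr slice_add l_distr\<close>)

lemma slice_tens_finsum:
  assumes "finite I" "I \<subseteq> B" "b \<in> B" "\<And>i. i \<in> I \<Longrightarrow> a i \<in> carrier A"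
  shows "slice b (\<Oplus>\<^bsub>S\<^esub>i\<in>I. tens (a i) i) = (if b \<in> I then a b else \<zero>)"
proof -
  have "slice b (\<Oplus>\<^bsub>S\<^esub>i\<in>I. tens (a i) i) = (\<Oplus>i\<in>I. slice b (tens (a i) i))"
    using assms by (intro slice_finsum(3)) auto
  also have "\<dots> = (\<Oplus>i\<in>I. if b = i then a i else \<zero>)"
    using assms by (intro finsum_cong') (auto simp: slice_tens kappa_basis)
  also have "\<dots> = (if b \<in> I then a b else \<zero>)"
  proof (cases "b \<in> I")
    case True
    then show ?thesis using assms by (simp add: finsum_singleton)
  next
    case False
    then have "(\<Oplus>i\<in>I. if b = i then a i else \<zero>) = (\<Oplus>i\<in>I. \<zero>)"
      by (intro finsum_cong') auto
    with False show ?thesis by (simp add: finsum_zero)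
  qed
  finally show ?thesis .
qed

lemma tens_sum:
  assumes "finite I" "a \<in> carrier A"
  shows "tens a (\<Sum>i\<in>I. k i) = (\<Oplus>\<^bsub>S\<^esub>i\<in>I. tens a (k i))"
  using assms(1) by (induction I rule: finite_induct)
    (use assms(2) in \<open>auto simp: tens_add_right ext.finsum_insert\<close>)

definition "expands J x \<longleftrightarrow> (\<Oplus>\<^bsub>S\<^esub>b\<in>J. tens (slice b x) b) = x"

text \<open>The claim covers every larger finite \<open>J\<close> because the expansions of two
  summands must be brought to a common index set before they can be added.\<close>

lemma slice_expand_ex:
  assumes "x \<in> carrier S"
  shows "\<exists>I. finite I \<and> I \<subseteq> B \<and> (\<forall>J. finite J \<and> I \<subseteq> J \<and> J \<subseteq> B \<longrightarrow> expands J x)"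
  using assms
proof (induction rule: ext_induct)
  case (tens a k)
  have "expands J (tens a k)" if J: "finite J" "{b. \<kappa> b k \<noteq> 0} \<subseteq> J" for J
  proof -
    have "tens a k = tens a (\<Sum>b\<in>J. \<iota> (\<kappa> b k) * b)" using kappa_expand[OF J] by simp
    also have "\<dots> = (\<Oplus>\<^bsub>S\<^esub>b\<in>J. tens a (\<iota> (\<kappa> b k) * b))" using J(1) tens by (rule tens_sum)
    also have "\<dots> = (\<Oplus>\<^bsub>S\<^esub>b\<in>J. tens (slice b (tens a k)) b)"
      using tens by (intro ext.finsum_cong') (auto simp: slice_tens tens_smult)
    finally show ?thesis by (simp add: expands_def)
  qed
  then show ?case using kappa_support[of k] by blast
next
  case (add x y)
  from add.IH(1) obtain I where
    I: "finite I \<and> I \<subseteq> B \<and> (\<forall>J. finite J \<and> I \<subseteq> J \<and> J \<subseteq> B \<longrightarrow> expands J x)" ..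
  from add.IH(2) obtain I' where
    I': "finite I' \<and> I' \<subseteq> B \<and> (\<forall>J. finite J \<and> I' \<subseteq> J \<and> J \<subseteq> B \<longrightarrow> expands J y)" ..
  have "expands J (x \<oplus>\<^bsub>S\<^esub> y)" if J: "finite J" "I \<union> I' \<subseteq> J" "J \<subseteq> B" for J
  proof -
    have "(\<Oplus>\<^bsub>S\<^esub>b\<in>J. tens (slice b (x \<oplus>\<^bsub>S\<^esub> y)) b) =
        (\<Oplus>\<^bsub>S\<^esub>b\<in>J. tens (slice b x) b \<oplus>\<^bsub>S\<^esub> tens (slice b y) b)"
      using add.hyps by (intro ext.finsum_cong') (auto simp: slice_add tens_add_left)
    also have "\<dots> = (\<Oplus>\<^bsub>S\<^esub>b\<in>J. tens (slice b x) b) \<oplus>\<^bsub>S\<^esub> (\<Oplus>\<^bsub>S\<^esub>b\<in>J. tens (slice b y) b)"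
      using add.hyps by (intro ext.finsum_addf) auto
    also have "\<dots> = x \<oplus>\<^bsub>S\<^esub> y"
      using I I' J by (auto simp: expands_def)
    finally show ?thesis by (simp add: expands_def)
  qed
  with I I' show ?case by (intro exI[of _ "I \<union> I'"]) auto
qed

definition "support x = {b \<in> B. slice b x \<noteq> \<zero>}"

lemma
  assumes "x \<in> carrier S"
  shows finite_support: "finite (support x)"
    and slice_expand: "(\<Oplus>\<^bsub>S\<^esub>b\<in>support x. tens (slice b x) b) = x"
proof -
  from slice_expand_ex[OF assms] obtain I where I: "finite I" "I \<subseteq> B"
    and x: "expands I x" by blast
  have "slice b x = \<zero>" if "b \<in> B - I" for b
    using slice_tens_finsum[of I b "\<lambda>b. slice b x"] that I assms x by (simp add: expands_def)
  then have sub: "support x \<subseteq> I" by (auto simp: support_def)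
  then show "finite (support x)" using I(1) finite_subset by blast
  have "(\<Oplus>\<^bsub>S\<^esub>b\<in>I. tens (slice b x) b) = (\<Oplus>\<^bsub>S\<^esub>b\<in>support x. tens (slice b x) b)"
    using sub I assms by (intro ext.add.finprod_mono_neutral_cong_right) (auto simp: support_def)
  with x show "(\<Oplus>\<^bsub>S\<^esub>b\<in>support x. tens (slice b x) b) = x" by (simp add: expands_def)
qed

lemma slices_zero:
  assumes "x \<in> carrier S" "\<And>b. b \<in> B \<Longrightarrow> slice b x = \<zero>"
  shows "x = \<zero>\<^bsub>S\<^esub>"
proof -
  have "support x = {}" using assms by (auto simp: support_def)
  with slice_expand[OF assms(1)] show ?thesis by simp
qed

end

section \<open>Linear independence and dimension\<close>

context assoc_algebra
begin

text \<open>Families indexed by a set, with coefficients in the field type, suit double indices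
  better than lists with coefficients in \<open>scalars A\<close>. The lemmas
  \<open>Span_map\<close> and \<open>independent_map\<close> translate between the two.\<close>

definition lin_indep :: "'i set \<Rightarrow> ('i \<Rightarrow> 'a) \<Rightarrow> bool" where
  "lin_indep I u \<longleftrightarrow> (\<forall>c. (\<Oplus>i\<in>I. c i \<odot> u i) = \<zero> \<longrightarrow> (\<forall>i\<in>I. c i = 0))"

definition lin_span :: "'i set \<Rightarrow> ('i \<Rightarrow> 'a) \<Rightarrow> 'a set" where
  "lin_span I u = range (\<lambda>c. \<Oplus>i\<in>I. c i \<odot> u i)"

lemma minus_smult: "x \<in> carrier A \<Longrightarrow> \<ominus> (c \<odot> x) = (- c) \<odot> x"
  by (rule minus_equality) (simp_all flip: smult_add_scalar)

lemma scalar_mult: "x \<in> carrier A \<Longrightarrow> (c \<odot> \<one>) \<otimes> x = c \<odot> x"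
  by (simp add: smult_mult_left)

lemma subfield_scalars:
  assumes "\<one> \<noteq> \<zero>"
  shows "subfield (scalars A) A"
proof (rule subfieldI)
  have mult: "(c \<odot> \<one>) \<otimes> (d \<odot> \<one>) = (c * d) \<odot> \<one>" for c d
    by (simp add: scalar_mult smult_smult)
  show "subcring (scalars A) A"
  proof (rule subcringI[OF subringI])
    show "\<one> \<in> scalars A" unfolding scalars_def by (rule image_eqI[of _ _ 1]) simp_all
  qed (auto simp: scalars_def minus_smult mult mult.commute simp flip: smult_add_scalar)
  have "c \<odot> \<one> \<in> Units (A \<lparr>carrier := scalars A\<rparr>) \<longleftrightarrow> c \<odot> \<one> \<noteq> \<zero>" for c
  proof
    assume "c \<odot> \<one> \<in> Units (A \<lparr>carrier := scalars A\<rparr>)"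
    then obtain d where "(c \<odot> \<one>) \<otimes> (d \<odot> \<one>) = \<one>"
      unfolding Units_def by (auto simp: scalars_def)
    with assms show "c \<odot> \<one> \<noteq> \<zero>" by auto
  next
    assume "c \<odot> \<one> \<noteq> \<zero>"
    then have "c \<noteq> 0" by auto
    then show "c \<odot> \<one> \<in> Units (A \<lparr>carrier := scalars A\<rparr>)"
      unfolding Units_def by (auto simp: scalars_def mult intro!: exI[of _ "inverse c"])
  qed
  then show "Units (A\<lparr>carrier := scalars A\<rparr>) = scalars A - {\<zero>}"
    by (auto simp: Units_def scalars_def) 
qed

lemma combine_eq_finsum:
  assumes "distinct js" "\<And>i. i \<in> set js \<Longrightarrow> u i \<in> carrier A"
  shows "combine (map (\<lambda>i. c i \<odot> \<one>) js) (map u js) = (\<Oplus>i\<in>set js. c i \<odot> u i)"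
  using assms by (induction js) (auto simp: scalar_mult finsum_insert Pi_def)

lemma scalar_list:
  assumes "distinct js" "length Ks = length js" "set Ks \<subseteq> scalars A"
  shows "\<exists>c. Ks = map (\<lambda>i. c i \<odot> \<one>) js"
  using assms
proof (induction js arbitrary: Ks)
  case (Cons j js)
  then obtain d Ks' where Ks: "Ks = (d \<odot> \<one>) # Ks'"
    by (cases Ks) (auto simp: scalars_def)
  with Cons obtain c where "Ks' = map (\<lambda>i. c i \<odot> \<one>) js" by fastforce
  with Ks Cons.prems(1) have "Ks = map (\<lambda>i. (c(j := d)) i \<odot> \<one>) (j # js)" by auto
  then show ?case by blast
qed simp

lemma Span_map:
  assumes "\<one> \<noteq> \<zero>" "distinct js" "\<And>i. i \<in> set js \<Longrightarrow> u i \<in> carrier A"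
  shows "Span (scalars A) (map u js) = lin_span (set js) u"
proof -
  have us: "set (map u js) \<subseteq> carrier A" using assms(3) by auto
  have "a \<in> Span (scalars A) (map u js) \<longleftrightarrow> a \<in> lin_span (set js) u" for a
  proof
    assume "a \<in> Span (scalars A) (map u js)"
    then obtain Ks where Ks: "set Ks \<subseteq> scalars A" "length Ks = length js" "a = combine Ks (map u js)"
      using Span_mem_iff_length_version[OF subfield_scalars[OF assms(1)] us] by auto
    then obtain c where "Ks = map (\<lambda>i. c i \<odot> \<one>) js" using scalar_list[OF assms(2)] by blast
    with Ks(3) have "a = (\<Oplus>i\<in>set js. c i \<odot> u i)" by (simp add: combine_eq_finsum[OF assms(2,3)])
    then show "a \<in> lin_span (set js) u" unfolding lin_span_def by blast
  next
    assume "a \<in> lin_span (set js) u"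
    then obtain c where "a = combine (map (\<lambda>i. c i \<odot> \<one>) js) (map u js)"
      using combine_eq_finsum[OF assms(2,3)] unfolding lin_span_def by auto
    then show "a \<in> Span (scalars A) (map u js)"
      unfolding Span_mem_iff_length_version[OF subfield_scalars[OF assms(1)] us]
      by (intro exI[of _ "map (\<lambda>i. c i \<odot> \<one>) js"]) (auto simp: scalars_def)
  qed
  then show ?thesis by blast
qed

lemma independent_map:
  assumes "\<one> \<noteq> \<zero>" "distinct js" "\<And>i. i \<in> set js \<Longrightarrow> u i \<in> carrier A"
  shows "independent (scalars A) (map u js) \<longleftrightarrow> lin_indep (set js) u"
proof
  have us: "set (map u js) \<subseteq> carrier A" using assms(3) by auto
  note K = subfield_scalars[OF assms(1)]
  have c0: "c \<odot> \<one> = \<zero> \<Longrightarrow> c = 0" for c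
  proof (rule ccontr)
    assume "c \<odot> \<one> = \<zero>" "c \<noteq> 0"
    moreover have "inverse c \<odot> (c \<odot> \<one>) = (inverse c * c) \<odot> \<one>" by (rule smult_smult) simp
    ultimately show False using assms(1) by simp
  qed
  show "lin_indep (set js) u" if ind: "independent (scalars A) (map u js)"
    unfolding lin_indep_def
  proof (intro allI impI ballI)
    fix c i assume 0: "(\<Oplus>i\<in>set js. c i \<odot> u i) = \<zero>" and i: "i \<in> set js"
    have "set (take (length (map u js)) (map (\<lambda>i. c i \<odot> \<one>) js)) \<subseteq> {\<zero>}"
      by (rule independent_imp_trivial_combine[OF K ind])
        (use combine_eq_finsum[OF assms(2,3), where c = c] 0 in \<open>auto simp: scalars_def\<close>)
    with i have "c i \<odot> \<one> = \<zero>" by auto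
    then show "c i = 0" by (rule c0)
  qed
  show "independent (scalars A) (map u js)" if ind: "lin_indep (set js) u"
  proof (rule trivial_combine_imp_independent[OF K us])
    fix Ks assume Ks: "set Ks \<subseteq> scalars A" "combine Ks (map u js) = \<zero>"
    have "set Ks \<subseteq> carrier A" using Ks(1) by (auto simp: scalars_def)
    \<comment> \<open>\<open>combine\<close> drops surplus entries of the longer list, so the
      coefficients are first brought to the length of \<open>js\<close>.\<close>
    from combine_normalize[OF this us Ks(2)] obtain Ks' where
      Ks': "set (take (length (map u js)) Ks) \<subseteq> set Ks'"
      "set Ks' \<subseteq> set (take (length (map u js)) Ks) \<union> {\<zero>}" "length Ks' = length (map u js)"
      "combine Ks' (map u js) = \<zero>" by metis
    have "\<zero> \<in> scalars A" unfolding scalars_def by (rule image_eqI[of _ _ 0]) simp_all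
    moreover have "set (take (length (map u js)) Ks) \<subseteq> scalars A"
      using Ks(1) set_take_subset by fast
    ultimately have "set Ks' \<subseteq> scalars A" using Ks'(2) by blast
    then obtain c where c: "Ks' = map (\<lambda>i. c i \<odot> \<one>) js"
      using scalar_list[OF assms(2), of Ks'] Ks'(3) by auto
    then have "\<forall>i\<in>set js. c i = 0"
      using ind Ks'(4) combine_eq_finsum[OF assms(2,3), where c = c] by (auto simp: lin_indep_def)
    with c have "set Ks' \<subseteq> {\<zero>}" by auto
    with Ks'(1) show "set (take (length (map u js)) Ks) \<subseteq> {\<zero>}" by auto
  qed
qed

lemma has_dim_lin_span:
  assumes "\<one> \<noteq> \<zero>" "finite I" "u \<in> I \<rightarrow> carrier A" "lin_indep I u"
  shows "has_dim A (card I) (lin_span I u)"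
proof -
  obtain js where js: "set js = I" "distinct js" using finite_distinct_list[OF assms(2)] by blast
  have u: "u i \<in> carrier A" if "i \<in> set js" for i using that assms(3) js by auto
  have "has_dim A (length (map u js)) (lin_span I u)"
    using independent_map[OF assms(1) js(2) u] Span_map[OF assms(1) js(2) u] assms(4) js(1)
    by (intro dimensionI[OF subfield_scalars[OF assms(1)]]) auto
  with js show ?thesis by (simp add: distinct_card[symmetric])
qed

lemma has_dim_basis:
  assumes "\<one> \<noteq> \<zero>" "has_dim A m V"
  obtains u :: "nat \<Rightarrow> 'a" where "u \<in> {..<m} \<rightarrow> carrier A" "lin_indep {..<m} u" "V = lin_span {..<m} u"
proof -
  from exists_base[OF subfield_scalars[OF assms(1)] assms(2)] obtain Vs where
    Vs: "set Vs \<subseteq> carrier A" "independent (scalars A) Vs" "length Vs = m" "Span (scalars A) Vs = V"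
    by blast
  have eq: "Vs = map ((!) Vs) [0..<m]" unfolding Vs(3)[symmetric] by (rule map_nth[symmetric])
  have c: "i \<in> set [0..<m] \<Longrightarrow> Vs ! i \<in> carrier A" for i using Vs by auto
  have "lin_indep {..<m} ((!) Vs)"
    using independent_map[OF assms(1) distinct_upt, of 0 m "(!) Vs"] c Vs(2) by (simp add: atLeast0LessThan flip: eq)
  moreover have "V = lin_span {..<m} ((!) Vs)"
    using Span_map[OF assms(1) distinct_upt, of 0 m "(!) Vs"] c Vs(4) by (simp add: atLeast0LessThan flip: eq)
  moreover have "(!) Vs \<in> {..<m} \<rightarrow> carrier A" using c by auto
  ultimately show thesis by (rule that[rotated 1])
qed

lemma lin_span_full:
  assumes "\<one> \<noteq> \<zero>" "has_dim A (card I) (carrier A)" "finite I" "u \<in> I \<rightarrow> carrier A" "lin_indep I u"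
  shows "lin_span I u = carrier A"
proof -
  obtain js where js: "set js = I" "distinct js" using finite_distinct_list[OF assms(3)] by blast
  have u: "u i \<in> carrier A" if "i \<in> set js" for i using that assms(4) js by auto
  have "independent (scalars A) (map u js)"
    using independent_map[OF assms(1) js(2), of u] u assms(5) js(1) by simp
  moreover have "set (map u js) \<subseteq> carrier A" using u by auto
  moreover have "length (map u js) = card I" using js distinct_card by fastforce
  ultimately have "Span (scalars A) (map u js) = carrier A"
    using independent_length_eq_dimension[OF subfield_scalars[OF assms(1)] assms(2)] by blast
  then show ?thesis using Span_map[OF assms(1) js(2) u] js(1) by simp
qed

end

section \<open>Primeness of the scalar extension\<close>

context scalar_extension
begin

text \<open>Sums of maps \<open>y \<mapsto> p y r\<close> with \<open>p\<close> and \<open>r\<close>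
  in \<open>A\<close>. The operator on \<open>A\<close> and the one on \<open>S\<close> are kept as
  a pair because the first is what the second does to each coordinate.\<close>

inductive mult_op :: "('a \<Rightarrow> 'a) \<Rightarrow> (('a, 'k) tensor \<Rightarrow> ('a, 'k) tensor) \<Rightarrow> bool" where
  base: "p \<in> carrier A \<Longrightarrow> r \<in> carrier A \<Longrightarrow>
    mult_op (\<lambda>y. p \<otimes> y \<otimes> r) (\<lambda>x. tens p 1 \<otimes>\<^bsub>S\<^esub> x \<otimes>\<^bsub>S\<^esub> tens r 1)"
| plus: "mult_op m M \<Longrightarrow> mult_op m' M' \<Longrightarrow>
    mult_op (\<lambda>y. m y \<oplus> m' y) (\<lambda>x. M x \<oplus>\<^bsub>S\<^esub> M' x)"

lemma mult_op_closed:
  assumes "mult_op m M"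
  shows "y \<in> carrier A \<Longrightarrow> m y \<in> carrier A" "x \<in> carrier S \<Longrightarrow> M x \<in> carrier S" "m \<zero> = \<zero>"
  using assms by (induction rule: mult_op.induct) auto

lemma mult_op_slice:
  assumes "mult_op m M" "x \<in> carrier S"
  shows "slice b (M x) = m (slice b x)"
  using assms
  by (induction rule: mult_op.induct)
    (auto simp: slice_mult_left slice_mult_right slice_add mult_op_closed)

text \<open>Replacing \<open>x\<close> by \<open>p x r\<close> keeps the condition
  \<open>x a q = 0\<close> for all \<open>a\<close>, because \<open>r a\<close> is again an element
  of \<open>A\<close>.\<close>

lemma mult_op_annihilate:
  assumes "mult_op m M" "x \<in> carrier S" "q \<in> carrier S"
    "\<And>a. a \<in> carrier A \<Longrightarrow> x \<otimes>\<^bsub>S\<^esub> tens a 1 \<otimes>\<^bsub>S\<^esub> q = \<zero>\<^bsub>S\<^esub>" "a \<in> carrier A"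
  shows "M x \<otimes>\<^bsub>S\<^esub> tens a 1 \<otimes>\<^bsub>S\<^esub> q = \<zero>\<^bsub>S\<^esub>"
  using assms(1)
proof (induction rule: mult_op.induct)
  case (base p r)
  have "tens p 1 \<otimes>\<^bsub>S\<^esub> x \<otimes>\<^bsub>S\<^esub> tens r 1 \<otimes>\<^bsub>S\<^esub> tens a 1 \<otimes>\<^bsub>S\<^esub> q =
      tens p 1 \<otimes>\<^bsub>S\<^esub> (x \<otimes>\<^bsub>S\<^esub> (tens r 1 \<otimes>\<^bsub>S\<^esub> tens a 1) \<otimes>\<^bsub>S\<^esub> q)"
    using base assms(2,3,5) by (simp add: ext.m_assoc)
  also have "\<dots> = \<zero>\<^bsub>S\<^esub>"
    using base assms(4)[of "r \<otimes> a"] assms(5) by (simp add: tens_mult)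
  finally show ?case .
next
  case (plus m M m' M')
  then show ?case using assms mult_op_closed by (simp add: ext.l_distr)
qed

text \<open>The two-sided ideal generated by \<open>y\<close>. Simplicity of \<open>A\<close> will
  place \<open>1\<close> in it.\<close>

definition "mult_orbit y = {z. \<exists>m M. mult_op m M \<and> m y = z}"

lemma mult_orbitI: "mult_op m M \<Longrightarrow> m y = z \<Longrightarrow> z \<in> mult_orbit y"
  unfolding mult_orbit_def by (intro CollectI exI conjI)

lemma mult_orbitE:
  assumes "z \<in> mult_orbit y"
  obtains m M where "mult_op m M" "m y = z"
  using assms unfolding mult_orbit_def by (elim CollectE exE conjE)

lemma mult_orbit_add: "z \<in> mult_orbit y \<Longrightarrow> z' \<in> mult_orbit y \<Longrightarrow> z \<oplus> z' \<in> mult_orbit y"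
  by (elim mult_orbitE) (rule mult_orbitI[OF mult_op.plus], assumption, assumption, simp)

lemma mult_orbit_base:
  "p \<in> carrier A \<Longrightarrow> r \<in> carrier A \<Longrightarrow> p \<otimes> y \<otimes> r = z \<Longrightarrow> z \<in> mult_orbit y"
  by (rule mult_orbitI[OF mult_op.base])

lemma mult_orbit_mult:
  assumes "y \<in> carrier A" "z \<in> mult_orbit y" "c \<in> carrier A"
  shows "c \<otimes> z \<in> mult_orbit y" "z \<otimes> c \<in> mult_orbit y"
proof -
  have "c \<otimes> m y \<in> mult_orbit y \<and> m y \<otimes> c \<in> mult_orbit y" if "mult_op m M" for m M
    using that
  proof (induction rule: mult_op.induct)
    case (base p r)
    then show ?case
      using mult_orbit_base[of "c \<otimes> p" r y "c \<otimes> (p \<otimes> y \<otimes> r)"]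
        mult_orbit_base[of p "r \<otimes> c" y "p \<otimes> y \<otimes> r \<otimes> c"] assms(1,3)
      by (simp add: m_assoc)
  next
    case (plus m M m' M')
    then show ?case
      using mult_op_closed(1)[OF plus.hyps(1) assms(1)] mult_op_closed(1)[OF plus.hyps(2) assms(1)]
        assms(3) by (simp add: l_distr r_distr mult_orbit_add)
  qed
  with assms(2) show "c \<otimes> z \<in> mult_orbit y" "z \<otimes> c \<in> mult_orbit y" by (auto elim!: mult_orbitE)
qed

lemma mult_orbit_ideal:
  assumes "y \<in> carrier A"
  shows "ideal (mult_orbit y) A"
proof (rule idealI)
  show "ring A" by (rule ring_axioms)
  have sub: "mult_orbit y \<subseteq> carrier A" using mult_op_closed(1) assms by (auto elim!: mult_orbitE)
  show "subgroup (mult_orbit y) (add_monoid A)"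
  proof (rule add.subgroupI[OF sub])
    show "mult_orbit y \<noteq> {}" using mult_orbit_base[of \<one> \<one> y] by blast
    show "\<ominus> a \<in> mult_orbit y" if "a \<in> mult_orbit y" for a
      using mult_orbit_mult(1)[OF assms that, of "\<ominus> \<one>"] that sub by (auto simp: l_minus)
  qed (rule mult_orbit_add)
qed (auto intro: mult_orbit_mult[OF assms])

text \<open>
  Induction on the number of coordinates of \<open>x\<close> in the base field: a multiplication operator turns one
  coordinate into \<open>1\<close>, and the commutators with \<open>A\<close> then have fewer coordinates. If all of them vanish,
  every coordinate is central, so \<open>x\<close> has been turned into a nonzero scalar.
\<close>

lemma prime_extension:
  assumes simple: "\<And>I. ideal I A \<Longrightarrow> I = {\<zero>} \<or> I = carrier A"
    and center: "center A = scalars A"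
    and "x \<in> carrier S" "x \<noteq> \<zero>\<^bsub>S\<^esub>" "q \<in> carrier S"
    and "\<And>a. a \<in> carrier A \<Longrightarrow> x \<otimes>\<^bsub>S\<^esub> tens a 1 \<otimes>\<^bsub>S\<^esub> q = \<zero>\<^bsub>S\<^esub>"
  shows "q = \<zero>\<^bsub>S\<^esub>"
  using assms(3,4,6)
proof (induction "card (support x)" arbitrary: x rule: less_induct)
  case less
  have "\<exists>b\<in>B. slice b x \<noteq> \<zero>" using slices_zero[OF less.prems(1)] less.prems(2) by blast
  then obtain b0 where b0: "b0 \<in> B" "slice b0 x \<noteq> \<zero>" ..
  have "slice b0 x \<in> mult_orbit (slice b0 x)"
    by (rule mult_orbit_base[of \<one> \<one>]) (use less.prems(1) in simp_all)
  with b0(2) have "mult_orbit (slice b0 x) \<noteq> {\<zero>}" by blast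
  with simple[OF mult_orbit_ideal[OF slice_closed[OF less.prems(1)]]]
  have "mult_orbit (slice b0 x) = carrier A" by blast
  then have "\<one> \<in> mult_orbit (slice b0 x)" by simp
  then obtain m M where m: "mult_op m M" "m (slice b0 x) = \<one>" by (rule mult_orbitE)
  define y where "y = M x"
  have y: "y \<in> carrier S" and sl: "slice b y = m (slice b x)" for b
    using m(1) less.prems(1) by (auto simp: y_def mult_op_closed mult_op_slice)
  have ann: "y \<otimes>\<^bsub>S\<^esub> tens a 1 \<otimes>\<^bsub>S\<^esub> q = \<zero>\<^bsub>S\<^esub>" if "a \<in> carrier A" for a
    unfolding y_def using mult_op_annihilate[OF m(1) less.prems(1) assms(5) less.prems(3) that] .
  define comm where "comm a = tens a 1 \<otimes>\<^bsub>S\<^esub> y \<ominus>\<^bsub>S\<^esub> y \<otimes>\<^bsub>S\<^esub> tens a 1" for a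
  have comm: "comm a \<in> carrier S" if "a \<in> carrier A" for a
    using that y by (simp add: comm_def)
  have sl_comm: "slice b (comm a) = a \<otimes> slice b y \<ominus> slice b y \<otimes> a" if "a \<in> carrier A" for a b
    using that y by (simp add: comm_def a_minus_def slice_add slice_finsum(2) slice_mult_left slice_mult_right)
  show ?case
  proof (cases "\<exists>a\<in>carrier A. comm a \<noteq> \<zero>\<^bsub>S\<^esub>")
    case True
    then obtain a where a: "a \<in> carrier A" "comm a \<noteq> \<zero>\<^bsub>S\<^esub>" by blast
    \<comment> \<open>Operators and commutators act coordinatewise, so a zero coordinate stays zero.
      The coordinate at \<open>b0\<close> has become \<open>1\<close>, which commutes with
      \<open>a\<close>, so it disappears.\<close>
    have "support (comm a) \<subseteq> support x - {b0}"
    proof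
      fix b assume b: "b \<in> support (comm a)"
      have "slice b x \<noteq> \<zero>"
      proof
        assume "slice b x = \<zero>"
        then have "slice b (comm a) = \<zero>"
          using sl sl_comm[OF a(1)] m(1) a(1) by (simp add: mult_op_closed(3) a_minus_def)
        with b show False by (simp add: support_def)
      qed
      moreover have "b \<noteq> b0"
      proof
        assume "b = b0"
        then have "slice b (comm a) = \<zero>" using sl sl_comm[OF a(1)] m(2) a(1) by (simp add: a_minus_def r_neg)
        with b show False by (simp add: support_def)
      qed
      ultimately show "b \<in> support x - {b0}" using b by (simp add: support_def)
    qed
    moreover have "b0 \<in> support x" using b0 by (simp add: support_def)
    ultimately have "support (comm a) \<subset> support x" by blast
    then have lt: "card (support (comm a)) < card (support x)"
      using finite_support[OF less.prems(1)] by (rule psubset_card_mono[rotated])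
    show ?thesis
    proof (rule less.hyps[OF lt comm[OF a(1)] a(2)])
      fix c assume c: "c \<in> carrier A"
      have "tens a 1 \<otimes>\<^bsub>S\<^esub> y \<otimes>\<^bsub>S\<^esub> tens c 1 \<otimes>\<^bsub>S\<^esub> q = tens a 1 \<otimes>\<^bsub>S\<^esub> (y \<otimes>\<^bsub>S\<^esub> tens c 1 \<otimes>\<^bsub>S\<^esub> q)"
        using a(1) c y assms(5) by (simp add: ext.m_assoc)
      also have "\<dots> = \<zero>\<^bsub>S\<^esub>" using ann[OF c] a(1) by simp
      finally have 1: "tens a 1 \<otimes>\<^bsub>S\<^esub> y \<otimes>\<^bsub>S\<^esub> tens c 1 \<otimes>\<^bsub>S\<^esub> q = \<zero>\<^bsub>S\<^esub>" .
      have "y \<otimes>\<^bsub>S\<^esub> tens a 1 \<otimes>\<^bsub>S\<^esub> tens c 1 \<otimes>\<^bsub>S\<^esub> q = y \<otimes>\<^bsub>S\<^esub> (tens a 1 \<otimes>\<^bsub>S\<^esub> tens c 1) \<otimes>\<^bsub>S\<^esub> q"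
        using a(1) c y assms(5) by (simp add: ext.m_assoc)
      also have "\<dots> = \<zero>\<^bsub>S\<^esub>" using ann[of "a \<otimes> c"] a(1) c by (simp add: tens_mult)
      finally have 2: "y \<otimes>\<^bsub>S\<^esub> tens a 1 \<otimes>\<^bsub>S\<^esub> tens c 1 \<otimes>\<^bsub>S\<^esub> q = \<zero>\<^bsub>S\<^esub>" .
      show "comm a \<otimes>\<^bsub>S\<^esub> tens c 1 \<otimes>\<^bsub>S\<^esub> q = \<zero>\<^bsub>S\<^esub>"
        using 1 2 a(1) c y assms(5)
        by (simp add: comm_def a_minus_def ext.l_distr ext.l_minus)
    qed
  next
    case False
    have "slice b y \<in> center A" for b
    proof -
      have "a \<otimes> slice b y \<ominus> slice b y \<otimes> a = \<zero>" if "a \<in> carrier A" for a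
        using sl_comm[OF that, of b] False that by (simp add: slice_finsum(1))
      then show ?thesis using y unfolding center_def by (auto simp: r_right_minus_eq)
    qed
    then have "\<exists>c. slice b y = c \<odot> \<one>" for b using center by (auto simp: scalars_def)
    then obtain c where c: "\<And>b. slice b y = c b \<odot> \<one>" by metis
    define k where "k = (\<Sum>b\<in>support y. \<iota> (c b) * b)"
    have "y = (\<Oplus>\<^bsub>S\<^esub>b\<in>support y. tens (c b \<odot> \<one>) b)" using slice_expand[OF y] by (simp add: c)
    also have "\<dots> = (\<Oplus>\<^bsub>S\<^esub>b\<in>support y. tens \<one> (\<iota> (c b) * b))"
      by (intro ext.finsum_cong') (auto simp: tens_smult)
    also have "\<dots> = tens \<one> k" unfolding k_def using finite_support[OF y] by (simp add: tens_sum)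
    finally have yk: "y = tens \<one> k" .
    have "\<one> \<noteq> \<zero>"
    proof
      assume "\<one> = \<zero>"
      then have "slice b0 x = \<zero>" using less.prems(1) by (metis l_null r_one slice_closed r_null)
      with b0 show False by simp
    qed
    have "k \<noteq> 0"
    proof
      assume "k = 0"
      then have "y = \<zero>\<^bsub>S\<^esub>" using yk by simp
      then have "slice b0 y = \<zero>" by (simp add: slice_finsum(1))
      with sl m(2) \<open>\<one> \<noteq> \<zero>\<close> show False by simp
    qed
    then have "q = tens \<one> (inverse k) \<otimes>\<^bsub>S\<^esub> (y \<otimes>\<^bsub>S\<^esub> tens \<one> 1 \<otimes>\<^bsub>S\<^esub> q)"
      using assms(5) by (simp add: yk tens_one flip: ext.m_assoc) (simp add: tens_mult tens_one)
    with ann[of \<one>] show ?thesis by simp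
  qed
qed

end

section \<open>Matrix units and traces\<close>

context assoc_algebra
begin

lemma smult_eq_zero:
  assumes "x \<in> carrier A" "c \<odot> x = \<zero>"
  shows "c = 0 \<or> x = \<zero>"
proof (rule disjCI)
  assume "x \<noteq> \<zero>"
  have "inverse c \<odot> (c \<odot> x) = (inverse c * c) \<odot> x" using assms(1) by (rule smult_smult)
  then show "c = 0" using assms \<open>x \<noteq> \<zero>\<close> by (cases "c = 0") simp_all
qed

lemma smult_cancel:
  assumes "x \<in> carrier A" "x \<noteq> \<zero>" "c \<odot> x = d \<odot> x"
  shows "c = d"
proof -
  have "(c + - d) \<odot> x = c \<odot> x \<oplus> \<ominus> (d \<odot> x)"
    using assms(1) by (simp only: smult_add_scalar minus_smult)
  also have "\<dots> = \<zero>" using assms by (simp add: r_neg)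
  finally show ?thesis using smult_eq_zero[OF assms(1)] assms(2) by fastforce
qed

end

text \<open>Each corner is given one nonzero element and the \<open>u i j\<close> satisfy no product
  relations yet. The locale is applied to arbitrary corner elements first, and again to the matrix
  units made from them.\<close>

locale peirce = assoc_algebra A for A :: "('k::field, 'a) module" (structure) +
  fixes d :: nat and e :: "nat \<Rightarrow> 'a" and u :: "nat \<Rightarrow> nat \<Rightarrow> 'a"
  assumes one_neq: "\<one> \<noteq> \<zero>"
    and dim: "has_dim A (d * d) (carrier A)"
    and e_closed [simp]: "i < d \<Longrightarrow> e i \<in> carrier A"
    and e_mult: "i < d \<Longrightarrow> j < d \<Longrightarrow> e i \<otimes> e j = (if i = j then e i else \<zero>)"
    and u_closed [simp]: "i < d \<Longrightarrow> j < d \<Longrightarrow> u i j \<in> carrier A"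
    and u_nonzero: "i < d \<Longrightarrow> j < d \<Longrightarrow> u i j \<noteq> \<zero>"
    and e_u: "i < d \<Longrightarrow> j < d \<Longrightarrow> e i \<otimes> u i j = u i j"
    and u_e: "i < d \<Longrightarrow> j < d \<Longrightarrow> u i j \<otimes> e j = u i j"
begin

abbreviation "idx \<equiv> {..<d} \<times> {..<d}"

lemma corner_unit:
  assumes "i < d" "j < d" "k < d" "l < d"
  shows "e i \<otimes> u k l \<otimes> e j = (if k = i \<and> l = j then u i j else \<zero>)"
proof -
  have "e i \<otimes> u k l \<otimes> e j = e i \<otimes> (e k \<otimes> (u k l \<otimes> e l)) \<otimes> e j"
    using assms by (simp add: e_u u_e)
  also have "\<dots> = (e i \<otimes> e k) \<otimes> u k l \<otimes> (e l \<otimes> e j)"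
    using assms by (simp add: m_assoc)
  finally show ?thesis using assms by (auto simp: e_mult e_u u_e)
qed

lemma finsum_single:
  assumes "finite I" "p \<in> I" "x \<in> carrier A"
  shows "(\<Oplus>q\<in>I. if q = p then x else \<zero>) = x"
  using finsum_singleton[of p I "\<lambda>_. x"] assms by (simp add: eq_commute)

text \<open>Compression by \<open>e i\<close> and \<open>e j\<close> removes every term but one.
  Hence the \<open>u i j\<close> are independent, and their number equals the dimension, so they
  form a basis whose coefficients are read off by compression.\<close>

lemma corner_sum:
  assumes "i < d" "j < d"
  shows "e i \<otimes> (\<Oplus>p\<in>idx. c p \<odot> u (fst p) (snd p)) \<otimes> e j = c (i, j) \<odot> u i j"
proof -
  have "e i \<otimes> (\<Oplus>p\<in>idx. c p \<odot> u (fst p) (snd p)) \<otimes> e j =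
      (\<Oplus>p\<in>idx. e i \<otimes> (c p \<odot> u (fst p) (snd p)) \<otimes> e j)"
    using assms by (simp add: finsum_rdistr finsum_ldistr Pi_def)
  also have "\<dots> = (\<Oplus>p\<in>idx. if p = (i, j) then c (i, j) \<odot> u i j else \<zero>)"
    using assms by (intro finsum_cong')
      (auto simp: smult_mult_left smult_mult_right corner_unit split: if_splits)
  also have "\<dots> = c (i, j) \<odot> u i j"
    using assms by (intro finsum_single) auto
  finally show ?thesis .
qed

lemma units_indep: "lin_indep idx (\<lambda>p. u (fst p) (snd p))"
  unfolding lin_indep_def
proof (intro allI impI ballI)
  fix c p assume 0: "(\<Oplus>p\<in>idx. c p \<odot> u (fst p) (snd p)) = \<zero>" and "p \<in> idx"
  then obtain i j where p: "p = (i, j)" "i < d" "j < d" by auto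
  have "c p \<odot> u i j = \<zero>" using corner_sum[of i j c] p unfolding 0 by simp
  then show "c p = 0" using smult_eq_zero[of "u i j" "c p"] u_nonzero[of i j] p by auto
qed

lemma units_span:
  assumes "x \<in> carrier A"
  obtains c where "x = (\<Oplus>p\<in>idx. c p \<odot> u (fst p) (snd p))"
proof -
  have "lin_span idx (\<lambda>p. u (fst p) (snd p)) = carrier A"
    by (rule lin_span_full[OF one_neq _ _ _ units_indep]) (use dim in \<open>auto simp: card_cartesian_product\<close>)
  with assms that show thesis unfolding lin_span_def by auto
qed

lemma corner_ex:
  assumes "x \<in> carrier A" "i < d" "j < d"
  shows "\<exists>c. e i \<otimes> x \<otimes> e j = c \<odot> u i j"
  using units_span[OF assms(1)] corner_sum[OF assms(2,3)] by metis

definition coef :: "'a \<Rightarrow> nat \<Rightarrow> nat \<Rightarrow> 'k" where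
  "coef x i j = (THE c. e i \<otimes> x \<otimes> e j = c \<odot> u i j)"

lemma coef_eqI:
  assumes "i < d" "j < d" "e i \<otimes> x \<otimes> e j = c \<odot> u i j"
  shows "coef x i j = c"
  unfolding coef_def
proof (rule the_equality)
  show "c' = c" if "e i \<otimes> x \<otimes> e j = c' \<odot> u i j" for c'
    using smult_cancel[of "u i j" c' c] u_nonzero[of i j] assms that by auto
qed (rule assms)

lemma coef:
  assumes "x \<in> carrier A" "i < d" "j < d"
  shows "e i \<otimes> x \<otimes> e j = coef x i j \<odot> u i j"
  using corner_ex[OF assms] coef_eqI[OF assms(2,3)] by metis

lemma coef_sum:
  assumes "i < d" "j < d"
  shows "coef (\<Oplus>p\<in>idx. c p \<odot> u (fst p) (snd p)) i j = c (i, j)"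
  by (rule coef_eqI[OF assms corner_sum[OF assms]])

lemma coef_expand:
  assumes "x \<in> carrier A"
  shows "(\<Oplus>p\<in>idx. coef x (fst p) (snd p) \<odot> u (fst p) (snd p)) = x"
proof -
  obtain c where c: "x = (\<Oplus>p\<in>idx. c p \<odot> u (fst p) (snd p))" by (rule units_span[OF assms])
  show ?thesis by (subst (2) c, intro finsum_cong') (auto simp: c coef_sum)
qed

lemma coef_add:
  assumes "x \<in> carrier A" "y \<in> carrier A" "i < d" "j < d"
  shows "coef (x \<oplus> y) i j = coef x i j + coef y i j"
  using assms by (intro coef_eqI) (auto simp: l_distr r_distr coef smult_add_scalar)

lemma coef_smult:
  assumes "x \<in> carrier A" "i < d" "j < d"
  shows "coef (c \<odot> x) i j = c * coef x i j"
  using assms by (intro coef_eqI) (auto simp: coef smult_mult_left smult_mult_right smult_smult)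

end

section \<open>From orthogonal idempotents to matrix units\<close>

locale idempotents = assoc_algebra A for A :: "('k::field, 'a) module" (structure) +
  fixes d :: nat and e :: "nat \<Rightarrow> 'a"
  assumes one_neq: "\<one> \<noteq> \<zero>"
    and dim: "has_dim A (d * d) (carrier A)"
    and e_closed [simp]: "i < d \<Longrightarrow> e i \<in> carrier A"
    and e_mult: "i < d \<Longrightarrow> j < d \<Longrightarrow> e i \<otimes> e j = (if i = j then e i else \<zero>)"
    and e_nonzero: "i < d \<Longrightarrow> e i \<noteq> \<zero>"
    and e_sum: "(\<Oplus>i\<in>{..<d}. e i) = \<one>"
    and prime: "x \<in> carrier A \<Longrightarrow> q \<in> carrier A \<Longrightarrow> x \<noteq> \<zero> \<Longrightarrow>
      (\<And>s. s \<in> carrier A \<Longrightarrow> x \<otimes> s \<otimes> q = \<zero>) \<Longrightarrow> q = \<zero>"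
begin

lemma d_pos: "0 < d"
  using e_sum one_neq by (cases d) auto

text \<open>Primeness yields \<open>s\<close> with \<open>x s e j\<close> nonzero. Since
  \<open>x = x e i\<close>, cutting \<open>s\<close> down to \<open>e i s e j\<close> does not
  change the product with \<open>x\<close>.\<close>

lemma corner_nonzero:
  assumes "x \<in> carrier A" "x \<noteq> \<zero>" "x \<otimes> e i = x" "i < d" "j < d"
  obtains y where "y \<in> carrier A" "e i \<otimes> y = y" "y \<otimes> e j = y" "x \<otimes> y \<noteq> \<zero>"
proof -
  obtain s where s: "s \<in> carrier A" "x \<otimes> s \<otimes> e j \<noteq> \<zero>"
    using prime[OF assms(1) e_closed[OF assms(5)] assms(2)] e_nonzero[OF assms(5)] by blast
  define y where "y = e i \<otimes> s \<otimes> e j"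
  have "x \<otimes> y = (x \<otimes> e i) \<otimes> s \<otimes> e j"
    using s(1) assms(1,4,5) by (simp add: y_def m_assoc)
  then have "x \<otimes> y \<noteq> \<zero>" using s(2) assms(3) by simp
  moreover have "e i \<otimes> y = (e i \<otimes> e i) \<otimes> s \<otimes> e j" using s(1) assms by (simp add: y_def m_assoc)
  then have "e i \<otimes> y = y" using assms by (simp add: e_mult y_def)
  moreover have "y \<otimes> e j = e i \<otimes> s \<otimes> (e j \<otimes> e j)" using s(1) assms by (simp add: y_def m_assoc)
  then have "y \<otimes> e j = y" using assms by (simp add: e_mult y_def)
  ultimately show thesis using that[of y] s(1) assms by (simp add: y_def)
qed

text \<open>All units are routed through index \<open>0\<close>: with \<open>a i\<close> in the
  corner \<open>(0, i)\<close>, \<open>b i\<close> in the corner \<open>(i, 0)\<close> and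
  \<open>a i b i = e 0\<close>, the products \<open>b i a j\<close> multiply as matrix
  units.\<close>

lemma matrix_units_ex:
  "\<exists>u. peirce A d e u \<and> (\<forall>i<d. u i i = e i) \<and>
    (\<forall>i<d. \<forall>j<d. \<forall>k<d. \<forall>l<d. u i j \<otimes> u k l = (if j = k then u i l else \<zero>))"
proof -
  have "\<exists>w. w \<in> carrier A \<and> w \<noteq> \<zero> \<and> e i \<otimes> w = w \<and> w \<otimes> e j = w" if ij: "i < d" "j < d" for i j
  proof -
    have "e i \<in> carrier A" "e i \<noteq> \<zero>" "e i \<otimes> e i = e i"
      using that e_nonzero by (auto simp: e_mult)
    then obtain y where "y \<in> carrier A" "e i \<otimes> y = y" "y \<otimes> e j = y" "e i \<otimes> y \<noteq> \<zero>"
      using ij by (rule corner_nonzero)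
    then show ?thesis by auto
  qed
  then obtain w where w: "\<And>i j. i < d \<Longrightarrow> j < d \<Longrightarrow> w i j \<in> carrier A \<and> w i j \<noteq> \<zero> \<and>
      e i \<otimes> w i j = w i j \<and> w i j \<otimes> e j = w i j" by metis
  interpret W: peirce A d e w
    by unfold_locales (use w one_neq dim in \<open>auto simp: e_mult\<close>)
  \<comment> \<open>The diagonal corner is a line and contains the nonzero element
    \<open>e i\<close>, which therefore spans it.\<close>
  have corner: "\<exists>c. x = c \<odot> e i"
    if x: "x \<in> carrier A" "e i \<otimes> x = x" "x \<otimes> e i = x" and i: "i < d" for x i
  proof -
    obtain c where c: "x = c \<odot> w i i" using W.corner_ex[OF x(1) i i] x by auto
    obtain c' where c': "e i = c' \<odot> w i i" using W.corner_ex[of "e i" i i] i by (auto simp: e_mult)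
    have "c' \<noteq> 0" using c' e_nonzero[OF i] i by auto
    then have "x = (c / c') \<odot> e i" using c i unfolding c' by (simp add: smult_smult)
    then show ?thesis ..
  qed
  have b_ex: "\<exists>b. b \<in> carrier A \<and> e i \<otimes> b = b \<and> b \<otimes> e 0 = b \<and> w 0 i \<otimes> b = e 0" if i: "i < d" for i
  proof -
    obtain y where y: "y \<in> carrier A" "e i \<otimes> y = y" "y \<otimes> e 0 = y" "w 0 i \<otimes> y \<noteq> \<zero>"
      using corner_nonzero[of "w 0 i" i 0] w[OF d_pos i] i d_pos by metis
    have cl: "w 0 i \<in> carrier A" using w d_pos i by blast
    have "e 0 \<otimes> (w 0 i \<otimes> y) = (e 0 \<otimes> w 0 i) \<otimes> y" "w 0 i \<otimes> y \<otimes> e 0 = w 0 i \<otimes> (y \<otimes> e 0)"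
      using cl y d_pos by (simp_all add: m_assoc)
    then obtain c where c: "w 0 i \<otimes> y = c \<odot> e 0"
      using corner[of "w 0 i \<otimes> y" 0] cl y d_pos w[OF d_pos i] by auto
    then have "c \<noteq> 0" using y(4) d_pos by auto
    \<comment> \<open>The product \<open>w 0 i y\<close> is a nonzero multiple of
      \<open>e 0\<close>, so rescaling \<open>y\<close> normalises it to \<open>e 0\<close>
      itself.\<close>
    then show ?thesis
      using y cl c d_pos i
      by (intro exI[of _ "inverse c \<odot> y"]) (simp add: smult_mult_left smult_mult_right smult_smult)
  qed
  then obtain b where b: "\<And>i. i < d \<Longrightarrow> b i \<in> carrier A \<and> e i \<otimes> b i = b i \<and>
      b i \<otimes> e 0 = b i \<and> w 0 i \<otimes> b i = e 0" by metis
  define a where "a i = w 0 i" for i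
  have ab: "a i \<in> carrier A" "b i \<in> carrier A" "e 0 \<otimes> a i = a i" "a i \<otimes> e i = a i"
    "e i \<otimes> b i = b i" "b i \<otimes> e 0 = b i" "a i \<otimes> b i = e 0" "a i \<noteq> \<zero>" if "i < d" for i
    using b[OF that] w[OF d_pos that] by (simp_all add: a_def)
  have ba: "b i \<otimes> a i = e i" if i: "i < d" for i
  proof -
    have "e i \<otimes> (b i \<otimes> a i) = (e i \<otimes> b i) \<otimes> a i" "b i \<otimes> a i \<otimes> e i = b i \<otimes> (a i \<otimes> e i)"
      using ab(1,2)[OF i] i by (simp_all add: m_assoc)
    then obtain c where c: "b i \<otimes> a i = c \<odot> e i"
      using corner[of "b i \<otimes> a i" i] ab[OF i] i by auto
    \<comment> \<open>From \<open>a i b i = e 0\<close> follows \<open>a i b i a i = a i\<close>,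
      which forces the scalar \<open>c\<close> to be \<open>1\<close>.\<close>
    have "a i \<otimes> (b i \<otimes> a i) = (a i \<otimes> b i) \<otimes> a i" using ab(1,2)[OF i] by (simp add: m_assoc)
    then have "c \<odot> a i = 1 \<odot> a i" using ab[OF i] c i by (simp add: smult_mult_right)
    then have "c = 1" using smult_cancel ab[OF i] by blast
    with c i show ?thesis by simp
  qed
  have a_b: "a j \<otimes> b k = (if j = k then e 0 else \<zero>)" if "j < d" "k < d" for j k
  proof -
    have "a j \<otimes> b k = a j \<otimes> e j \<otimes> (e k \<otimes> b k)" using ab[OF that(1)] ab[OF that(2)] by simp
    also have "\<dots> = a j \<otimes> (e j \<otimes> e k) \<otimes> b k"
      using ab(1,2)[OF that(1)] ab(1,2)[OF that(2)] that by (simp add: m_assoc)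
    finally show ?thesis using that ab(1,2,4,7) by (auto simp: e_mult)
  qed
  define u where "u i j = b i \<otimes> a j" for i j
  have uu: "u i j \<otimes> u k l = (if j = k then u i l else \<zero>)" if "i < d" "j < d" "k < d" "l < d" for i j k l
  proof -
    have "u i j \<otimes> u k l = b i \<otimes> (a j \<otimes> b k) \<otimes> a l"
      using ab(1,2) that by (simp add: u_def m_assoc)
    then show ?thesis using that ab by (auto simp: a_b u_def)
  qed
  have ue: "u i i = e i" if "i < d" for i using ba that by (simp add: u_def)
  have "peirce A d e u"
  proof unfold_locales
    show "u i j \<noteq> \<zero>" if "i < d" "j < d" for i j
      using uu[of i j j i] that ue[OF that(1)] e_nonzero[OF that(1)]
        ab(1)[OF that(1)] ab(2)[OF that(2)] by (auto simp: u_def)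
    show "e i \<otimes> u i j = u i j" "u i j \<otimes> e j = u i j" if "i < d" "j < d" for i j
      using uu[of i i i j] uu[of i j j j] ue that by auto
  qed (use one_neq dim ab in \<open>auto simp: e_mult u_def\<close>)
  with ue uu show ?thesis by (intro exI[of _ u]) auto
qed

end

section \<open>Matrix coordinates and the trace\<close>

locale matrix_units = peirce A d e u
  for A :: "('k::field, 'a) module" (structure) and d :: nat and e :: "nat \<Rightarrow> 'a"
    and u :: "nat \<Rightarrow> nat \<Rightarrow> 'a" +
  assumes e_sum: "(\<Oplus>i\<in>{..<d}. e i) = \<one>"
    and u_diag: "i < d \<Longrightarrow> u i i = e i"
    and u_mult: "i < d \<Longrightarrow> j < d \<Longrightarrow> k < d \<Longrightarrow> l < d \<Longrightarrow>
      u i j \<otimes> u k l = (if j = k then u i l else \<zero>)"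
begin

lemma d_pos: "0 < d"
  using e_sum one_neq by (cases d) auto

lemma coef_mult:
  assumes "x \<in> carrier A" "y \<in> carrier A" "i < d" "j < d"
  shows "coef (x \<otimes> y) i j = (\<Sum>k<d. coef x i k * coef y k j)"
proof (rule coef_eqI[OF assms(3,4)])
  have sum_smult: "(\<Oplus>k\<in>I. g k \<odot> z) = (\<Sum>k\<in>I. g k) \<odot> z" if "finite I" "z \<in> carrier A"
    for I :: "nat set" and g z
    using that by (induction I rule: finite_induct) (auto simp: finsum_insert smult_add_scalar)
  \<comment> \<open>The unit, written as the sum of the \<open>e k\<close>, is inserted between the
    factors; each \<open>e k\<close> is then doubled so that both factors appear compressed.\<close>
  have "e i \<otimes> (x \<otimes> y) \<otimes> e j = e i \<otimes> (x \<otimes> (\<Oplus>k\<in>{..<d}. e k) \<otimes> y) \<otimes> e j"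
    using assms by (simp add: e_sum)
  also have "\<dots> = (\<Oplus>k\<in>{..<d}. e i \<otimes> (x \<otimes> e k \<otimes> y) \<otimes> e j)"
    using assms by (simp add: finsum_rdistr finsum_ldistr Pi_def)
  also have "\<dots> = (\<Oplus>k\<in>{..<d}. (coef x i k * coef y k j) \<odot> u i j)"
  proof (intro finsum_cong')
    fix k assume "k \<in> {..<d}"
    then have k: "k < d" by simp
    have "e i \<otimes> (x \<otimes> e k \<otimes> y) \<otimes> e j = e i \<otimes> (x \<otimes> (e k \<otimes> e k) \<otimes> y) \<otimes> e j"
      using k by (simp add: e_mult)
    also have "\<dots> = (e i \<otimes> x \<otimes> e k) \<otimes> (e k \<otimes> y \<otimes> e j)"
      using assms k by (simp only: m_assoc m_closed e_closed)
    also have "\<dots> = (coef x i k * coef y k j) \<odot> u i j"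
      using assms k by (simp add: coef smult_mult_left smult_mult_right smult_smult u_mult mult.commute)
    finally show "e i \<otimes> (x \<otimes> e k \<otimes> y) \<otimes> e j = (coef x i k * coef y k j) \<odot> u i j" .
  qed (use assms in auto)
  also have "\<dots> = (\<Sum>k<d. coef x i k * coef y k j) \<odot> u i j"
    using assms by (simp add: sum_smult)
  finally show "e i \<otimes> (x \<otimes> y) \<otimes> e j = (\<Sum>k<d. coef x i k * coef y k j) \<odot> u i j" .
qed

lemma coef_unit:
  assumes "i < d" "j < d" "k < d" "l < d"
  shows "coef (u k l) i j = (if k = i \<and> l = j then 1 else 0)"
  using assms by (intro coef_eqI) (auto simp: corner_unit)

lemma coef_one:
  assumes "i < d" "j < d"
  shows "coef \<one> i j = (if i = j then 1 else 0)"
  using assms by (intro coef_eqI) (auto simp: e_mult u_diag)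

definition to_mat :: "'a \<Rightarrow> 'k mat" where
  "to_mat x = Matrix.mat d d (\<lambda>(i, j). coef x i j)"

lemma to_mat_iso: "algebra_iso A (module_mat TYPE('k) d d) to_mat"
proof -
  have "algebra_hom A (module_mat TYPE('k) d d) to_mat"
    unfolding algebra_hom_def
    by (auto simp: module_mat_simps to_mat_def coef_add coef_smult coef_mult coef_one
        scalar_prod_def lessThan_atLeast0
        intro!: ring_hom_memI eq_matI sum.cong)
  moreover have "inj_on to_mat (carrier A)"
  proof (rule inj_onI)
    fix x y assume xy: "x \<in> carrier A" "y \<in> carrier A" "to_mat x = to_mat y"
    have "coef x i j = coef y i j" if "i < d" "j < d" for i j
      using arg_cong[OF xy(3), of "\<lambda>M. M $$ (i, j)"] that by (simp add: to_mat_def)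
    then have "(\<Oplus>p\<in>idx. coef x (fst p) (snd p) \<odot> u (fst p) (snd p)) =
        (\<Oplus>p\<in>idx. coef y (fst p) (snd p) \<odot> u (fst p) (snd p))"
      by (intro finsum_cong') auto
    with coef_expand xy(1,2) show "x = y" by simp
  qed
  moreover have "M \<in> to_mat ` carrier A" if "M \<in> carrier_mat d d" for M
  proof
    show "M = to_mat (\<Oplus>p\<in>idx. M $$ p \<odot> u (fst p) (snd p))"
      using that by (intro eq_matI) (auto simp: to_mat_def coef_sum)
    show "(\<Oplus>p\<in>idx. M $$ p \<odot> u (fst p) (snd p)) \<in> carrier A" by (intro finsum_closed) auto
  qed
  moreover have "to_mat x \<in> carrier_mat d d" for x by (simp add: to_mat_def)
  ultimately show ?thesis
    unfolding algebra_iso_def bij_betw_def by (auto simp: module_mat_simps)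
qed

definition trace :: "'a \<Rightarrow> 'k" where "trace x = (\<Sum>i<d. coef x i i)"

lemma trace_to_mat: "mat_trace (to_mat x) = trace x"
  by (simp add: mat_trace_def to_mat_def trace_def)

lemma trace_form: "semilinear_form id A trace"
  by (simp add: semilinear_form_def trace_def coef_add coef_smult sum.distrib sum_distrib_left)

lemma trace_comm: "x \<in> carrier A \<Longrightarrow> y \<in> carrier A \<Longrightarrow> trace (x \<otimes> y) = trace (y \<otimes> x)"
  unfolding trace_def by (simp add: coef_mult) (subst sum.swap, simp add: mult.commute)

lemma trace_e: "i < d \<Longrightarrow> trace (e i) = 1"
  by (simp add: trace_def coef_unit flip: u_diag)

text \<open>For distinct \<open>i\<close> and \<open>j\<close>, \<open>u i j\<close> is the product
  \<open>u i i u i j\<close> while the reversed product is zero, so \<open>g\<close> vanishes off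
  the diagonal. The two products of \<open>u i 0\<close> and \<open>u 0 i\<close> are
  \<open>e i\<close> and \<open>e 0\<close>, so \<open>g\<close> is constant on the diagonal
  units.\<close>

lemma central_form_unique:
  assumes g: "semilinear_form id A g"
    and comm: "\<And>x y. x \<in> carrier A \<Longrightarrow> y \<in> carrier A \<Longrightarrow> g (x \<otimes> y) = g (y \<otimes> x)"
    and x: "x \<in> carrier A"
  shows "g x = g (e 0) * trace x"
proof -
  have A: "abelian_group A" by (rule is_abelian_group)
  have g_diag: "g (u i i) = g (e 0)" if "i < d" for i
    using comm[of "u i 0" "u 0 i"] that d_pos by (simp add: u_mult u_diag)
  have g_off: "g (u i j) = 0" if "i < d" "j < d" "i \<noteq> j" for i j
    using comm[of "u i i" "u i j"] that by (simp add: u_mult semilinear_form_finsum(1)[OF A g])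
  have "g x = g (\<Oplus>p\<in>idx. coef x (fst p) (snd p) \<odot> u (fst p) (snd p))"
    by (simp add: coef_expand x)
  also have "\<dots> = (\<Sum>p\<in>idx. coef x (fst p) (snd p) * g (u (fst p) (snd p)))"
    using g by (subst semilinear_form_finsum(3)[OF A g]) (auto simp: semilinear_form_def intro!: sum.cong)
  also have "\<dots> = (\<Sum>i<d. \<Sum>j<d. coef x i j * g (u i j))"
    by (simp add: sum.cartesian_product split_def)
  also have "\<dots> = (\<Sum>i<d. coef x i i * g (e 0))"
  proof (intro sum.cong refl)
    fix i assume "i \<in> {..<d}"
    then have "(\<Sum>j<d. coef x i j * g (u i j)) = (\<Sum>j<d. if j = i then coef x i i * g (e 0) else 0)"
      by (intro sum.cong) (auto simp: g_diag g_off)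
    with \<open>i \<in> {..<d}\<close> show "(\<Sum>j<d. coef x i j * g (u i j)) = coef x i i * g (e 0)" by simp
  qed
  finally show ?thesis by (simp add: trace_def sum_distrib_left sum_distrib_right mult.commute)
qed

end

section \<open>Independence of the trace from the matrix isomorphism\<close>

lemma mat_trace_comm:
  fixes M N :: "'k::comm_semiring_0 mat"
  assumes "M \<in> carrier_mat m m" "N \<in> carrier_mat m m"
  shows "mat_trace (M * N) = mat_trace (N * M)"
proof -
  have "mat_trace (M * N) = (\<Sum>i<m. \<Sum>j<m. M $$ (i, j) * N $$ (j, i))"
    using assms by (simp add: mat_trace_def scalar_prod_def lessThan_atLeast0)
  also have "\<dots> = (\<Sum>j<m. \<Sum>i<m. N $$ (j, i) * M $$ (i, j))"
    by (subst sum.swap) (simp add: mult.commute)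
  also have "\<dots> = mat_trace (N * M)"
    using assms by (simp add: mat_trace_def scalar_prod_def lessThan_atLeast0)
  finally show ?thesis .
qed

text \<open>Minimality makes \<open>E\<close> a multiple of a column times a row, that is, of rank
  one. Idempotence then fixes its trace, by an entrywise computation valid in every
  characteristic.\<close>

lemma mat_trace_minimal_idempotent:
  fixes E :: "'k::field mat"
  assumes E: "E \<in> carrier_mat m m" "E * E = E" "E \<noteq> 0\<^sub>m m m"
    and min: "\<And>M. M \<in> carrier_mat m m \<Longrightarrow> \<exists>c. E * M * E = c \<cdot>\<^sub>m E"
  shows "mat_trace E = 1"
proof -
  obtain j i where ji: "j < m" "i < m" "E $$ (j, i) \<noteq> 0"
    using E(1,3) by (metis carrier_matD eq_matI index_zero_mat)
  \<comment> \<open>With this matrix unit, \<open>E * M * E\<close> is column \<open>i\<close> of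
    \<open>E\<close> times row \<open>j\<close> of \<open>E\<close>. Its entry at
    \<open>(j, i)\<close> is the square of a nonzero entry.\<close>
  define M :: "'k mat" where "M = Matrix.mat m m (\<lambda>(k, l). if k = i \<and> l = j then 1 else 0)"
  have M: "M \<in> carrier_mat m m" by (simp add: M_def)
  obtain c where c: "E * M * E = c \<cdot>\<^sub>m E" using min[OF M] by blast
  have EM: "(E * M) $$ (a, l) = (if l = j then E $$ (a, i) else 0)" if "a < m" "l < m" for a l
  proof -
    have "(E * M) $$ (a, l) = (\<Sum>k<m. E $$ (a, k) * M $$ (k, l))"
      using that E(1) M by (simp add: scalar_prod_def lessThan_atLeast0)
    also have "\<dots> = (\<Sum>k<m. if k = i then (if l = j then E $$ (a, i) else 0) else 0)"
      using that by (intro sum.cong) (auto simp: M_def)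
    finally show ?thesis using ji by simp
  qed
  have ent: "E $$ (a, i) * E $$ (j, b) = c * E $$ (a, b)" if "a < m" "b < m" for a b
  proof -
    have "(N * E) $$ (a, b) = (\<Sum>l<m. N $$ (a, l) * E $$ (l, b))" if "N \<in> carrier_mat m m" for N
      using that \<open>a < m\<close> \<open>b < m\<close> E(1) by (simp add: scalar_prod_def lessThan_atLeast0)
    then have "(E * M * E) $$ (a, b) = (\<Sum>l<m. (E * M) $$ (a, l) * E $$ (l, b))"
      by this (use E(1) M in simp)
    also have "\<dots> = (\<Sum>l<m. if l = j then E $$ (a, i) * E $$ (j, b) else 0)"
      using that by (intro sum.cong) (auto simp: EM)
    also have "\<dots> = E $$ (a, i) * E $$ (j, b)" using ji by simp
    finally show ?thesis using c that E(1) by simp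
  qed
  have "c = E $$ (j, i)" using ent[OF ji(1,2)] ji(3) by simp
  moreover have "E $$ (j, i) = c * mat_trace E"
  proof -
    have "E $$ (j, i) = (E * E) $$ (j, i)" by (simp add: E(2))
    also have "\<dots> = (\<Sum>a<m. E $$ (a, i) * E $$ (j, a))"
      using E(1) ji by (simp add: scalar_prod_def lessThan_atLeast0 mult.commute)
    also have "\<dots> = c * mat_trace E" using E(1) by (simp add: ent mat_trace_def sum_distrib_left)
    finally show ?thesis .
  qed
  ultimately show ?thesis using ji(3) by simp
qed

context matrix_units
begin

text \<open>The pulled-back matrix trace vanishes on commutators, so it is a multiple of
  \<open>trace\<close>. The factor is the trace of the image of \<open>e 0\<close>, a minimal
  idempotent, hence \<open>1\<close>. The size \<open>m\<close> is left free as in the definition of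
  the reduced trace.\<close>

lemma trace_unique:
  assumes "algebra_iso A (module_mat TYPE('k) m m) \<psi>" "x \<in> carrier A"
  shows "mat_trace (\<psi> x) = trace x"
proof -
  have hom: "\<psi> \<in> Ring.ring_hom A (module_mat TYPE('k) m m)"
    and sm: "\<And>c x. x \<in> carrier A \<Longrightarrow> \<psi> (c \<odot> x) = c \<cdot>\<^sub>m \<psi> x"
    and bij: "bij_betw \<psi> (carrier A) (carrier_mat m m)"
    using assms(1) by (auto simp: algebra_iso_def algebra_hom_def module_mat_simps)
  have cl: "\<psi> x \<in> carrier_mat m m" if "x \<in> carrier A" for x
    using bij that by (auto simp: bij_betw_def)
  have mult: "\<psi> (x \<otimes> y) = \<psi> x * \<psi> y" and add: "\<psi> (x \<oplus> y) = \<psi> x + \<psi> y"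
    if "x \<in> carrier A" "y \<in> carrier A" for x y
    using ring_hom_mult[OF hom that] ring_hom_add[OF hom that] by (simp_all add: module_mat_simps)
  define E where "E = \<psi> (e 0)"
  have E: "E \<in> carrier_mat m m" using cl d_pos by (simp add: E_def)
  have "semilinear_form id A (\<lambda>x. mat_trace (\<psi> x))"
    unfolding semilinear_form_def
  proof (intro conjI ballI allI)
    show "mat_trace (\<psi> (x \<oplus> y)) = mat_trace (\<psi> x) + mat_trace (\<psi> y)"
      if "x \<in> carrier A" "y \<in> carrier A" for x y
      using cl[OF that(1)] cl[OF that(2)] that by (simp add: add mat_trace_def sum.distrib)
    show "mat_trace (\<psi> (c \<odot> x)) = id c * mat_trace (\<psi> x)" if "x \<in> carrier A" for c x
      using cl[OF that] that by (simp add: sm mat_trace_def sum_distrib_left)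
  qed
  then have "mat_trace (\<psi> x) = mat_trace E * trace x"
    unfolding E_def
    by (rule central_form_unique[OF _ _ assms(2)]) (simp add: mult mat_trace_comm[OF cl cl])
  moreover have "mat_trace E = 1"
  proof (rule mat_trace_minimal_idempotent[OF E])
    show "E * E = E" using d_pos by (simp add: E_def e_mult flip: mult)
    have "\<psi> \<zero> = 0\<^sub>m m m"
    proof -
      have z: "\<psi> \<zero> = 0 \<cdot>\<^sub>m \<psi> \<zero>" using sm[of \<zero> 0] by simp
      have "\<psi> \<zero> $$ (i, j) = 0" if "i < m" "j < m" for i j
        by (subst z) (use that cl[of \<zero>] in simp)
      then show ?thesis using cl[of \<zero>] by (intro eq_matI) auto
    qed
    then show "E \<noteq> 0\<^sub>m m m"
      using bij d_pos u_nonzero[of 0 0] inj_onD[of \<psi> "carrier A" "e 0" \<zero>]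
      by (auto simp: E_def bij_betw_def u_diag)
    show "\<exists>c. E * M * E = c \<cdot>\<^sub>m E" if "M \<in> carrier_mat m m" for M
    proof -
      from bij that have "M \<in> \<psi> ` carrier A" by (simp add: bij_betw_def)
      then obtain y where y: "y \<in> carrier A" "M = \<psi> y" by blast
      have "E * M * E = \<psi> (e 0 \<otimes> y \<otimes> e 0)" using y d_pos by (simp add: E_def mult)
      also have "\<dots> = coef y 0 0 \<cdot>\<^sub>m E" using y d_pos by (simp add: coef u_diag sm E_def)
      finally show ?thesis ..
    qed
  qed
  ultimately show ?thesis by simp
qed

end

section \<open>Etale algebras\<close>

context scalar_extension
begin

lemma ext_map:
  assumes "\<And>a. a \<in> carrier A \<Longrightarrow> h a \<in> carrier A"
    and "\<And>a b. a \<in> carrier A \<Longrightarrow> b \<in> carrier A \<Longrightarrow> h (a \<oplus> b) = h a \<oplus> h b"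
    and "\<And>c a. a \<in> carrier A \<Longrightarrow> h (c \<odot> a) = c \<odot> h a"
  shows "a \<in> carrier A \<Longrightarrow> ext_map \<iota> A h (tens a k) = tens (h a) k"
    and "x \<in> carrier S \<Longrightarrow> ext_map \<iota> A h x \<in> carrier S"
    and "x \<in> carrier S \<Longrightarrow> y \<in> carrier S \<Longrightarrow>
      ext_map \<iota> A h (x \<oplus>\<^bsub>S\<^esub> y) = ext_map \<iota> A h x \<oplus>\<^bsub>S\<^esub> ext_map \<iota> A h y"
proof -
  note t = tensor_map[of "\<lambda>(a, k). (h a, k)", folded ext_map_def, simplified]
  show "ext_map \<iota> A h (tens a k) = tens (h a) k" if "a \<in> carrier A"
    using that by (rule t(1)[rotated 4]) (use assms in \<open>simp_all add: tens_add_left tens_add_right tens_smult\<close>)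
  show "ext_map \<iota> A h x \<in> carrier S" if "x \<in> carrier S"
    using that by (rule t(2)[rotated 4]) (use assms in \<open>simp_all add: tens_add_left tens_add_right tens_smult\<close>)
  show "ext_map \<iota> A h (x \<oplus>\<^bsub>S\<^esub> y) = ext_map \<iota> A h x \<oplus>\<^bsub>S\<^esub> ext_map \<iota> A h y"
    if "x \<in> carrier S" "y \<in> carrier S"
    using that by (rule t(3)[rotated 4]) (use assms in \<open>simp_all add: tens_add_left tens_add_right tens_smult\<close>)
qed

lemma galois_map:
  assumes "\<And>k l. \<gamma> (k + l) = \<gamma> k + \<gamma> l" "\<And>c k. \<gamma> (\<iota> c * k) = \<iota> c * \<gamma> k"
  shows "a \<in> carrier A \<Longrightarrow> galois_map \<iota> A \<gamma> (tens a k) = tens a (\<gamma> k)"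
    and "x \<in> carrier S \<Longrightarrow> galois_map \<iota> A \<gamma> x \<in> carrier S"
    and "x \<in> carrier S \<Longrightarrow> y \<in> carrier S \<Longrightarrow>
      galois_map \<iota> A \<gamma> (x \<oplus>\<^bsub>S\<^esub> y) = galois_map \<iota> A \<gamma> x \<oplus>\<^bsub>S\<^esub> galois_map \<iota> A \<gamma> y"
proof -
  note t = tensor_map[of "\<lambda>(a, k). (a, \<gamma> k)", folded galois_map_def, simplified]
  show "galois_map \<iota> A \<gamma> (tens a k) = tens a (\<gamma> k)" if "a \<in> carrier A"
    using that by (rule t(1)[rotated 3]) (use assms in \<open>simp_all add: tens_add_left tens_add_right tens_smult\<close>)
  show "galois_map \<iota> A \<gamma> x \<in> carrier S" if "x \<in> carrier S"
    using that by (rule t(2)[rotated 3]) (use assms in \<open>simp_all add: tens_add_left tens_add_right tens_smult\<close>)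
  show "galois_map \<iota> A \<gamma> (x \<oplus>\<^bsub>S\<^esub> y) = galois_map \<iota> A \<gamma> x \<oplus>\<^bsub>S\<^esub> galois_map \<iota> A \<gamma> y"
    if "x \<in> carrier S" "y \<in> carrier S"
    using that by (rule t(3)[rotated 3]) (use assms in \<open>simp_all add: tens_add_left tens_add_right tens_smult\<close>)
qed

lemma galois_map_mult:
  assumes "\<And>k l. \<gamma> (k + l) = \<gamma> k + \<gamma> l" "\<And>c k. \<gamma> (\<iota> c * k) = \<iota> c * \<gamma> k"
    "\<And>k l. \<gamma> (k * l) = \<gamma> k * \<gamma> l" "x \<in> carrier S" "a \<in> carrier A"
  shows "galois_map \<iota> A \<gamma> (tens a k \<otimes>\<^bsub>S\<^esub> x) = tens a (\<gamma> k) \<otimes>\<^bsub>S\<^esub> galois_map \<iota> A \<gamma> x"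
proof -
  note g = galois_map[of \<gamma>, OF assms(1,2)]
  from assms(4) show ?thesis
    by (induction rule: ext_induct)
      (use assms(3,5) in \<open>simp_all add: g tens_mult ext.r_distr\<close>)
qed

text \<open>Slices are linear over the base field only; a scalar of the extension field mixes the
  coordinates through its multiplication on the basis.\<close>

lemma slice_smult:
  assumes "x \<in> carrier S"
  shows "slice b (k \<odot>\<^bsub>S\<^esub> x) = (\<Oplus>b'\<in>support x. \<kappa> b (k * b') \<odot> slice b' x)"
proof -
  have "k \<odot>\<^bsub>S\<^esub> x = tens \<one> k \<otimes>\<^bsub>S\<^esub> (\<Oplus>\<^bsub>S\<^esub>b'\<in>support x. tens (slice b' x) b')"
    by (simp add: slice_expand[OF assms] ext_smult)
  also have "\<dots> = (\<Oplus>\<^bsub>S\<^esub>b'\<in>support x. tens (slice b' x) (k * b'))"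
    using assms finite_support[OF assms] by (simp add: ext.finsum_rdistr Pi_def tens_mult)
  finally have "slice b (k \<odot>\<^bsub>S\<^esub> x) = (\<Oplus>b'\<in>support x. slice b (tens (slice b' x) (k * b')))"
    using assms finite_support[OF assms] by (simp add: slice_finsum(3) Pi_def)
  also have "\<dots> = (\<Oplus>b'\<in>support x. \<kappa> b (k * b') \<odot> slice b' x)"
    using assms by (intro finsum_cong') (auto simp: slice_tens)
  finally show ?thesis .
qed

end

section \<open>Homomorphisms of an etale algebra into the extension field\<close>

locale etale_extension = scalar_extension \<iota> A
  for \<iota> :: "'f::field \<Rightarrow> 'k::field" and A :: "('f, 'a) module" (structure) +
  fixes m :: nat and \<phi> :: "('a, 'k) tensor \<Rightarrow> nat \<Rightarrow> 'k"
  assumes comm: "cring A" and iso: "algebra_iso (scalar_ext \<iota> A) (split_algebra m) \<phi>"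
begin

lemma phi_hom:
  "x \<in> carrier S \<Longrightarrow> y \<in> carrier S \<Longrightarrow> i < m \<Longrightarrow> \<phi> (x \<oplus>\<^bsub>S\<^esub> y) i = \<phi> x i + \<phi> y i"
  "x \<in> carrier S \<Longrightarrow> y \<in> carrier S \<Longrightarrow> i < m \<Longrightarrow> \<phi> (x \<otimes>\<^bsub>S\<^esub> y) i = \<phi> x i * \<phi> y i"
  "x \<in> carrier S \<Longrightarrow> i < m \<Longrightarrow> \<phi> (k \<odot>\<^bsub>S\<^esub> x) i = k * \<phi> x i"
  "i < m \<Longrightarrow> \<phi> \<one>\<^bsub>S\<^esub> i = 1"
proof -
  have hom: "\<phi> \<in> Ring.ring_hom S (split_algebra m)"
    and sm: "\<forall>c. \<forall>x\<in>carrier S. \<phi> (c \<odot>\<^bsub>S\<^esub> x) = c \<odot>\<^bsub>split_algebra m\<^esub> \<phi> x"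
    using iso by (auto simp: algebra_iso_def algebra_hom_def)
  show "\<phi> (x \<oplus>\<^bsub>S\<^esub> y) i = \<phi> x i + \<phi> y i" if "x \<in> carrier S" "y \<in> carrier S" "i < m"
    using ring_hom_add[OF hom that(1,2)] that(3) by (simp add: split_algebra_def)
  show "\<phi> (x \<otimes>\<^bsub>S\<^esub> y) i = \<phi> x i * \<phi> y i" if "x \<in> carrier S" "y \<in> carrier S" "i < m"
    using ring_hom_mult[OF hom that(1,2)] that(3) by (simp add: split_algebra_def)
  show "\<phi> (k \<odot>\<^bsub>S\<^esub> x) i = k * \<phi> x i" if "x \<in> carrier S" "i < m"
    using sm that by (simp add: split_algebra_def)
  show "\<phi> \<one>\<^bsub>S\<^esub> i = 1" if "i < m"
    using ring_hom_one[OF hom] that by (simp add: split_algebra_def)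
qed

lemma phi_form: "i < m \<Longrightarrow> semilinear_form id S (\<lambda>x. \<phi> x i)"
  by (simp add: semilinear_form_def phi_hom)

lemma phi_inj:
  assumes "x \<in> carrier S" "y \<in> carrier S" "\<And>i. i < m \<Longrightarrow> \<phi> x i = \<phi> y i"
  shows "x = y"
proof -
  have bij: "bij_betw \<phi> (carrier S) ({..<m} \<rightarrow>\<^sub>E UNIV)"
    using iso by (simp add: algebra_iso_def split_algebra_def)
  then have "\<phi> x \<in> {..<m} \<rightarrow>\<^sub>E UNIV" "\<phi> y \<in> {..<m} \<rightarrow>\<^sub>E UNIV" using assms by (auto simp: bij_betw_def)
  then have "\<phi> x = \<phi> y" using assms(3) by (intro PiE_ext) auto
  with bij assms(1,2) show ?thesis by (auto simp: bij_betw_def dest: inj_onD)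
qed

lemma phi_surj: "\<exists>x\<in>carrier S. \<forall>i<m. \<phi> x i = g i"
proof -
  have "restrict g {..<m} \<in> \<phi> ` carrier S"
    using iso by (simp add: algebra_iso_def split_algebra_def bij_betw_def)
  then obtain x where "x \<in> carrier S" "\<phi> x = restrict g {..<m}" by auto
  then show ?thesis by (intro bexI[of _ x]) auto
qed

definition D :: "nat \<Rightarrow> ('a, 'k) tensor" where
  "D i = (SOME x. x \<in> carrier S \<and> (\<forall>j<m. \<phi> x j = (if i = j then 1 else 0)))"

lemma D_closed [simp]: "D i \<in> carrier S" and phi_D: "j < m \<Longrightarrow> \<phi> (D i) j = (if i = j then 1 else 0)"
proof -
  have "\<exists>x. x \<in> carrier S \<and> (\<forall>j<m. \<phi> x j = (if i = j then 1 else 0))"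
    using phi_surj[of "\<lambda>j. if i = j then 1 else 0"] unfolding Bex_def .
  then have "D i \<in> carrier S \<and> (\<forall>j<m. \<phi> (D i) j = (if i = j then 1 else 0))"
    unfolding D_def by (rule someI_ex)
  then show "D i \<in> carrier S" "j < m \<Longrightarrow> \<phi> (D i) j = (if i = j then 1 else 0)" by auto
qed

lemma D_mult: "i < m \<Longrightarrow> x \<in> carrier S \<Longrightarrow> D i \<otimes>\<^bsub>S\<^esub> x = \<phi> x i \<odot>\<^bsub>S\<^esub> D i"
  by (rule phi_inj) (auto simp: phi_hom phi_D)

lemma D_expand:
  assumes "x \<in> carrier S"
  shows "(\<Oplus>\<^bsub>S\<^esub>i\<in>{..<m}. \<phi> x i \<odot>\<^bsub>S\<^esub> D i) = x"
proof (rule phi_inj)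
  fix j assume j: "j < m"
  have "\<phi> (\<Oplus>\<^bsub>S\<^esub>i\<in>{..<m}. \<phi> x i \<odot>\<^bsub>S\<^esub> D i) j = (\<Sum>i<m. \<phi> (\<phi> x i \<odot>\<^bsub>S\<^esub> D i) j)"
    by (rule semilinear_form_finsum(3)[OF abelian_group_S phi_form[OF j]]) auto
  also have "\<dots> = (\<Sum>i<m. if i = j then \<phi> x j else 0)"
    using j by (intro sum.cong) (auto simp: phi_hom phi_D)
  finally show "\<phi> (\<Oplus>\<^bsub>S\<^esub>i\<in>{..<m}. \<phi> x i \<odot>\<^bsub>S\<^esub> D i) j = \<phi> x j" using j by simp
qed (use assms in \<open>auto intro: ext.finsum_closed\<close>)

lemma form_expand:
  assumes "semilinear_form id S G" "x \<in> carrier S"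
  shows "G x = (\<Sum>i<m. \<phi> x i * G (D i))"
proof -
  have "G x = G (\<Oplus>\<^bsub>S\<^esub>i\<in>{..<m}. \<phi> x i \<odot>\<^bsub>S\<^esub> D i)" by (simp add: D_expand assms(2))
  also have "\<dots> = (\<Sum>i<m. G (\<phi> x i \<odot>\<^bsub>S\<^esub> D i))"
    by (rule semilinear_form_finsum(3)[OF abelian_group_S assms(1)]) auto
  finally show ?thesis using assms(1) by (simp add: semilinear_form_def)
qed

definition \<xi> :: "nat \<Rightarrow> 'a \<Rightarrow> 'k" where
  "\<xi> i = (\<lambda>a\<in>carrier A. \<phi> (tens a 1) i)"

lemma xi: "a \<in> carrier A \<Longrightarrow> \<phi> (tens a 1) i = \<xi> i a"
  by (simp add: \<xi>_def)

lemma xi_form: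
  assumes "i < m"
  shows "semilinear_form \<iota> A (\<xi> i)"
  unfolding semilinear_form_def
proof (intro conjI ballI allI)
  show "\<xi> i (a \<oplus> b) = \<xi> i a + \<xi> i b" if "a \<in> carrier A" "b \<in> carrier A" for a b
    using phi_hom(1)[of "tens a 1" "tens b 1" i] that assms by (simp add: xi flip: tens_add_left)
  show "\<xi> i (c \<odot> a) = \<iota> c * \<xi> i a" if "a \<in> carrier A" for a c
    using phi_hom(3)[of "tens a 1" i "\<iota> c"] smult_tens[OF that, of "\<iota> c" 1]
      tens_smult[OF that, of c 1] that assms xi[of "c \<odot> a" i] by (simp add: xi)
qed

lemma xi_mult:
  assumes "i < m" "a \<in> carrier A" "b \<in> carrier A"
  shows "\<xi> i (a \<otimes> b) = \<xi> i a * \<xi> i b"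
  using phi_hom(2)[of "tens a 1" "tens b 1" i] assms by (simp add: tens_mult xi)

lemma xi_one: "i < m \<Longrightarrow> \<xi> i \<one> = 1"
  using phi_hom(4)[of i] xi[of \<one> i] by (simp add: tens_one)

lemma xi_X_homs: "i < m \<Longrightarrow> \<xi> i \<in> X_homs \<iota> A"
  using xi_form[of i] unfolding X_homs_def algebra_hom_def
  by (auto simp: semilinear_form_def extension_algebra_def xi_mult xi_one intro!: ring_hom_memI)
    (simp add: \<xi>_def)

lemma X_homsD:
  assumes "\<eta> \<in> X_homs \<iota> A"
  shows "semilinear_form \<iota> A \<eta>" "a \<in> carrier A \<Longrightarrow> b \<in> carrier A \<Longrightarrow> \<eta> (a \<otimes> b) = \<eta> a * \<eta> b"
    "\<eta> \<one> = 1" "\<eta> \<in> extensional (carrier A)"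
proof -
  have h: "\<eta> \<in> Ring.ring_hom A (extension_algebra \<iota>)"
    and sm: "\<forall>c. \<forall>x\<in>carrier A. \<eta> (c \<odot> x) = c \<odot>\<^bsub>extension_algebra \<iota>\<^esub> \<eta> x"
    and "\<eta> \<in> extensional (carrier A)"
    using assms by (auto simp: X_homs_def algebra_hom_def)
  then show "\<eta> \<in> extensional (carrier A)" by simp
  show "semilinear_form \<iota> A \<eta>"
    using sm ring_hom_add[OF h] by (auto simp: semilinear_form_def extension_algebra_def)
  show "\<eta> \<one> = 1" using ring_hom_one[OF h] by (simp add: extension_algebra_def)
  show "\<eta> (a \<otimes> b) = \<eta> a * \<eta> b" if "a \<in> carrier A" "b \<in> carrier A"
    using ring_hom_mult[OF h that] by (simp add: extension_algebra_def)
qed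

text \<open>The linear extension \<open>G\<close> of \<eta> is multiplicative. As \<open>G\<close>
  sends the unit, the sum of the \<open>D i\<close>, to \<open>1\<close>, some
  \<open>G (D i)\<close> is nonzero; applying \<open>G\<close> to
  \<open>D i x = \<phi> x i D i\<close> and cancelling identifies \<open>G\<close> with the
  \<open>i\<close>-th coordinate.\<close>

lemma X_homs_xi:
  assumes "\<eta> \<in> X_homs \<iota> A"
  obtains i where "i < m" "\<eta> = \<xi> i"
proof -
  note h = X_homsD[OF assms]
  obtain G where G': "semilinear_form id S G \<and> (\<forall>a\<in>carrier A. \<forall>k. G (tens a k) = k * \<eta> a)"
    using form_lift_exists[OF h(1)] ..
  then have G: "semilinear_form id S G" "\<And>a k. a \<in> carrier A \<Longrightarrow> G (tens a k) = k * \<eta> a" by auto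
  have Gadd: "G (x \<oplus>\<^bsub>S\<^esub> y) = G x + G y" if "x \<in> carrier S" "y \<in> carrier S" for x y
    using G(1) that by (simp add: semilinear_form_def)
  have Gsm: "G (k \<odot>\<^bsub>S\<^esub> x) = k * G x" if "x \<in> carrier S" for k x
    using G(1) that by (simp add: semilinear_form_def)
  have Gmult: "G (x \<otimes>\<^bsub>S\<^esub> y) = G x * G y" if "x \<in> carrier S" "y \<in> carrier S" for x y
    using that(1)
  proof (induction x rule: ext_induct)
    case (tens a k)
    from that(2) tens show ?case
      by (induction y rule: ext_induct) (auto simp: tens_mult G h(2) ext.r_distr Gadd algebra_simps)
  next
    case (add x x')
    with that(2) show ?case by (simp add: ext.l_distr Gadd algebra_simps)
  qed
  have "G \<one>\<^bsub>S\<^esub> = 1" using G(2)[of \<one> 1] h(3) by (simp add: tens_one)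
  moreover have "G \<one>\<^bsub>S\<^esub> = (\<Sum>i<m. \<phi> \<one>\<^bsub>S\<^esub> i * G (D i))" by (rule form_expand[OF G(1)]) simp
  ultimately obtain i where i: "i < m" "G (D i) \<noteq> 0"
    by (metis (no_types, lifting) lessThan_iff mult_zero_right sum.neutral zero_neq_one)
  have "\<eta> = \<xi> i"
  proof (rule extensionalityI[OF h(4)])
    show "\<xi> i \<in> extensional (carrier A)" by (simp add: \<xi>_def)
    fix a assume a: "a \<in> carrier A"
    have "G (D i) * G (tens a 1) = G (\<phi> (tens a 1) i \<odot>\<^bsub>S\<^esub> D i)"
      using i a by (simp flip: D_mult Gmult)
    also have "\<dots> = G (D i) * \<xi> i a" using a by (simp add: Gsm xi)
    finally show "\<eta> a = \<xi> i a" using i(2) a by (simp add: G)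
  qed
  with i(1) that show thesis by blast
qed

text \<open>Linear forms on the extension are determined by their values on the algebra, and the
  coordinates \<open>i\<close> and \<open>j\<close> already differ at \<open>D i\<close>.\<close>

lemma xi_separate:
  assumes "i < m" "j < m" "i \<noteq> j"
  shows "\<exists>a\<in>carrier A. \<xi> i a \<noteq> \<xi> j a"
proof (rule ccontr)
  assume "\<not> ?thesis"
  then have "\<phi> (tens a 1) i = \<phi> (tens a 1) j" if "a \<in> carrier A" for a
    using that by (simp add: xi)
  then have "\<phi> (D i) i = \<phi> (D i) j"
    by (rule forms_agree[OF phi_form[OF assms(1)] phi_form[OF assms(2)] _ D_closed])
  with assms show False by (simp add: phi_D)
qed

lemma X_homs_bij: "bij_betw \<xi> {..<m} (X_homs \<iota> A)"
  unfolding bij_betw_def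
proof
  show "inj_on \<xi> {..<m}"
  proof (rule inj_onI)
    fix i j assume "i \<in> {..<m}" "j \<in> {..<m}" "\<xi> i = \<xi> j"
    then show "i = j" using xi_separate[of i j] by auto
  qed
  show "\<xi> ` {..<m} = X_homs \<iota> A"
  proof
    show "\<xi> ` {..<m} \<subseteq> X_homs \<iota> A" using xi_X_homs by auto
    show "X_homs \<iota> A \<subseteq> \<xi> ` {..<m}"
    proof
      fix \<eta> assume "\<eta> \<in> X_homs \<iota> A"
      then obtain i where "i < m" "\<eta> = \<xi> i" by (rule X_homs_xi)
      then show "\<eta> \<in> \<xi> ` {..<m}" by simp
    qed
  qed
qed

text \<open>
  Slicing the expansions of the idempotents \<open>D i\<close> yields finitely many elements of \<open>A\<close> and linear
  forms on \<open>A\<close> that decompose the identity; the trace of a multiplication operator computed from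
  them lies in the base field.
\<close>

lemma trace_rational:
  assumes a: "a \<in> carrier A"
  shows "\<exists>c. (\<Sum>i<m. \<xi> i a) = \<iota> c"
proof -
  define v where "v i b = slice b (D i)" for i b
  define \<mu> where "\<mu> i b x = \<kappa> 1 (\<xi> i x * b)" for i b x
  have v: "v i b \<in> carrier A" for i b by (simp add: v_def)
  have mu: "semilinear_form \<iota> A (\<lambda>x. \<iota> (\<mu> i b x))" if "i < m" for i b
    using xi_form[OF that] unfolding semilinear_form_def \<mu>_def
    by (simp add: distrib_right kappa_add hom_add mult.assoc kappa_scale hom_mult)
  \<comment> \<open>This is the slice at \<open>1\<close> of the expansion of
    \<open>x \<otimes> 1\<close> in the \<open>D i\<close>. Expanding each \<open>D i\<close> into
    its own slices produces the coefficients \<mu>, which lie in the base field.\<close>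
  have frame: "x = (\<Oplus>i\<in>{..<m}. \<Oplus>b\<in>support (D i). \<mu> i b x \<odot> v i b)" if "x \<in> carrier A" for x
  proof -
    have "x = slice 1 (\<Oplus>\<^bsub>S\<^esub>i\<in>{..<m}. \<phi> (tens x 1) i \<odot>\<^bsub>S\<^esub> D i)"
      using that by (simp add: D_expand slice_tens kappa_basis one_B)
    also have "\<dots> = (\<Oplus>i\<in>{..<m}. slice 1 (\<phi> (tens x 1) i \<odot>\<^bsub>S\<^esub> D i))"
      by (intro slice_finsum(3)) auto
    also have "\<dots> = (\<Oplus>i\<in>{..<m}. \<Oplus>b\<in>support (D i). \<mu> i b x \<odot> v i b)"
      using that by (intro finsum_cong') (auto simp: slice_smult \<mu>_def v_def xi intro!: finsum_closed)
    finally show ?thesis .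
  qed
  have frame_xi: "\<xi> j x = (\<Sum>i<m. \<Sum>b\<in>support (D i). \<iota> (\<mu> i b x) * \<xi> j (v i b))"
    if "x \<in> carrier A" "j < m" for x j
  proof -
    note fs = semilinear_form_finsum(3)[OF is_abelian_group xi_form[OF that(2)]]
    have "\<xi> j x = \<xi> j (\<Oplus>i\<in>{..<m}. \<Oplus>b\<in>support (D i). \<mu> i b x \<odot> v i b)"
      using frame[OF that(1)] by (rule arg_cong)
    also have "\<dots> = (\<Sum>i<m. \<xi> j (\<Oplus>b\<in>support (D i). \<mu> i b x \<odot> v i b))"
      by (rule fs) (auto intro!: finsum_closed simp: v)
    also have "\<dots> = (\<Sum>i<m. \<Sum>b\<in>support (D i). \<xi> j (\<mu> i b x \<odot> v i b))"
      by (intro sum.cong refl fs) (auto simp: v finite_support)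
    finally show ?thesis using xi_form[OF that(2)] v by (simp add: semilinear_form_def)
  qed
  \<comment> \<open>The linear extension of \<mu> to \<open>S\<close>. It is introduced because the
    decomposition of the identity has to be evaluated at the \<open>D j\<close>, which need not come
    from the algebra itself.\<close>
  define M where "M i b = (SOME G. semilinear_form id S G \<and>
      (\<forall>x\<in>carrier A. \<forall>k. G (tens x k) = k * \<iota> (\<mu> i b x)))" for i b
  have M': "semilinear_form id S (M i b) \<and> (\<forall>x\<in>carrier A. \<forall>k. M i b (tens x k) = k * \<iota> (\<mu> i b x))"
    if "i < m" for i b
    unfolding M_def by (rule someI_ex[OF form_lift_exists[OF mu[OF that]]])
  have M: "i < m \<Longrightarrow> semilinear_form id S (M i b)"
    "i < m \<Longrightarrow> x \<in> carrier A \<Longrightarrow> M i b (tens x k) = k * \<iota> (\<mu> i b x)" for i b x k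
    using M'[of i b] by auto
  have frame_phi: "(\<Sum>i<m. \<Sum>b\<in>support (D i). M i b y * \<xi> j (v i b)) = \<phi> y j"
    if "y \<in> carrier S" "j < m" for y j
  proof (rule forms_agree[OF _ phi_form[OF that(2)] _ that(1)])
    show "semilinear_form id S (\<lambda>y. \<Sum>i<m. \<Sum>b\<in>support (D i). M i b y * \<xi> j (v i b))"
      using M(1) unfolding semilinear_form_def
      by (auto simp: distrib_right sum.distrib sum_distrib_left mult.assoc)
    show "(\<Sum>i<m. \<Sum>b\<in>support (D i). M i b (tens x 1) * \<xi> j (v i b)) = \<phi> (tens x 1) j"
      if "x \<in> carrier A" for x
      using frame_xi[OF that \<open>j < m\<close>] that by (simp add: M(2) xi)
  qed
  have "\<iota> (\<Sum>i<m. \<Sum>b\<in>support (D i). \<mu> i b (a \<otimes> v i b)) =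
      (\<Sum>i<m. \<Sum>b\<in>support (D i). M i b (tens (a \<otimes> v i b) 1))"
    using a v by (simp add: hom_sum M(2))
  also have "\<dots> = (\<Sum>i<m. \<Sum>b\<in>support (D i). \<Sum>j<m. \<xi> j a * \<xi> j (v i b) * M i b (D j))"
  proof (intro sum.cong refl)
    fix i b assume "i \<in> {..<m}"
    then have i: "i < m" by simp
    have "\<phi> (tens (a \<otimes> v i b) 1) j = \<xi> j a * \<xi> j (v i b)" if "j < m" for j
      using phi_hom(2)[of "tens a 1" "tens (v i b) 1" j] that a v by (simp add: tens_mult xi)
    then show "M i b (tens (a \<otimes> v i b) 1) = (\<Sum>j<m. \<xi> j a * \<xi> j (v i b) * M i b (D j))"
      using form_expand[OF M(1)[OF i], of "tens (a \<otimes> v i b) 1"] a v by simp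
  qed
  also have "\<dots> = (\<Sum>j<m. \<Sum>i<m. \<Sum>b\<in>support (D i). \<xi> j a * \<xi> j (v i b) * M i b (D j))"
  proof -
    have "(\<Sum>i<m. \<Sum>b\<in>support (D i). \<Sum>j<m. \<xi> j a * \<xi> j (v i b) * M i b (D j)) =
        (\<Sum>i<m. \<Sum>j<m. \<Sum>b\<in>support (D i). \<xi> j a * \<xi> j (v i b) * M i b (D j))"
      by (intro sum.cong refl sum.swap)
    also have "\<dots> = (\<Sum>j<m. \<Sum>i<m. \<Sum>b\<in>support (D i). \<xi> j a * \<xi> j (v i b) * M i b (D j))"
      by (rule sum.swap)
    finally show ?thesis .
  qed
  also have "\<dots> = (\<Sum>j<m. \<xi> j a * \<phi> (D j) j)"
  proof (intro sum.cong refl)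
    fix j assume "j \<in> {..<m}"
    then have j: "j < m" by simp
    show "(\<Sum>i<m. \<Sum>b\<in>support (D i). \<xi> j a * \<xi> j (v i b) * M i b (D j)) = \<xi> j a * \<phi> (D j) j"
      unfolding frame_phi[OF D_closed j, symmetric] by (simp add: sum_distrib_left ac_simps)
  qed
  also have "\<dots> = (\<Sum>j<m. \<xi> j a)" by (simp add: phi_D)
  finally show ?thesis by (intro exI) (rule sym)
qed

end

section \<open>Involutions and linear forms on the scalar extension\<close>

context scalar_extension
begin

lemma kappa_eq_zero:
  assumes "\<And>b. \<kappa> b k = 0"
  shows "k = 0"
  using kappa_expand[of "{}" k] assms by simp

lemma one_ext_neq:
  assumes "\<one> \<noteq> \<zero>"
  shows "\<one>\<^bsub>S\<^esub> \<noteq> \<zero>\<^bsub>S\<^esub>"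
proof
  assume "\<one>\<^bsub>S\<^esub> = \<zero>\<^bsub>S\<^esub>"
  then have "slice 1 (tens \<one> 1) = \<zero>" unfolding tens_one by (simp only: slice_finsum(1))
  moreover have "slice 1 (tens \<one> 1) = \<one>"
    by (subst slice_tens) (simp_all add: kappa_basis one_B)
  ultimately show False using assms by simp
qed

lemma has_dim_ext:
  assumes "\<one> \<noteq> \<zero>" "has_dim A m (carrier A)"
  shows "has_dim S m (carrier S)"
proof (rule has_dim_basis[OF assms])
  fix u :: "nat \<Rightarrow> 'a"
  assume u: "u \<in> {..<m} \<rightarrow> carrier A" and ind: "lin_indep {..<m} u"
    and sp: "carrier A = lin_span {..<m} u"
  let ?comb = "\<lambda>c. \<Oplus>\<^bsub>S\<^esub>i\<in>{..<m}. c i \<odot>\<^bsub>S\<^esub> tens (u i) 1"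
  let ?v = "\<lambda>i. tens (u i) 1"
  have u': "u i \<in> carrier A" if "i < m" for i using u that by auto
  then have v: "?v \<in> {..<m} \<rightarrow> carrier S" by auto
  have "extm.lin_indep {..<m} ?v"
    unfolding extm.lin_indep_def
  proof (intro allI impI)
    fix c assume 0: "?comb c = \<zero>\<^bsub>S\<^esub>"
    \<comment> \<open>The slice at \<open>b\<close> turns a relation over the extension field into
      one over the base field with coefficients \<open>\<kappa> b (c i)\<close>.\<close>
    have "\<forall>i\<in>{..<m}. \<kappa> b (c i) = 0" for b
    proof -
      have "(\<Oplus>i\<in>{..<m}. \<kappa> b (c i) \<odot> u i) = (\<Oplus>i\<in>{..<m}. slice b (c i \<odot>\<^bsub>S\<^esub> tens (u i) 1))"
        using u' by (intro finsum_cong') (auto simp: smult_tens slice_tens)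
      also have "\<dots> = slice b (?comb c)"
        using u' by (intro slice_finsum(3)[symmetric]) auto
      finally have "(\<Oplus>i\<in>{..<m}. \<kappa> b (c i) \<odot> u i) = \<zero>" by (simp add: 0 slice_finsum(1))
      then show ?thesis
        by (rule mp[OF ind[unfolded lin_indep_def, THEN spec[of _ "\<lambda>i. \<kappa> b (c i)"]]])
    qed
    note kc = this
    show "\<forall>i\<in>{..<m}. c i = 0"
    proof
      fix i assume "i \<in> {..<m}"
      with kc show "c i = 0" by (intro kappa_eq_zero) (rule bspec)
    qed
  qed
  moreover have "extm.lin_span {..<m} ?v = carrier S"
  proof
    show "extm.lin_span {..<m} ?v \<subseteq> carrier S"
      using u' by (auto simp: extm.lin_span_def intro!: ext.finsum_closed)
    show "carrier S \<subseteq> extm.lin_span {..<m} ?v"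
    proof
      fix x assume "x \<in> carrier S"
      then have "\<exists>c. ?comb c = x"
      proof (induction rule: ext_induct)
        case (tens a k)
        then obtain c where c: "a = (\<Oplus>i\<in>{..<m}. c i \<odot> u i)" using sp by (auto simp: lin_span_def)
        have "tens a k = (\<Oplus>\<^bsub>S\<^esub>i\<in>{..<m}. tens (c i \<odot> u i) k)"
          unfolding c by (rule additive_finsum(3)[OF is_abelian_group abelian_group_S])
            (use u' in \<open>auto simp: tens_add_left\<close>)
        also have "\<dots> = (\<Oplus>\<^bsub>S\<^esub>i\<in>{..<m}. (\<iota> (c i) * k) \<odot>\<^bsub>S\<^esub> tens (u i) 1)"
          using u' by (intro ext.finsum_cong') (auto simp: tens_smult smult_tens)
        finally show ?case by (intro exI) (rule sym)
      next
        case (add x y)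
        from add.IH obtain c c' where c: "?comb c = x"
          "?comb c' = y" by auto
        have "(\<Oplus>\<^bsub>S\<^esub>i\<in>{..<m}. (c i + c' i) \<odot>\<^bsub>S\<^esub> tens (u i) 1) =
            (\<Oplus>\<^bsub>S\<^esub>i\<in>{..<m}. c i \<odot>\<^bsub>S\<^esub> tens (u i) 1 \<oplus>\<^bsub>S\<^esub> c' i \<odot>\<^bsub>S\<^esub> tens (u i) 1)"
          using u' by (intro ext.finsum_cong') (auto simp: extm.smult_add_scalar)
        also have "\<dots> = x \<oplus>\<^bsub>S\<^esub> y" using u' c by (simp add: ext.finsum_addf Pi_def)
        finally show ?case by (intro exI)
      qed
      then show "x \<in> extm.lin_span {..<m} ?v" unfolding extm.lin_span_def by auto
    qed
  qed
  ultimately show ?thesis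
    using extm.has_dim_lin_span[OF one_ext_neq[OF assms(1)] finite_lessThan v] by simp
qed

lemma linear_involutionD:
  assumes "linear_involution A h"
  shows "a \<in> carrier A \<Longrightarrow> h a \<in> carrier A"
    and "a \<in> carrier A \<Longrightarrow> b \<in> carrier A \<Longrightarrow> h (a \<oplus> b) = h a \<oplus> h b"
    and "a \<in> carrier A \<Longrightarrow> h (c \<odot> a) = c \<odot> h a"
    and "a \<in> carrier A \<Longrightarrow> b \<in> carrier A \<Longrightarrow> h (a \<otimes> b) = h b \<otimes> h a"
    and "a \<in> carrier A \<Longrightarrow> h (h a) = a"
  using assms by (auto simp: linear_involution_def)

lemma ext_involution_mult:
  assumes "linear_involution A h" "x \<in> carrier S" "y \<in> carrier S"
  shows "ext_map \<iota> A h (x \<otimes>\<^bsub>S\<^esub> y) = ext_map \<iota> A h y \<otimes>\<^bsub>S\<^esub> ext_map \<iota> A h x"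
proof -
  note h = linear_involutionD[OF assms(1)]
  note e = ext_map[of h, OF h(1-3)]
  from assms(2) show ?thesis
  proof (induction x rule: ext_induct)
    case (tens a k)
    from assms(3) show ?case
      by (induction y rule: ext_induct)
        (use tens in \<open>auto simp: e tens_mult h mult.commute ext.l_distr ext.r_distr\<close>)
  next
    case (add x x')
    with assms(3) show ?case by (simp add: e ext.l_distr ext.r_distr)
  qed
qed

section \<open>The extended form on symmetric elements\<close>

lemma slice_ext_map:
  assumes "\<And>a. a \<in> carrier A \<Longrightarrow> h a \<in> carrier A"
    and "\<And>a b. a \<in> carrier A \<Longrightarrow> b \<in> carrier A \<Longrightarrow> h (a \<oplus> b) = h a \<oplus> h b"
    and "\<And>c a. a \<in> carrier A \<Longrightarrow> h (c \<odot> a) = c \<odot> h a"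
    and "x \<in> carrier S"
  shows "slice b (ext_map \<iota> A h x) = h (slice b x)"
  using assms(4)
  by (induction rule: ext_induct)
    (use assms(1-3) in \<open>simp_all add: ext_map[of h, OF assms(1-3)] slice_tens slice_add\<close>)

lemma form_coset:
  assumes G: "semilinear_form id S G" and u: "u \<in> carrier R"
  shows "G (coset u) = (\<Sum>p\<in>Poly_Mapping.keys u.
    of_int (Poly_Mapping.lookup u p) * G (tens (fst p) (snd p)))"
proof -
  define ev where "ev v = (\<Sum>p\<in>Poly_Mapping.keys v.
    of_int (Poly_Mapping.lookup v p) * G (tens (fst p) (snd p)))" for v
  have ev: "ev v = (\<Sum>p\<in>K. of_int (Poly_Mapping.lookup v p) * G (tens (fst p) (snd p)))"
    if "finite K" "Poly_Mapping.keys v \<subseteq> K" for v K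
    unfolding ev_def using that by (intro sum.mono_neutral_left) (auto simp: in_keys_iff)
  have Gadd: "G (x \<oplus>\<^bsub>S\<^esub> y) = G x + G y" if "x \<in> carrier S" "y \<in> carrier S" for x y
    using G that by (simp add: semilinear_form_def)
  have "u \<in> carrier R \<and> G (coset u) = ev u"
    using u
  proof (induction u rule: R_induct)
    case zero
    show ?case using semilinear_form_finsum(1)[OF abelian_group_S G] by (simp add: coset_ops R_closed ev_def)
  next
    case (gen a k)
    then show ?case by (simp add: R_closed ev_def keys_frag_of tens_eq)
  next
    case (add u v)
    let ?K = "Poly_Mapping.keys u \<union> Poly_Mapping.keys v"
    have "ev (u + v) = ev u + ev v"
      using keys_add[of u v]
      by (simp add: ev[of ?K] Poly_Mapping.lookup_add distrib_right sum.distrib)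
    with add show ?case by (auto simp: R_closed carrier_S Gadd simp flip: coset_ops(1))
  next
    case (uminus u)
    then have "coset u \<oplus>\<^bsub>S\<^esub> coset (- u) = \<zero>\<^bsub>S\<^esub>" by (simp add: coset_ops R_closed)
    then have "G (coset u) + G (coset (- u)) = 0"
      using uminus semilinear_form_finsum(1)[OF abelian_group_S G]
      by (metis Gadd R_closed(3) carrier_S imageI)
    with uminus have "ev u + G (coset (- u)) = 0" by simp
    then have "G (coset (- u)) = - ev u" by (simp add: add_eq_0_iff)
    moreover have "ev (- u) = - ev u" by (simp add: ev_def sum_negf)
    ultimately show ?case using uminus by (simp add: R_closed)
  qed
  then show ?thesis by (simp add: ev_def)
qed

lemma coset_sum:
  assumes "finite I" "\<And>i. i \<in> I \<Longrightarrow> u i \<in> carrier R"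
  shows "coset (\<Sum>i\<in>I. u i) = (\<Oplus>\<^bsub>S\<^esub>i\<in>I. coset (u i)) \<and> (\<Sum>i\<in>I. u i) \<in> carrier R"
  using assms
proof (induction I rule: finite_induct)
  case (insert i I)
  have "(\<lambda>i. coset (u i)) \<in> I \<rightarrow> carrier S" using insert.prems by (auto simp: carrier_S)
  with insert show ?case by (auto simp: ext.finsum_insert R_closed carrier_S simp flip: coset_ops(1))
qed (simp add: coset_ops R_closed)

text \<open>Every representative with symmetric first entries evaluates to \<open>G y\<close>, which
  settles uniqueness. One exists because the slices of a symmetric element are symmetric, so its
  coordinate expansion qualifies.\<close>

lemma ext_form_eq:
  assumes h: "linear_involution A h"
    and G: "semilinear_form id S G" "\<And>x k. x \<in> Sym A h \<Longrightarrow> G (tens x k) = k * \<iota> (f x)"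
    and y: "y \<in> Sym S (ext_map \<iota> A h)"
  shows "ext_form \<iota> A h f y = G y"
  unfolding ext_form_def
proof (rule the_equality)
  let ?val = "\<lambda>u. \<Sum>(x, k)\<in>Poly_Mapping.keys u.
    of_int (Poly_Mapping.lookup u (x, k)) * (k * \<iota> (f x))"
  note hD = linear_involutionD[OF h]
  have yS: "y \<in> carrier S" and hy: "ext_map \<iota> A h y = y" using y by (auto simp: Sym_def)
  have val: "?val u = G (coset u)"
    if u: "Poly_Mapping.keys u \<subseteq> Sym A h \<times> UNIV" for u
  proof -
    have "u \<in> carrier R" using u by (auto simp: carrier_R Sym_def)
    then have "G (coset u) = (\<Sum>p\<in>Poly_Mapping.keys u.
        of_int (Poly_Mapping.lookup u p) * G (tens (fst p) (snd p)))"
      by (rule form_coset[OF G(1)])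
    also have "\<dots> = ?val u"
      using u by (intro sum.cong) (auto simp: G(2))
    finally show ?thesis by simp
  qed
  have mem: "coset u = y" if "u \<in> y" for u
  proof -
    obtain v where "v \<in> carrier R" "y = coset v" using yS by (auto simp: carrier_S)
    with that show ?thesis by (simp add: mem_coset coset_eq_iff)
  qed
  define u where "u = (\<Sum>b\<in>support y. frag_of (slice b y, b))"
  have sym: "slice b y \<in> Sym A h" for b
    using slice_ext_map[of h y b, OF hD(1-3) yS] hy yS by (simp add: Sym_def)
  have "coset u = y"
    using coset_sum[OF finite_support[OF yS], of "\<lambda>b. frag_of (slice b y, b)"] slice_expand[OF yS] yS
    unfolding u_def by (simp add: R_closed tens_eq)
  moreover have "Poly_Mapping.keys u \<subseteq> Sym A h \<times> UNIV"
    using keys_sum[of "\<lambda>b. frag_of (slice b y, b)" "support y"] sym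
    unfolding u_def by (auto simp: keys_frag_of)
  moreover have "u \<in> y" using calculation(1) coset_self[of u] by simp
  ultimately show "\<exists>u\<in>y. Poly_Mapping.keys u \<subseteq> Sym A h \<times> UNIV \<and>
      G y = ?val u"
    using val[of u] by (intro bexI[of _ u]) simp_all
  show "t = G y" if "\<exists>u\<in>y. Poly_Mapping.keys u \<subseteq> Sym A h \<times> UNIV \<and>
      t = ?val u" for t
    using that val mem by auto
qed

end

section \<open>Idempotents in the scalar extension and the reduced trace\<close>

locale embedding_data = A: scalar_extension \<iota> A + L: etale_extension \<iota> L "2 * n" \<phi>
  for \<iota> :: "'f::field \<Rightarrow> 'k::field" and A :: "('f, 'a) module" and L :: "('f, 'l) module"
    and n :: nat and \<phi> :: "('l, 'k) tensor \<Rightarrow> nat \<Rightarrow> 'k" +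
  fixes \<sigma> :: "'a \<Rightarrow> 'a" and f :: "'a \<Rightarrow> 'f" and \<sigma>\<^sub>L :: "'l \<Rightarrow> 'l" and \<epsilon> :: "'l \<Rightarrow> 'a"
  assumes n_pos: "n \<ge> 1"
    and csa: "central_simple (2 * n) A"
    and pair: "quadratic_pair \<iota> n A \<sigma> f"
    and involution: "etale_with_involution \<iota> (2 * n) L \<sigma>\<^sub>L"
    and embedding: "algebra_inv_embedding \<iota> L \<sigma>\<^sub>L A \<sigma> f \<epsilon>"
begin

abbreviation mult_S (infixl "\<cdot>" 70) where "x \<cdot> y \<equiv> x \<otimes>\<^bsub>A.S\<^esub> y"
abbreviation zero_S ("\<zero>\<^sub>s") where "\<zero>\<^sub>s \<equiv> \<zero>\<^bsub>A.S\<^esub>"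
abbreviation one_S ("\<one>\<^sub>s") where "\<one>\<^sub>s \<equiv> \<one>\<^bsub>A.S\<^esub>"
abbreviation "img l \<equiv> A.tens (\<epsilon> l) 1"
abbreviation eps_star ("\<epsilon>\<^sub>*") where "\<epsilon>\<^sub>* \<equiv> induced_map \<iota> L A \<epsilon>"

lemma eps_hom: "\<epsilon> \<in> Ring.ring_hom L A"
  using embedding by (simp add: algebra_inv_embedding_def algebra_hom_def)

lemma eps:
  "l \<in> carrier L \<Longrightarrow> \<epsilon> l \<in> carrier A"
  "l \<in> carrier L \<Longrightarrow> l' \<in> carrier L \<Longrightarrow> \<epsilon> (l \<oplus>\<^bsub>L\<^esub> l') = \<epsilon> l \<oplus>\<^bsub>A\<^esub> \<epsilon> l'"
  "l \<in> carrier L \<Longrightarrow> l' \<in> carrier L \<Longrightarrow> \<epsilon> (l \<otimes>\<^bsub>L\<^esub> l') = \<epsilon> l \<otimes>\<^bsub>A\<^esub> \<epsilon> l'"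
  "\<epsilon> \<one>\<^bsub>L\<^esub> = \<one>\<^bsub>A\<^esub>"
  "l \<in> carrier L \<Longrightarrow> \<epsilon> (c \<odot>\<^bsub>L\<^esub> l) = c \<odot>\<^bsub>A\<^esub> \<epsilon> l"
  "inj_on \<epsilon> (carrier L)"
  "l \<in> carrier L \<Longrightarrow> \<epsilon> (\<sigma>\<^sub>L l) = \<sigma> (\<epsilon> l)"
  using embedding ring_hom_closed[OF eps_hom] ring_hom_add[OF eps_hom] ring_hom_mult[OF eps_hom]
    ring_hom_one[OF eps_hom]
  by (auto simp: algebra_inv_embedding_def algebra_hom_def)

lemma eps_zero: "\<epsilon> \<zero>\<^bsub>L\<^esub> = \<zero>\<^bsub>A\<^esub>"
  by (rule additive_finsum(1)[OF L.is_abelian_group A.is_abelian_group]) (simp_all add: eps)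

text \<open>Characterises \<open>\<epsilon> \<otimes> id\<close>; multiplicativity and linearity
  over the extension field are derived from the values on pure tensors.\<close>

definition is_ext :: "(('l, 'k) tensor \<Rightarrow> ('a, 'k) tensor) \<Rightarrow> bool" where
  "is_ext H \<longleftrightarrow> (\<forall>l\<in>carrier L. \<forall>k. H (L.tens l k) = A.tens (\<epsilon> l) k) \<and>
    (\<forall>x\<in>carrier L.S. H x \<in> carrier A.S) \<and>
    (\<forall>x\<in>carrier L.S. \<forall>y\<in>carrier L.S. H (x \<oplus>\<^bsub>L.S\<^esub> y) = H x \<oplus>\<^bsub>A.S\<^esub> H y)"

definition "E = (SOME H. is_ext H)"

lemma is_ext_E: "is_ext E"
proof -
  obtain H where "\<And>l k. l \<in> carrier L \<Longrightarrow> H (L.tens l k) = A.tens (\<epsilon> l) k"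
    "\<And>x. x \<in> carrier L.S \<Longrightarrow> H x \<in> carrier A.S"
    "\<And>x y. x \<in> carrier L.S \<Longrightarrow> y \<in> carrier L.S \<Longrightarrow> H (x \<oplus>\<^bsub>L.S\<^esub> y) = H x \<oplus>\<^bsub>A.S\<^esub> H y"
    by (rule L.lift_exists[OF A.abelian_group_S, of "\<lambda>l k. A.tens (\<epsilon> l) k"])
      (auto simp: eps A.tens_add_left A.tens_add_right A.tens_smult)
  then have "is_ext H" unfolding is_ext_def by simp
  then show ?thesis unfolding E_def by (rule someI[of is_ext])
qed

lemma E_tens: "l \<in> carrier L \<Longrightarrow> E (L.tens l k) = A.tens (\<epsilon> l) k"
  and E_closed [simp]: "x \<in> carrier L.S \<Longrightarrow> E x \<in> carrier A.S"
  and E_add: "x \<in> carrier L.S \<Longrightarrow> y \<in> carrier L.S \<Longrightarrow> E (x \<oplus>\<^bsub>L.S\<^esub> y) = E x \<oplus>\<^bsub>A.S\<^esub> E y"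
  using is_ext_E by (auto simp: is_ext_def)

lemmas E_finsum = additive_finsum[OF L.abelian_group_S A.abelian_group_S E_closed E_add]

lemma E_mult:
  assumes "x \<in> carrier L.S" "y \<in> carrier L.S"
  shows "E (x \<otimes>\<^bsub>L.S\<^esub> y) = E x \<cdot> E y"
  using assms(1)
proof (induction x rule: L.ext_induct)
  case (tens l k)
  from assms(2) show ?case
    by (induction y rule: L.ext_induct)
      (use tens in \<open>simp_all add: L.tens_mult A.tens_mult E_tens eps L.ext.r_distr A.ext.r_distr E_add\<close>)
next
  case (add x x')
  with assms(2) show ?case by (simp add: L.ext.l_distr A.ext.l_distr E_add)
qed

lemma E_smult:
  assumes "x \<in> carrier L.S"
  shows "E (k \<odot>\<^bsub>L.S\<^esub> x) = k \<odot>\<^bsub>A.S\<^esub> E x"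
  using assms by (simp add: L.ext_smult A.ext_smult E_mult E_tens eps)

text \<open>Slicing commutes with \<open>E\<close>, so an element of the kernel has all its slices
  in the kernel of \<epsilon>. This is what keeps the idempotents \<open>e i\<close>
  nonzero.\<close>

lemma E_nonzero:
  assumes "x \<in> carrier L.S" "x \<noteq> \<zero>\<^bsub>L.S\<^esub>"
  shows "E x \<noteq> \<zero>\<^sub>s"
proof
  assume 0: "E x = \<zero>\<^sub>s"
  have "A.slice b (E x) = \<epsilon> (L.slice b x)" for b
    using assms(1) by (induction x rule: L.ext_induct)
      (simp_all add: E_tens A.slice_tens L.slice_tens eps E_add A.slice_add L.slice_add)
  then have "\<epsilon> (L.slice b x) = \<epsilon> \<zero>\<^bsub>L\<^esub>" for b
    using 0 by (metis A.slice_finsum(1) eps_zero)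
  then have "L.slice b x = \<zero>\<^bsub>L\<^esub>" for b
    using inj_onD[OF eps(6)] assms(1) by simp
  with L.slices_zero[OF assms(1)] assms(2) show False by blast
qed

definition "e i = E (L.D i)"

lemma e_closed [simp]: "e i \<in> carrier A.S"
  by (simp add: e_def)

lemma e_mult: "i < 2 * n \<Longrightarrow> j < 2 * n \<Longrightarrow> e i \<cdot> e j = (if i = j then e i else \<zero>\<^sub>s)"
  unfolding e_def by (simp add: L.D_mult L.phi_D E_smult flip: E_mult)

lemma e_nonzero: "i < 2 * n \<Longrightarrow> e i \<noteq> \<zero>\<^sub>s"
proof -
  assume i: "i < 2 * n"
  have "L.D i \<noteq> \<zero>\<^bsub>L.S\<^esub>"
    using L.phi_D[OF i, of i] semilinear_form_finsum(1)[OF L.abelian_group_S L.phi_form[OF i]]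
    by fastforce
  then show ?thesis unfolding e_def by (intro E_nonzero) simp_all
qed

lemma e_sum: "(\<Oplus>\<^bsub>A.S\<^esub>i\<in>{..<2 * n}. e i) = \<one>\<^sub>s"
proof -
  have "(\<Oplus>\<^bsub>L.S\<^esub>i\<in>{..<2 * n}. L.D i) = (\<Oplus>\<^bsub>L.S\<^esub>i\<in>{..<2 * n}. \<phi> \<one>\<^bsub>L.S\<^esub> i \<odot>\<^bsub>L.S\<^esub> L.D i)"
    by (intro L.ext.finsum_cong') (auto simp: L.phi_hom)
  then have "(\<Oplus>\<^bsub>L.S\<^esub>i\<in>{..<2 * n}. L.D i) = \<one>\<^bsub>L.S\<^esub>" by (simp add: L.D_expand)
  moreover have "E (\<Oplus>\<^bsub>L.S\<^esub>i\<in>{..<2 * n}. L.D i) = (\<Oplus>\<^bsub>A.S\<^esub>i\<in>{..<2 * n}. e i)"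
    unfolding e_def by (rule E_finsum(3)) auto
  moreover have "E \<one>\<^bsub>L.S\<^esub> = \<one>\<^sub>s"
    unfolding L.tens_one[symmetric] by (subst E_tens) (simp_all add: eps A.tens_one)
  ultimately show ?thesis by simp
qed

lemma j_e:
  assumes "l \<in> carrier L" "i < 2 * n"
  shows "e i \<cdot> img l = L.\<xi> i l \<odot>\<^bsub>A.S\<^esub> e i"
    and "img l \<cdot> e i = L.\<xi> i l \<odot>\<^bsub>A.S\<^esub> e i"
proof -
  have D: "L.D i \<otimes>\<^bsub>L.S\<^esub> L.tens l 1 = L.\<xi> i l \<odot>\<^bsub>L.S\<^esub> L.D i"
    using assms by (simp add: L.D_mult L.xi)
  then show "e i \<cdot> img l = L.\<xi> i l \<odot>\<^bsub>A.S\<^esub> e i"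
    using E_mult[of "L.D i" "L.tens l 1"] assms by (simp add: E_tens E_smult e_def)
  have "L.tens l 1 \<otimes>\<^bsub>L.S\<^esub> L.D i = L.D i \<otimes>\<^bsub>L.S\<^esub> L.tens l 1"
    using assms by (intro L.phi_inj) (auto simp: L.phi_hom)
  with D show "img l \<cdot> e i = L.\<xi> i l \<odot>\<^bsub>A.S\<^esub> e i"
    using E_mult[of "L.tens l 1" "L.D i"] assms by (simp add: E_tens E_smult e_def)
qed

lemma A_facts:
  "\<one>\<^bsub>A\<^esub> \<noteq> \<zero>\<^bsub>A\<^esub>" "center A = scalars A"
  "ideal I A \<Longrightarrow> I = {\<zero>\<^bsub>A\<^esub>} \<or> I = carrier A" "has_dim A (2 * n * (2 * n)) (carrier A)"
  using csa by (auto simp: central_simple_def power2_eq_square)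

lemma idempotents: "idempotents A.S (2 * n) e"
proof (rule idempotents.intro[OF A.assoc_algebra_S], rule idempotents_axioms.intro)
  fix x q assume xq: "x \<in> carrier A.S" "q \<in> carrier A.S" "x \<noteq> \<zero>\<^sub>s"
    and 0: "\<And>s. s \<in> carrier A.S \<Longrightarrow> x \<cdot> s \<cdot> q = \<zero>\<^sub>s"
  show "q = \<zero>\<^sub>s"
    by (rule A.prime_extension[OF A_facts(3,2) xq(1,3,2)]) (simp_all add: 0)
next
  show "has_dim A.S (2 * n * (2 * n)) (carrier A.S)"
    by (rule A.has_dim_ext[OF A_facts(1,4)])
qed (simp_all add: e_mult e_nonzero e_sum A.one_ext_neq A_facts)

definition "u = (SOME u. peirce A.S (2 * n) e u \<and> (\<forall>i<2 * n. u i i = e i) \<and>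
    (\<forall>i<2 * n. \<forall>j<2 * n. \<forall>k<2 * n. \<forall>l<2 * n.
      u i j \<cdot> u k l = (if j = k then u i l else \<zero>\<^sub>s)))"

lemma u: "peirce A.S (2 * n) e u" "i < 2 * n \<Longrightarrow> u i i = e i"
  "i < 2 * n \<Longrightarrow> j < 2 * n \<Longrightarrow> k < 2 * n \<Longrightarrow> l < 2 * n \<Longrightarrow>
    u i j \<cdot> u k l = (if j = k then u i l else \<zero>\<^sub>s)"
  using someI_ex[OF idempotents.matrix_units_ex[OF idempotents], folded u_def] by auto

lemma matrix_units: "matrix_units A.S (2 * n) e u"
  by (rule matrix_units.intro[OF u(1)], rule matrix_units_axioms.intro) (simp_all add: u e_sum)

sublocale M: matrix_units A.S "2 * n" e u
  by (rule matrix_units)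

section \<open>Traces on the image of the etale algebra and descent\<close>

lemma trace_E:
  assumes "x \<in> carrier L.S"
  shows "M.trace (E x) = (\<Sum>i<2 * n. \<phi> x i)"
proof -
  have "semilinear_form id L.S (\<lambda>x. M.trace (E x))"
    using M.trace_form by (simp add: semilinear_form_def E_add E_smult)
  from L.form_expand[OF this assms] show ?thesis
    by (simp add: M.trace_e flip: e_def)
qed

lemma trace_eps: "l \<in> carrier L \<Longrightarrow> M.trace (img l) = (\<Sum>i<2 * n. L.\<xi> i l)"
  using trace_E[of "L.tens l 1"] by (simp add: E_tens L.xi)

text \<open>Supplies the element at which the factor in \<open>trace_in_base\<close> is found. The
  unit would not do, since its trace \<open>2n\<close> may vanish in the field; the idempotent
  \<open>D 0\<close> has trace \<open>1\<close>, so the trace form cannot be zero on all of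
  \<open>L\<close>.\<close>

lemma trace_eps_nonzero: "\<exists>l\<in>carrier L. (\<Sum>i<2 * n. L.\<xi> i l) \<noteq> 0"
proof (rule ccontr)
  assume 0: "\<not> ?thesis"
  have "(\<Sum>i<2 * n. \<phi> (L.D 0) i) = (\<lambda>_. 0) (L.D 0)"
  proof (rule L.forms_agree)
    show "semilinear_form id L.S (\<lambda>x. \<Sum>i<2 * n. \<phi> x i)"
      by (simp add: semilinear_form_def L.phi_hom sum.distrib sum_distrib_left)
    show "semilinear_form id L.S (\<lambda>_. 0)" by (simp add: semilinear_form_def)
    show "(\<Sum>i<2 * n. \<phi> (L.tens a 1) i) = 0" if "a \<in> carrier L" for a
      using 0 that by (simp add: L.xi)
  qed simp
  moreover have "(\<Sum>i<2 * n. \<phi> (L.D 0) i) = (\<Sum>i<2 * n. if i = 0 then 1 else 0)"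
    by (intro sum.cong) (auto simp: L.phi_D)
  ultimately show False using n_pos by simp
qed

text \<open>
  The trace and the extension of its projection to the base field both vanish on commutators, hence
  are proportional; comparing them on the image of the etale algebra shows that they agree.
\<close>

lemma trace_in_base:
  assumes "a \<in> carrier A"
  shows "\<exists>c. M.trace (A.tens a 1) = \<iota> c"
proof -
  note T = M.trace_form[unfolded semilinear_form_def]
  define g where "g a = \<iota> (A.\<kappa> 1 (M.trace (A.tens a 1)))" for a
  have tr_smult: "M.trace (A.tens (c \<odot>\<^bsub>A\<^esub> a) 1) = \<iota> c * M.trace (A.tens a 1)" if "a \<in> carrier A" for a c
    using T A.smult_tens[OF that, of "\<iota> c" 1] that by (simp add: A.tens_smult) (metis A.tens_closed)
  have "semilinear_form \<iota> A g"
    unfolding semilinear_form_def g_def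
    using T by (simp add: A.tens_add_left tr_smult A.kappa_add A.kappa_scale A.hom_add A.hom_mult)
  from A.form_lift_exists[OF this] obtain G where G0: "semilinear_form id A.S G \<and>
      (\<forall>a\<in>carrier A. \<forall>k. G (A.tens a k) = k * g a)" ..
  then have G: "semilinear_form id A.S G" "\<And>a k. a \<in> carrier A \<Longrightarrow> G (A.tens a k) = k * g a"
    by auto
  have Gadd: "G (x \<oplus>\<^bsub>A.S\<^esub> y) = G x + G y" if "x \<in> carrier A.S" "y \<in> carrier A.S" for x y
    using G(1) that by (simp add: semilinear_form_def)
  have g_comm: "g (a \<otimes>\<^bsub>A\<^esub> b) = g (b \<otimes>\<^bsub>A\<^esub> a)" if "a \<in> carrier A" "b \<in> carrier A" for a b
    using M.trace_comm[of "A.tens a 1" "A.tens b 1"] that by (simp add: g_def A.tens_mult)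
  have G_comm: "G (x \<cdot> y) = G (y \<cdot> x)" if "x \<in> carrier A.S" "y \<in> carrier A.S" for x y
    using that(1)
  proof (induction x rule: A.ext_induct)
    case (tens a k)
    from that(2) show ?case
    proof (induction y rule: A.ext_induct)
      case (tens b l)
      with \<open>a \<in> carrier A\<close> show ?case using g_comm[of a b] by (simp add: A.tens_mult G(2) mult.commute)
    next
      case (add y y')
      with \<open>a \<in> carrier A\<close> show ?case by (simp add: A.ext.l_distr A.ext.r_distr Gadd)
    qed
  next
    case (add x x')
    with that(2) show ?case by (simp add: A.ext.l_distr A.ext.r_distr Gadd)
  qed
  have GT: "G x = G (e 0) * M.trace x" if "x \<in> carrier A.S" for x
    by (rule M.central_form_unique[OF G(1) G_comm that])
  obtain l where l: "l \<in> carrier L" "(\<Sum>i<2 * n. L.\<xi> i l) \<noteq> 0" using trace_eps_nonzero by blast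
  obtain c where c: "(\<Sum>i<2 * n. L.\<xi> i l) = \<iota> c" using L.trace_rational[OF l(1)] by blast
  have "G (img l) = M.trace (img l)"
    using l(1) eps(1)[OF l(1)] by (simp add: G(2) g_def trace_eps c A.kappa_one)
  with GT[of "img l"] l eps(1)[OF l(1)] have "G (e 0) = 1" by (simp add: trace_eps)
  with GT[of "A.tens a 1"] assms have "M.trace (A.tens a 1) = g a" by (simp add: G(2))
  then show ?thesis unfolding g_def ..
qed

text \<open>The definite description is meaningful: \<open>to_mat\<close> is one admissible
  isomorphism, \<open>trace_unique\<close> makes all others agree with it, and \<iota> is injective
  because \<open>\<kappa> 1\<close> inverts it.\<close>

lemma reduced_trace:
  assumes "a \<in> carrier A"
  shows "\<iota> (reduced_trace \<iota> A a) = M.trace (A.tens a 1)"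
proof -
  obtain c where c: "M.trace (A.tens a 1) = \<iota> c" using trace_in_base[OF assms] ..
  have "reduced_trace \<iota> A a = c"
    unfolding reduced_trace_def
  proof (rule the_equality)
    show "\<exists>d \<psi>. algebra_iso A.S (module_mat TYPE('k) d d) \<psi> \<and> mat_trace (\<psi> (A.tens a 1)) = \<iota> c"
      using M.to_mat_iso M.trace_to_mat c by metis
    show "t = c" if "\<exists>d \<psi>. algebra_iso A.S (module_mat TYPE('k) d d) \<psi> \<and>
        mat_trace (\<psi> (A.tens a 1)) = \<iota> t" for t
    proof -
      from that have "M.trace (A.tens a 1) = \<iota> t"
        using M.trace_unique assms A.tens_closed by metis
      with c have "\<iota> t = \<iota> c" by simp
      then have "A.\<kappa> 1 (\<iota> t) = A.\<kappa> 1 (\<iota> c)" by simp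
      then show "t = c" by (simp add: A.kappa_one)
    qed
  qed
  with c show ?thesis by simp
qed

end

section \<open>The linear varieties attached to sets of homomorphisms\<close>

context embedding_data
begin

definition "eT T = (\<Oplus>\<^bsub>A.S\<^esub>i\<in>T. e i)"
text \<open>The right ideal \<open>eT T\<close> times \<open>S\<close>, described as a fixed set so
  that membership is a single equation.\<close>

definition "V T = {x \<in> carrier A.S. eT T \<cdot> x = x}"

lemma eT_closed [simp]: "eT T \<in> carrier A.S"
  unfolding eT_def by (intro A.ext.finsum_closed) simp

lemma e_eT:
  assumes "T \<subseteq> {..<2 * n}" "i < 2 * n"
  shows "e i \<cdot> eT T = (if i \<in> T then e i else \<zero>\<^sub>s)"
    and "eT T \<cdot> e i = (if i \<in> T then e i else \<zero>\<^sub>s)"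
proof -
  have fin: "finite T" using assms(1) finite_subset by blast
  have single: "(\<Oplus>\<^bsub>A.S\<^esub>k\<in>T. if k = i then e i else \<zero>\<^sub>s) = (if i \<in> T then e i else \<zero>\<^sub>s)"
  proof (cases "i \<in> T")
    case True
    then show ?thesis using fin by (simp add: M.finsum_single)
  next
    case False
    then have "(\<Oplus>\<^bsub>A.S\<^esub>k\<in>T. if k = i then e i else \<zero>\<^sub>s) = (\<Oplus>\<^bsub>A.S\<^esub>k\<in>T. \<zero>\<^sub>s)"
      by (intro A.ext.finsum_cong') auto
    with False show ?thesis by (simp add: A.ext.finsum_zero)
  qed
  have "e i \<cdot> eT T = (\<Oplus>\<^bsub>A.S\<^esub>k\<in>T. e i \<cdot> e k)"
    unfolding eT_def by (rule A.ext.finsum_rdistr[OF fin]) auto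
  also have "\<dots> = (\<Oplus>\<^bsub>A.S\<^esub>k\<in>T. if k = i then e i else \<zero>\<^sub>s)"
    using assms by (intro A.ext.finsum_cong') (auto simp: e_mult)
  finally show "e i \<cdot> eT T = (if i \<in> T then e i else \<zero>\<^sub>s)" by (simp only: single)
  have "eT T \<cdot> e i = (\<Oplus>\<^bsub>A.S\<^esub>k\<in>T. e k \<cdot> e i)"
    unfolding eT_def by (rule A.ext.finsum_ldistr[OF fin]) auto
  also have "\<dots> = (\<Oplus>\<^bsub>A.S\<^esub>k\<in>T. if k = i then e i else \<zero>\<^sub>s)"
    using assms by (intro A.ext.finsum_cong') (auto simp: e_mult)
  finally show "eT T \<cdot> e i = (if i \<in> T then e i else \<zero>\<^sub>s)" by (simp only: single)
qed

lemma eT_e_sum: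
  assumes "T \<subseteq> {..<2 * n}" "x \<in> carrier A.S"
  shows "eT T \<cdot> x = (\<Oplus>\<^bsub>A.S\<^esub>i\<in>T. e i \<cdot> x)"
  unfolding eT_def using assms finite_subset[OF assms(1)] by (intro A.ext.finsum_ldistr) auto

lemma right_ideal_V: "right_ideal (V T) A.S"
  unfolding right_ideal_def
proof (intro conjI ballI)
  show "additive_subgroup (V T) A.S"
  proof (intro additive_subgroup.intro A.ext.add.subgroupI)
    show "V T \<noteq> {}" by (auto simp: V_def intro!: exI[of _ "\<zero>\<^sub>s"])
    show "\<ominus>\<^bsub>A.S\<^esub> a \<in> V T" if "a \<in> V T" for a
      using that by (auto simp: V_def A.ext.r_minus)
  qed (auto simp: V_def A.ext.r_distr)
  show "x \<cdot> a \<in> V T" if "x \<in> V T" "a \<in> carrier A.S" for x a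
    using that by (auto simp: V_def simp flip: A.ext.m_assoc)
qed

text \<open>In matrix terms, \<open>V T\<close> consists of the matrices whose rows outside
  \<open>T\<close> vanish. Each row in \<open>T\<close> contributes \<open>2n\<close> to its
  dimension.\<close>

lemma lin_span_V:
  assumes T: "T \<subseteq> {..<2 * n}"
  shows "A.extm.lin_span (T \<times> {..<2 * n}) (\<lambda>p. u (fst p) (snd p)) = V T"
    (is "?span = _")
proof
  have fin: "finite (T \<times> {..<2 * n})" using T finite_subset by blast
  show "?span \<subseteq> V T"
  proof
    fix x assume "x \<in> ?span"
    then obtain c where x: "x = (\<Oplus>\<^bsub>A.S\<^esub>p\<in>T \<times> {..<2 * n}. c p \<odot>\<^bsub>A.S\<^esub> u (fst p) (snd p))"
      unfolding A.extm.lin_span_def by blast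
    have cl: "(\<lambda>p. c p \<odot>\<^bsub>A.S\<^esub> u (fst p) (snd p)) \<in> T \<times> {..<2 * n} \<rightarrow> carrier A.S"
      using T by auto
    have "eT T \<cdot> (c p \<odot>\<^bsub>A.S\<^esub> u (fst p) (snd p)) = c p \<odot>\<^bsub>A.S\<^esub> u (fst p) (snd p)"
      if "p \<in> T \<times> {..<2 * n}" for p
    proof -
      have p: "fst p < 2 * n" "snd p < 2 * n" "fst p \<in> T" using that T by auto
      have "eT T \<cdot> u (fst p) (snd p) = eT T \<cdot> (e (fst p) \<cdot> u (fst p) (snd p))"
        using p by (simp add: M.e_u)
      also have "\<dots> = (eT T \<cdot> e (fst p)) \<cdot> u (fst p) (snd p)"
        using p by (simp add: A.ext.m_assoc)
      also have "\<dots> = u (fst p) (snd p)"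
        using p e_eT(2)[OF T p(1)] by (simp add: M.e_u)
      finally show ?thesis using p by (simp add: A.extm.smult_mult_right)
    qed
    then have "(\<Oplus>\<^bsub>A.S\<^esub>p\<in>T \<times> {..<2 * n}. eT T \<cdot> (c p \<odot>\<^bsub>A.S\<^esub> u (fst p) (snd p))) = x"
      unfolding x using cl by (intro A.ext.finsum_cong') auto
    then have "eT T \<cdot> x = x"
      using A.ext.finsum_rdistr[OF fin eT_closed cl, of T] by (simp add: x)
    moreover have "x \<in> carrier A.S" unfolding x using cl by (rule A.ext.finsum_closed)
    ultimately show "x \<in> V T" by (simp add: V_def)
  qed
  show "V T \<subseteq> ?span"
  proof
    fix x assume x: "x \<in> V T"
    then have xS: "x \<in> carrier A.S" and ex: "eT T \<cdot> x = x" by (auto simp: V_def)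
    have c0: "M.coef x i j = 0" if "i < 2 * n" "j < 2 * n" "i \<notin> T" for i j
    proof (rule M.coef_eqI)
      have "e i \<cdot> x = (e i \<cdot> eT T) \<cdot> x"
        using xS ex by (simp add: A.ext.m_assoc)
      then have "e i \<cdot> x = \<zero>\<^sub>s" using e_eT(1)[OF T that(1)] that(3) xS by simp
      then show "e i \<cdot> x \<cdot> e j = 0 \<odot>\<^bsub>A.S\<^esub> u i j" using that by simp
    qed (use that in auto)
    have z: "M.coef x (fst p) (snd p) \<odot>\<^bsub>A.S\<^esub> u (fst p) (snd p) = \<zero>\<^sub>s"
      if "p \<in> {..<2 * n} \<times> {..<2 * n} - T \<times> {..<2 * n}" for p
    proof -
      from that obtain a b where "p = (a, b)" "a < 2 * n" "b < 2 * n" "a \<notin> T" by auto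
      then show ?thesis by (simp add: c0)
    qed
    have "(\<Oplus>\<^bsub>A.S\<^esub>p\<in>T \<times> {..<2 * n}. M.coef x (fst p) (snd p) \<odot>\<^bsub>A.S\<^esub> u (fst p) (snd p)) =
        (\<Oplus>\<^bsub>A.S\<^esub>p\<in>{..<2 * n} \<times> {..<2 * n}. M.coef x (fst p) (snd p) \<odot>\<^bsub>A.S\<^esub> u (fst p) (snd p))"
      using T by (intro A.ext.add.finprod_mono_neutral_cong_left) (simp_all add: z Sigma_mono Pi_iff split_beta)
    also have "\<dots> = x" by (rule M.coef_expand[OF xS])
    finally show "x \<in> ?span"
      unfolding A.extm.lin_span_def
      by (intro range_eqI[of _ _ "\<lambda>p. M.coef x (fst p) (snd p)"]) simp
  qed
qed

lemma lin_indep_V: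
  assumes T: "T \<subseteq> {..<2 * n}"
  shows "A.extm.lin_indep (T \<times> {..<2 * n}) (\<lambda>p. u (fst p) (snd p))"
  unfolding A.extm.lin_indep_def
proof (intro allI impI ballI)
  fix c p
  assume 0: "(\<Oplus>\<^bsub>A.S\<^esub>p\<in>T \<times> {..<2 * n}. c p \<odot>\<^bsub>A.S\<^esub> u (fst p) (snd p)) = \<zero>\<^sub>s"
    and p: "p \<in> T \<times> {..<2 * n}"
  define c' where "c' p = (if p \<in> T \<times> {..<2 * n} then c p else 0)" for p
  have "(\<Oplus>\<^bsub>A.S\<^esub>p\<in>{..<2 * n} \<times> {..<2 * n}. c' p \<odot>\<^bsub>A.S\<^esub> u (fst p) (snd p)) =
      (\<Oplus>\<^bsub>A.S\<^esub>p\<in>T \<times> {..<2 * n}. c p \<odot>\<^bsub>A.S\<^esub> u (fst p) (snd p))"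
    using T by (intro A.ext.add.finprod_mono_neutral_cong_right) (auto simp: c'_def)
  then have "\<forall>p\<in>{..<2 * n} \<times> {..<2 * n}. c' p = 0"
    unfolding 0 by (rule mp[OF M.units_indep[unfolded A.extm.lin_indep_def, THEN spec[of _ c']]])
  then have "c' p = 0" using p T by blast
  with p show "c p = 0" by (simp add: c'_def)
qed

lemma linear_variety_V:
  assumes "T \<subseteq> {..<2 * n}"
  shows "linear_variety \<iota> n A (card T) (V T)"
proof -
  have fin: "finite T" using assms finite_subset by blast
  have "has_dim A.S (card (T \<times> {..<2 * n})) (V T)"
    unfolding lin_span_V[OF assms, symmetric]
    by (rule A.extm.has_dim_lin_span[OF A.one_ext_neq[OF A_facts(1)] _ _ lin_indep_V[OF assms]])
      (use fin assms in auto)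
  then show ?thesis
    unfolding linear_variety_def
    using right_ideal_V by (simp add: card_cartesian_product mult.commute)
qed

text \<open>If \<open>x\<close> satisfies the defining equations for \<open>\<xi> i\<close>,
  multiplication by \<open>e k\<close> gives \<open>\<xi> i l e k x = \<xi> k l e k x\<close>.
  Choosing \<open>l\<close> to separate the two homomorphisms kills \<open>e k x\<close> for each
  \<open>k \<noteq> i\<close>, leaving \<open>x = e i x\<close>.\<close>

lemma induced_map_V:
  assumes i: "i < 2 * n"
  shows "\<epsilon>\<^sub>* (L.\<xi> i) = V {i}"
proof -
  have eT: "eT {i} = e i" by (simp add: eT_def)
  have eq: "A.tens \<one>\<^bsub>A\<^esub> (L.\<xi> i l) \<cdot> x = img l \<cdot> x"
    if "x \<in> V {i}" "l \<in> carrier L" for x l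
  proof -
    have x: "x \<in> carrier A.S" "e i \<cdot> x = x" using that by (auto simp: V_def eT)
    have "img l \<cdot> x = (img l \<cdot> e i) \<cdot> x"
      using x eps(1)[OF that(2)] by (simp add: A.ext.m_assoc)
    also have "\<dots> = L.\<xi> i l \<odot>\<^bsub>A.S\<^esub> x" using x that i by (simp add: j_e A.extm.smult_mult_left)
    finally show ?thesis by (simp add: A.ext_smult)
  qed
  have mem: "x \<in> V {i}"
    if x: "x \<in> carrier A.S" and l: "\<And>l. l \<in> carrier L \<Longrightarrow>
      A.tens \<one>\<^bsub>A\<^esub> (L.\<xi> i l) \<cdot> x = img l \<cdot> x" for x
  proof -
    have 0: "e k \<cdot> x = \<zero>\<^sub>s" if k: "k < 2 * n" "k \<noteq> i" for k
    proof -
      obtain l where l': "l \<in> carrier L" "L.\<xi> k l \<noteq> L.\<xi> i l"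
        using L.xi_separate[OF k(1) i k(2)] by blast
      have "L.\<xi> i l \<odot>\<^bsub>A.S\<^esub> (e k \<cdot> x) = e k \<cdot> (L.\<xi> i l \<odot>\<^bsub>A.S\<^esub> x)"
        using x by (simp add: A.extm.smult_mult_right)
      also have "\<dots> = (e k \<cdot> img l) \<cdot> x"
        using l[OF l'(1)] x eps(1)[OF l'(1)] by (simp add: A.ext_smult A.ext.m_assoc)
      also have "\<dots> = L.\<xi> k l \<odot>\<^bsub>A.S\<^esub> (e k \<cdot> x)"
        using x k l'(1) by (simp add: j_e A.extm.smult_mult_left)
      finally show ?thesis
        using A.extm.smult_cancel[of "e k \<cdot> x" "L.\<xi> i l" "L.\<xi> k l"] l'(2) x by auto
    qed
    have "x = eT {..<2 * n} \<cdot> x" using x by (simp add: eT_def e_sum)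
    also have "\<dots> = (\<Oplus>\<^bsub>A.S\<^esub>k\<in>{..<2 * n}. e k \<cdot> x)" using x by (simp add: eT_e_sum)
    also have "\<dots> = (\<Oplus>\<^bsub>A.S\<^esub>k\<in>{..<2 * n}. if k = i then e i \<cdot> x else \<zero>\<^sub>s)"
      using x 0 by (intro A.ext.finsum_cong') auto
    also have "\<dots> = e i \<cdot> x" using x i by (intro M.finsum_single) auto
    finally show ?thesis using x by (simp add: V_def eT)
  qed
  show ?thesis
    unfolding induced_map_def using eq mem by (auto simp: V_def)
qed

text \<open>\<open>J\<close> contains \<open>e i\<close> and hence \<open>e i x\<close> for every
  \<open>i\<close> in \<open>T\<close>; for \<open>x\<close> in \<open>V T\<close> these elements
  add up to \<open>x\<close>. Minimality of the span and general position both rest on this.\<close>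

lemma V_mono_span:
  assumes T: "T \<subseteq> {..<2 * n}" and J: "right_ideal J A.S" "\<And>i. i \<in> T \<Longrightarrow> V {i} \<subseteq> J"
  shows "V T \<subseteq> J"
proof
  interpret J: additive_subgroup J A.S using J(1) by (simp add: right_ideal_def)
  have fin: "finite T" using T finite_subset by blast
  fix x assume "x \<in> V T"
  then have x: "x \<in> carrier A.S" "eT T \<cdot> x = x" by (auto simp: V_def)
  have ex: "e i \<cdot> x \<in> J" if "i \<in> T" for i
  proof -
    have "e i \<in> V {i}" using that T e_mult[of i i] by (auto simp: V_def eT_def)
    then show ?thesis using J that x(1) by (auto simp: right_ideal_def)
  qed
  have mem: "(\<Oplus>\<^bsub>A.S\<^esub>i\<in>T'. e i \<cdot> x) \<in> J" if "T' \<subseteq> T" for T'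
    using finite_subset[OF that fin] that
    by (induction T' rule: finite_induct) (use x(1) ex in \<open>auto simp: A.ext.finsum_insert Pi_def\<close>)
  from mem[of T] show "x \<in> J" using eT_e_sum[OF T x(1)] x(2) by simp
qed

text \<open>\<open>V T\<close> is itself one of the linear varieties being intersected, and by
  \<open>V_mono_span\<close> it lies in all the others.\<close>

lemma spanned_V:
  assumes T: "T \<subseteq> {..<2 * n}"
  shows "spanned_variety \<iota> n A (\<epsilon>\<^sub>* ` L.\<xi> ` T) = V T"
proof
  have ind: "\<epsilon>\<^sub>* ` L.\<xi> ` T = (\<lambda>i. V {i}) ` T"
    using T induced_map_V by (force simp: image_image)
  have "V {i} \<subseteq> V T" if "i \<in> T" for i
  proof
    fix x assume "x \<in> V {i}"
    then have x: "x \<in> carrier A.S" "e i \<cdot> x = x" by (auto simp: V_def eT_def)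
    then have "eT T \<cdot> x = (eT T \<cdot> e i) \<cdot> x" by (simp add: A.ext.m_assoc)
    also have "\<dots> = x" using e_eT(2)[OF T, of i] that T x by auto
    finally show "x \<in> V T" using x by (simp add: V_def)
  qed
  with linear_variety_V[OF T] show "spanned_variety \<iota> n A (\<epsilon>\<^sub>* ` L.\<xi> ` T) \<subseteq> V T"
    unfolding spanned_variety_def ind by (intro Inter_lower) blast
  show "V T \<subseteq> spanned_variety \<iota> n A (\<epsilon>\<^sub>* ` L.\<xi> ` T)"
    unfolding spanned_variety_def ind
  proof (intro Inter_greatest)
    fix J assume "J \<in> {J. (\<exists>k. linear_variety \<iota> n A k J) \<and> (\<forall>I\<in>(\<lambda>i. V {i}) ` T. I \<subseteq> J)}"
    then show "V T \<subseteq> J" by (intro V_mono_span[OF T]) (auto simp: linear_variety_def)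
  qed
qed

lemma general_position: "general_position \<iota> n A (\<epsilon>\<^sub>* ` L.\<xi> ` {..<2 * n})"
  unfolding general_position_def
proof
  assume "\<exists>k J. linear_variety \<iota> n A k J \<and> J \<noteq> carrier A.S \<and>
    (\<forall>I\<in>\<epsilon>\<^sub>* ` L.\<xi> ` {..<2 * n}. I \<subseteq> J)"
  then obtain J where J: "right_ideal J A.S" "J \<noteq> carrier A.S" "\<And>i. i < 2 * n \<Longrightarrow> V {i} \<subseteq> J"
    by (force simp: linear_variety_def induced_map_V)
  have "V {..<2 * n} \<subseteq> J" by (rule V_mono_span[OF subset_refl J(1)]) (use J(3) in auto)
  moreover have "V {..<2 * n} = carrier A.S" by (auto simp: V_def eT_def e_sum)
  moreover have "J \<subseteq> carrier A.S"
    using J(1) by (simp add: right_ideal_def additive_subgroup.a_subset)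
  ultimately show False using J(2) by blast
qed

lemma induced_map_inj: "inj_on (\<epsilon>\<^sub>*) (L.\<xi> ` {..<2 * n})"
proof (rule inj_onI)
  fix \<eta> \<eta>' assume "\<eta> \<in> L.\<xi> ` {..<2 * n}" "\<eta>' \<in> L.\<xi> ` {..<2 * n}"
    and eq: "\<epsilon>\<^sub>* \<eta> = \<epsilon>\<^sub>* \<eta>'"
  then obtain i k where ik: "i < 2 * n" "k < 2 * n" "\<eta> = L.\<xi> i" "\<eta>' = L.\<xi> k" by auto
  have "e i \<in> V {i}" using ik e_mult[of i i] by (simp add: V_def eT_def)
  then have "e i \<in> V {k}" using eq ik by (simp add: induced_map_V)
  then have "e k \<cdot> e i = e i" by (simp add: V_def eT_def)
  then have "i = k" using e_mult[OF ik(2,1)] e_nonzero[OF ik(1)] by (auto split: if_splits)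
  with ik show "\<eta> = \<eta>'" by simp
qed

end

section \<open>Isotropy\<close>

context embedding_data
begin

lemma inv: "linear_involution A \<sigma>"
  using pair by (simp add: quadratic_pair_def)

lemmas inv_props = A.linear_involutionD[OF inv]

abbreviation "\<sigma>\<^sub>s \<equiv> ext_map \<iota> A \<sigma>"

lemmas ext_inv = A.ext_map[of \<sigma>, OF inv_props(1-3)]

lemma involution_L_hom: "\<sigma>\<^sub>L \<in> Ring.ring_hom L L"
  using involution by (simp add: etale_with_involution_def algebra_iso_def algebra_hom_def)

lemma involution_L:
  "l \<in> carrier L \<Longrightarrow> \<sigma>\<^sub>L l \<in> carrier L"
  "l \<in> carrier L \<Longrightarrow> l' \<in> carrier L \<Longrightarrow> \<sigma>\<^sub>L (l \<oplus>\<^bsub>L\<^esub> l') = \<sigma>\<^sub>L l \<oplus>\<^bsub>L\<^esub> \<sigma>\<^sub>L l'"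
  "l \<in> carrier L \<Longrightarrow> l' \<in> carrier L \<Longrightarrow> \<sigma>\<^sub>L (l \<otimes>\<^bsub>L\<^esub> l') = \<sigma>\<^sub>L l \<otimes>\<^bsub>L\<^esub> \<sigma>\<^sub>L l'"
  "\<sigma>\<^sub>L \<one>\<^bsub>L\<^esub> = \<one>\<^bsub>L\<^esub>"
  "l \<in> carrier L \<Longrightarrow> \<sigma>\<^sub>L (c \<odot>\<^bsub>L\<^esub> l) = c \<odot>\<^bsub>L\<^esub> \<sigma>\<^sub>L l"
  "l \<in> carrier L \<Longrightarrow> \<sigma>\<^sub>L (\<sigma>\<^sub>L l) = l"
  using involution ring_hom_closed[OF involution_L_hom] ring_hom_add[OF involution_L_hom]
    ring_hom_mult[OF involution_L_hom] ring_hom_one[OF involution_L_hom]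
  by (auto simp: etale_with_involution_def algebra_iso_def algebra_hom_def)

lemma X_involution_closed:
  assumes "\<eta> \<in> X_homs \<iota> L"
  shows "X_involution L \<sigma>\<^sub>L \<eta> \<in> X_homs \<iota> L"
proof -
  note h = L.X_homsD[OF assms, unfolded semilinear_form_def]
  have "X_involution L \<sigma>\<^sub>L \<eta> \<in> Ring.ring_hom L (extension_algebra \<iota>)"
    by (rule ring_hom_memI)
      (use h in \<open>simp_all add: X_involution_def compose_def involution_L extension_algebra_def\<close>)
  then show ?thesis
    using h by (simp add: X_homs_def algebra_hom_def)
      (simp add: X_involution_def compose_def involution_L extension_algebra_def)
qed

lemma X_involution_involutive:
  assumes "\<eta> \<in> X_homs \<iota> L"
  shows "X_involution L \<sigma>\<^sub>L (X_involution L \<sigma>\<^sub>L \<eta>) = \<eta>"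
  by (rule extensionalityI[of _ "carrier L"])
    (use L.X_homsD(4)[OF assms] in \<open>simp_all add: X_involution_def compose_def involution_L\<close>)

lemma X_involution_free:
  "\<eta> \<in> X_homs \<iota> L \<Longrightarrow> X_involution L \<sigma>\<^sub>L \<eta> \<noteq> \<eta>"
  using involution by (simp add: etale_with_involution_def)

section \<open>Conjugation of indices and its consequences for the form\<close>

definition "s i = (SOME k. k < 2 * n \<and> X_involution L \<sigma>\<^sub>L (L.\<xi> i) = L.\<xi> k)"

lemma s:
  assumes "i < 2 * n"
  shows "s i < 2 * n" "X_involution L \<sigma>\<^sub>L (L.\<xi> i) = L.\<xi> (s i)"
proof -
  have "\<exists>k. k < 2 * n \<and> X_involution L \<sigma>\<^sub>L (L.\<xi> i) = L.\<xi> k"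
    using L.X_homs_xi[OF X_involution_closed[OF L.xi_X_homs[OF assms]]] by metis
  then have "s i < 2 * n \<and> X_involution L \<sigma>\<^sub>L (L.\<xi> i) = L.\<xi> (s i)"
    unfolding s_def by (rule someI_ex)
  then show "s i < 2 * n" "X_involution L \<sigma>\<^sub>L (L.\<xi> i) = L.\<xi> (s i)" by auto
qed

lemma xi_involution: "i < 2 * n \<Longrightarrow> l \<in> carrier L \<Longrightarrow> L.\<xi> i (\<sigma>\<^sub>L l) = L.\<xi> (s i) l"
  using fun_cong[OF s(2), of i l] by (simp add: X_involution_def compose_def)

lemma s_props:
  assumes "i < 2 * n"
  shows "s (s i) = i" "s i \<noteq> i"
proof -
  have "L.\<xi> (s (s i)) = L.\<xi> i"
    using X_involution_involutive[OF L.xi_X_homs[OF assms]] s[OF assms] s[OF s(1)[OF assms]] by simp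
  then show "s (s i) = i"
    using L.X_homs_bij s(1)[OF assms] s(1)[OF s(1)[OF assms]] assms
    by (auto simp: bij_betw_def dest: inj_onD)
  show "s i \<noteq> i"
    using X_involution_free[OF L.xi_X_homs[OF assms]] s(2)[OF assms] by auto
qed

text \<open>Such an element makes the embedding condition on \<open>f\<close> effective, in
  characteristic 2 as well. A solution is found in the split algebra and its coordinate at
  \<open>1\<close> is again a solution.\<close>

lemma half_ex: "\<exists>l\<in>carrier L. l \<oplus>\<^bsub>L\<^esub> \<sigma>\<^sub>L l = \<one>\<^bsub>L\<^esub>"
proof -
  note ext = L.ext_map[of \<sigma>\<^sub>L, OF involution_L(1,2,5)]
  \<comment> \<open>Since \<open>s\<close> is an involution without fixed points, exactly one member
    of each pair \<open>i\<close>, \<open>s i\<close> is assigned the value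
    \<open>1\<close>.\<close>
  obtain x where x: "x \<in> carrier L.S" "\<forall>i<2 * n. \<phi> x i = (if i < s i then 1 else 0)"
    using L.phi_surj[of "\<lambda>i. if i < s i then 1 else 0"] by blast
  have smult: "ext_map \<iota> L \<sigma>\<^sub>L (k \<odot>\<^bsub>L.S\<^esub> y) = k \<odot>\<^bsub>L.S\<^esub> ext_map \<iota> L \<sigma>\<^sub>L y" if "y \<in> carrier L.S" for k y
    using that by (induction rule: L.ext_induct)
      (simp_all add: L.smult_tens ext L.extm.smult_add_vector involution_L)
  have phi_s: "\<phi> (ext_map \<iota> L \<sigma>\<^sub>L y) i = \<phi> y (s i)" if "y \<in> carrier L.S" "i < 2 * n" for y i
  proof (rule L.forms_agree[OF _ L.phi_form[OF s(1)[OF that(2)]] _ that(1)])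
    show "semilinear_form id L.S (\<lambda>y. \<phi> (ext_map \<iota> L \<sigma>\<^sub>L y) i)"
      using that by (simp add: semilinear_form_def ext smult L.phi_hom)
    show "\<phi> (ext_map \<iota> L \<sigma>\<^sub>L (L.tens a 1)) i = \<phi> (L.tens a 1) (s i)" if "a \<in> carrier L" for a
      using that \<open>i < 2 * n\<close> by (simp add: ext L.xi involution_L xi_involution)
  qed
  have "x \<oplus>\<^bsub>L.S\<^esub> ext_map \<iota> L \<sigma>\<^sub>L x = \<one>\<^bsub>L.S\<^esub>"
  proof (rule L.phi_inj)
    fix i assume i: "i < 2 * n"
    have "i < s i \<or> s i < i" using s_props(2)[OF i] by linarith
    then show "\<phi> (x \<oplus>\<^bsub>L.S\<^esub> ext_map \<iota> L \<sigma>\<^sub>L x) i = \<phi> \<one>\<^bsub>L.S\<^esub> i"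
      using x i s(1)[OF i] s_props(1)[OF i] by (auto simp: L.phi_hom ext phi_s)
  qed (use x ext in auto)
  \<comment> \<open>Slices commute with the involution and are additive, so the slice at
    \<open>1\<close> moves the equation from the extension down to \<open>L\<close>.\<close>
  then have "L.slice 1 x \<oplus>\<^bsub>L\<^esub> \<sigma>\<^sub>L (L.slice 1 x) = L.slice 1 \<one>\<^bsub>L.S\<^esub>"
    using x ext L.slice_ext_map[of \<sigma>\<^sub>L x 1, OF involution_L(1,2,5)] by (metis L.slice_add)
  also have "\<dots> = \<one>\<^bsub>L\<^esub>"
    unfolding L.tens_one[symmetric] by (subst L.slice_tens) (simp_all add: L.kappa_basis L.one_B)
  finally show ?thesis using x(1) L.slice_closed by blast
qed

text \<open>The form \<open>y \<mapsto> trace (l y)\<close> is linear on all of \<open>S\<close> and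
  agrees with \<open>f\<close> on symmetric elements of \<open>A\<close> by the embedding condition,
  so it computes the extended form. The same \<open>l\<close> serves for every
  \<open>y\<close>.\<close>

lemma ext_form_trace: "\<exists>l\<in>carrier L. \<forall>y\<in>Sym A.S \<sigma>\<^sub>s.
  ext_form \<iota> A \<sigma> f y = M.trace (img l \<cdot> y)"
proof -
  obtain l where l: "l \<in> carrier L" "l \<oplus>\<^bsub>L\<^esub> \<sigma>\<^sub>L l = \<one>\<^bsub>L\<^esub>" using half_ex by blast
  note T = M.trace_form[unfolded semilinear_form_def]
  have fx: "f x = reduced_trace \<iota> A (\<epsilon> l \<otimes>\<^bsub>A\<^esub> x)" if "x \<in> Sym A \<sigma>" for x
    using embedding that l by (simp add: algebra_inv_embedding_def)
  have el: "\<epsilon> l \<in> carrier A" using eps(1) l(1) .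
  show ?thesis
  proof (intro bexI[OF _ l(1)] ballI)
    fix y assume y: "y \<in> Sym A.S \<sigma>\<^sub>s"
    show "ext_form \<iota> A \<sigma> f y = M.trace (img l \<cdot> y)"
    proof (rule A.ext_form_eq[OF inv _ _ y])
      show "semilinear_form id A.S (\<lambda>y. M.trace (img l \<cdot> y))"
        using T el by (simp add: semilinear_form_def A.ext.r_distr A.extm.smult_mult_right)
      fix x k assume x: "x \<in> Sym A \<sigma>"
      then have xA: "x \<in> carrier A" by (simp add: Sym_def)
      have "img l \<cdot> A.tens x k = k \<odot>\<^bsub>A.S\<^esub> A.tens (\<epsilon> l \<otimes>\<^bsub>A\<^esub> x) 1"
        using el xA by (simp add: A.tens_mult A.smult_tens)
      then show "M.trace (img l \<cdot> A.tens x k) = k * \<iota> (f x)"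
        using T el xA x by (simp add: fx reduced_trace)
    qed
  qed
qed

text \<open>Multiplying \<open>\<sigma>\<^sub>s (e i)\<close> on the right by the image of
  \<open>l\<close> scales it by \<open>\<xi> (s i) l\<close>, while \<open>e k\<close> is scaled by
  \<open>\<xi> k l\<close> from the left. A separating \<open>l\<close> forces the product to
  vanish. This orthogonality is the form in which the action of the involution on the idempotents is
  used.\<close>

lemma inv_e_e:
  assumes "i < 2 * n" "k < 2 * n" "k \<noteq> s i"
  shows "\<sigma>\<^sub>s (e i) \<cdot> e k = \<zero>\<^sub>s"
proof -
  obtain l where l: "l \<in> carrier L" "L.\<xi> k l \<noteq> L.\<xi> (s i) l"
    using L.xi_separate[OF assms(2) s(1)[OF assms(1)] assms(3)] by blast
  let ?j = "img l" and ?y = "\<sigma>\<^sub>s (e i) \<cdot> e k"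
  have cl: "\<sigma>\<^sub>s (e i) \<in> carrier A.S" "?j \<in> carrier A.S" using ext_inv eps(1)[OF l(1)] by simp_all
  have "\<sigma>\<^sub>s (e i) \<cdot> ?j = \<sigma>\<^sub>s (A.tens (\<epsilon> (\<sigma>\<^sub>L l)) 1 \<cdot> e i)"
    using l(1) eps inv_props by (simp add: A.ext_involution_mult[OF inv] ext_inv involution_L)
  also have "\<dots> = \<sigma>\<^sub>s (A.tens \<one>\<^bsub>A\<^esub> (L.\<xi> (s i) l) \<cdot> e i)"
    using l(1) assms by (simp add: j_e involution_L xi_involution A.ext_smult)
  also have "\<dots> = \<sigma>\<^sub>s (e i) \<cdot> A.tens (\<sigma> \<one>\<^bsub>A\<^esub>) (L.\<xi> (s i) l)"
    by (simp add: A.ext_involution_mult[OF inv] ext_inv)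
  \<comment> \<open>The unit is fixed because \<sigma> reverses products and is its own
    inverse.\<close>
  also have "\<sigma> \<one>\<^bsub>A\<^esub> = \<one>\<^bsub>A\<^esub>"
  proof -
    have "\<sigma> \<one>\<^bsub>A\<^esub> = \<sigma> \<one>\<^bsub>A\<^esub> \<otimes>\<^bsub>A\<^esub> \<one>\<^bsub>A\<^esub>" using inv_props(1) by simp
    also have "\<dots> = \<sigma> (\<sigma> \<one>\<^bsub>A\<^esub> \<otimes>\<^bsub>A\<^esub> \<one>\<^bsub>A\<^esub>)"
      using inv_props(1,5) inv_props(4)[of "\<sigma> \<one>\<^bsub>A\<^esub>" "\<one>\<^bsub>A\<^esub>"] by simp
    also have "\<dots> = \<one>\<^bsub>A\<^esub>" using inv_props(1,5) by simp
    finally show ?thesis .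
  qed
  finally have "\<sigma>\<^sub>s (e i) \<cdot> ?j = L.\<xi> (s i) l \<odot>\<^bsub>A.S\<^esub> \<sigma>\<^sub>s (e i)"
    using cl by (simp add: A.ext_smult A.scalar_central)
  then have "L.\<xi> (s i) l \<odot>\<^bsub>A.S\<^esub> ?y = \<sigma>\<^sub>s (e i) \<cdot> ?j \<cdot> e k"
    using cl by (simp add: A.extm.smult_mult_left)
  also have "\<dots> = L.\<xi> k l \<odot>\<^bsub>A.S\<^esub> ?y"
    using cl l(1) assms by (simp add: A.ext.m_assoc j_e A.extm.smult_mult_right)
  finally show ?thesis
    using A.extm.smult_cancel[of ?y "L.\<xi> (s i) l" "L.\<xi> k l"] l(2) cl by auto
qed

lemma j_eT:
  assumes l: "l \<in> carrier L" and T: "T \<subseteq> {..<2 * n}"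
  shows "img l \<cdot> eT T = eT T \<cdot> img l"
proof -
  have fin: "finite T" using T finite_subset by blast
  have j: "img l \<in> carrier A.S" using eps(1)[OF l] by simp
  have "img l \<cdot> eT T = (\<Oplus>\<^bsub>A.S\<^esub>i\<in>T. img l \<cdot> e i)"
    unfolding eT_def using fin j by (intro A.ext.finsum_rdistr) auto
  also have "\<dots> = (\<Oplus>\<^bsub>A.S\<^esub>i\<in>T. e i \<cdot> img l)"
    using T l by (intro A.ext.finsum_cong') (auto simp: j_e subset_iff)
  also have "\<dots> = eT T \<cdot> img l"
    unfolding eT_def using fin j by (intro A.ext.finsum_ldistr[symmetric]) auto
  finally show ?thesis .
qed

lemma inv_eT_eT:
  assumes T: "T \<subseteq> {..<2 * n}" and iso: "\<And>i. i \<in> T \<Longrightarrow> s i \<notin> T"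
  shows "\<sigma>\<^sub>s (eT T) \<cdot> eT T = \<zero>\<^sub>s"
proof -
  have fin: "finite T" using T finite_subset by blast
  have "\<sigma>\<^sub>s (eT T) = (\<Oplus>\<^bsub>A.S\<^esub>i\<in>T. \<sigma>\<^sub>s (e i))"
    unfolding eT_def
    by (rule additive_finsum(3)[OF A.abelian_group_S A.abelian_group_S ext_inv(2,3)])
      (use fin in auto)
  moreover have "(\<Oplus>\<^bsub>A.S\<^esub>i\<in>T. \<sigma>\<^sub>s (e i)) \<cdot> eT T = (\<Oplus>\<^bsub>A.S\<^esub>i\<in>T. \<sigma>\<^sub>s (e i) \<cdot> eT T)"
    using fin ext_inv(2) by (intro A.ext.finsum_ldistr) auto
  moreover have "\<sigma>\<^sub>s (e i) \<cdot> eT T = \<zero>\<^sub>s" if i: "i \<in> T" for i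
  proof -
    have "\<sigma>\<^sub>s (e i) \<cdot> eT T = (\<Oplus>\<^bsub>A.S\<^esub>k\<in>T. \<sigma>\<^sub>s (e i) \<cdot> e k)"
      unfolding eT_def using fin ext_inv(2) by (intro A.ext.finsum_rdistr) auto
    also have "\<dots> = (\<Oplus>\<^bsub>A.S\<^esub>k\<in>T. \<zero>\<^sub>s)"
    proof (intro A.ext.finsum_cong')
      show "\<sigma>\<^sub>s (e i) \<cdot> e k = \<zero>\<^sub>s" if "k \<in> T" for k
        using that T i iso[OF i] by (intro inv_e_e) auto
    qed auto
    finally show ?thesis by (simp add: A.ext.finsum_zero)
  qed
  then have "(\<Oplus>\<^bsub>A.S\<^esub>i\<in>T. \<sigma>\<^sub>s (e i) \<cdot> eT T) = (\<Oplus>\<^bsub>A.S\<^esub>i\<in>T. \<zero>\<^sub>s)"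
    by (intro A.ext.finsum_cong') auto
  ultimately show ?thesis by (simp add: A.ext.finsum_zero)
qed

lemma isotropic_V:
  assumes T: "T \<subseteq> {..<2 * n}" and iso: "\<And>i. i \<in> T \<Longrightarrow> s i \<notin> T"
  shows "isotropic \<iota> A \<sigma> f (V T)"
proof -
  note 0 = inv_eT_eT[OF assms]
  have zero_V: "\<zero>\<^sub>s \<in> V T" by (simp add: V_def)
  have inv_zero: "\<sigma>\<^sub>s \<zero>\<^sub>s = \<zero>\<^sub>s"
    by (rule additive_finsum(1)[OF A.abelian_group_S A.abelian_group_S ext_inv(2,3)])
  have prod: "\<sigma>\<^sub>s x \<cdot> y = \<zero>\<^sub>s" if "x \<in> V T" "y \<in> V T" for x y
  proof -
    have cl: "x \<in> carrier A.S" "y \<in> carrier A.S" "eT T \<cdot> x = x" "eT T \<cdot> y = y"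
      using that by (auto simp: V_def)
    have "\<sigma>\<^sub>s x \<cdot> y = \<sigma>\<^sub>s (eT T \<cdot> x) \<cdot> (eT T \<cdot> y)" by (simp add: cl)
    also have "\<dots> = \<sigma>\<^sub>s x \<cdot> (\<sigma>\<^sub>s (eT T) \<cdot> eT T) \<cdot> y"
      using cl(1,2) ext_inv(2) by (simp add: A.ext_involution_mult[OF inv] A.ext.m_assoc)
    finally show ?thesis using 0 cl(1,2) ext_inv(2) by simp
  qed
  have "(\<sigma>\<^sub>s ` V T) <#>\<^bsub>A.S\<^esub> V T = {\<zero>\<^sub>s}"
  proof
    show "(\<sigma>\<^sub>s ` V T) <#>\<^bsub>A.S\<^esub> V T \<subseteq> {\<zero>\<^sub>s}" using prod by (auto simp: set_mult_def)
    have "\<zero>\<^sub>s = \<sigma>\<^sub>s \<zero>\<^sub>s \<cdot> \<zero>\<^sub>s" by (simp add: inv_zero)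
    with zero_V show "{\<zero>\<^sub>s} \<subseteq> (\<sigma>\<^sub>s ` V T) <#>\<^bsub>A.S\<^esub> V T" unfolding set_mult_def by blast
  qed
  moreover have "ext_form \<iota> A \<sigma> f ` (V T \<inter> Sym A.S \<sigma>\<^sub>s) = {0}"
  proof -
    obtain l where l: "l \<in> carrier L" and form: "\<forall>y\<in>Sym A.S \<sigma>\<^sub>s.
        ext_form \<iota> A \<sigma> f y = M.trace (img l \<cdot> y)"
      using ext_form_trace by blast
    have j: "img l \<in> carrier A.S" using eps(1)[OF l] by simp
    have "ext_form \<iota> A \<sigma> f y = 0" if "y \<in> V T" "y \<in> Sym A.S \<sigma>\<^sub>s" for y
    proof -
      have y: "y \<in> carrier A.S" "eT T \<cdot> y = y" "\<sigma>\<^sub>s y = y"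
        using that by (auto simp: V_def Sym_def)
      have "y \<cdot> eT T = \<sigma>\<^sub>s (eT T \<cdot> y) \<cdot> eT T" by (simp add: y)
      also have "\<dots> = \<sigma>\<^sub>s y \<cdot> (\<sigma>\<^sub>s (eT T) \<cdot> eT T)"
        using y(1) ext_inv(2) by (simp add: A.ext_involution_mult[OF inv] A.ext.m_assoc)
      finally have ye: "y \<cdot> eT T = \<zero>\<^sub>s" using 0 y by simp
      have "img l \<cdot> y = (img l \<cdot> eT T) \<cdot> y"
        using j y by (simp add: A.ext.m_assoc)
      also have "\<dots> = eT T \<cdot> (img l \<cdot> y)"
        using j y(1) by (simp add: j_eT[OF l T] A.ext.m_assoc)
      finally have "M.trace (img l \<cdot> y) =
          M.trace (eT T \<cdot> (img l \<cdot> y))"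
        by simp
      also have "\<dots> = M.trace (img l \<cdot> y \<cdot> eT T)"
        using j y(1) by (intro M.trace_comm) auto
      also have "\<dots> = M.trace \<zero>\<^sub>s" using j y(1) by (simp add: A.ext.m_assoc ye)
      also have "\<dots> = 0" by (rule semilinear_form_finsum(1)[OF A.abelian_group_S M.trace_form])
      finally show ?thesis using form that(2) by simp
    qed
    then have "ext_form \<iota> A \<sigma> f ` (V T \<inter> Sym A.S \<sigma>\<^sub>s) \<subseteq> {0}" by auto
    \<comment> \<open>\<open>isotropic\<close> asks for the image to be exactly \<open>{0}\<close>,
      so a symmetric element of \<open>V T\<close> must be exhibited; zero is one.\<close>
    moreover have "V T \<inter> Sym A.S \<sigma>\<^sub>s \<noteq> {}" using zero_V inv_zero by (auto simp: Sym_def)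
    ultimately show ?thesis by (metis image_is_empty subset_singletonD)
  qed
  ultimately show ?thesis using right_ideal_V by (simp add: isotropic_def)
qed

end

section \<open>The Galois action\<close>

lemma galois_group_iff:
  fixes \<iota> :: "'f::field \<Rightarrow> 'k::field"
  shows "\<gamma> \<in> carrier (galois_group \<iota>) \<longleftrightarrow> bij \<gamma> \<and> (\<forall>k l. \<gamma> (k + l) = \<gamma> k + \<gamma> l) \<and>
    (\<forall>k l. \<gamma> (k * l) = \<gamma> k * \<gamma> l) \<and> \<gamma> 1 = 1 \<and> (\<forall>c k. \<gamma> (\<iota> c * k) = \<iota> c * \<gamma> k)"
proof -
  have "\<gamma> (\<iota> c * k) = \<iota> c * \<gamma> k" if "\<forall>k l. \<gamma> (k * l) = \<gamma> k * \<gamma> l" "\<forall>c. \<gamma> (\<iota> c) = \<iota> c" for c k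
    using that by simp
  then show ?thesis
    by (auto simp: galois_group_def algebra_iso_def algebra_hom_def extension_algebra_def
        Ring.ring_hom_def)
qed

lemma galois_group_group: "group (galois_group \<iota>)"
proof (rule groupI)
  have one: "\<one>\<^bsub>galois_group \<iota>\<^esub> = id" and mult: "x \<otimes>\<^bsub>galois_group \<iota>\<^esub> y = x \<circ> y" for x y
    by (simp_all add: galois_group_def)
  show "\<one>\<^bsub>galois_group \<iota>\<^esub> \<in> carrier (galois_group \<iota>)"
    by (simp add: one galois_group_iff)
  show "x \<otimes>\<^bsub>galois_group \<iota>\<^esub> y \<in> carrier (galois_group \<iota>)"
    if "x \<in> carrier (galois_group \<iota>)" "y \<in> carrier (galois_group \<iota>)" for x y
    using that by (auto simp: mult galois_group_iff bij_comp)
  show "\<exists>y\<in>carrier (galois_group \<iota>). y \<otimes>\<^bsub>galois_group \<iota>\<^esub> x = \<one>\<^bsub>galois_group \<iota>\<^esub>"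
    if "x \<in> carrier (galois_group \<iota>)" for x
  proof
    have x: "bij x" "\<And>k l. x (k + l) = x k + x l" "\<And>k l. x (k * l) = x k * x l" "x 1 = 1"
      "\<And>c k. x (\<iota> c * k) = \<iota> c * x k"
      using that by (auto simp: galois_group_iff)
    have xi: "x (\<iota> c) = \<iota> c" for c using x(4) x(5)[of c 1] by simp
    have inv: "x (inv_into UNIV x k) = k" "inv_into UNIV x (x k) = k" for k
      using x(1) by (simp_all add: bij_is_surj surj_f_inv_f bij_is_inj)
    then have eq: "inv_into UNIV x k = l \<longleftrightarrow> k = x l" for k l by metis
    show "inv_into UNIV x \<in> carrier (galois_group \<iota>)"
      by (auto simp: galois_group_iff bij_imp_bij_inv[OF x(1)] eq x(2-4) xi inv)
    show "inv_into UNIV x \<otimes>\<^bsub>galois_group \<iota>\<^esub> x = \<one>\<^bsub>galois_group \<iota>\<^esub>"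
      by (auto simp: mult one inv)
  qed
qed (auto simp: galois_group_def)

section \<open>The Galois group acting on the homomorphisms\<close>

context etale_extension
begin

lemma X_action_closed:
  assumes "\<gamma> \<in> carrier (galois_group \<iota>)" "\<eta> \<in> X_homs \<iota> A"
  shows "X_action \<iota> A \<gamma> \<eta> \<in> X_homs \<iota> A"
proof -
  note h = X_homsD[OF assms(2), unfolded semilinear_form_def]
  note g = assms(1)[unfolded galois_group_iff]
  have gi: "\<gamma> (\<iota> c) = \<iota> c" for c using g by (metis mult.right_neutral)
  have "compose (carrier A) \<gamma> \<eta> \<in> Ring.ring_hom A (extension_algebra \<iota>)"
    by (rule ring_hom_memI) (use h g in \<open>simp_all add: compose_def extension_algebra_def\<close>)
  then have "compose (carrier A) \<gamma> \<eta> \<in> X_homs \<iota> A"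
    using h g by (simp add: X_homs_def algebra_hom_def) (simp add: compose_def extension_algebra_def gi)
  then show ?thesis using assms(2) by (simp add: X_action_def)
qed

lemma X_action_apply:
  "\<eta> \<in> X_homs \<iota> A \<Longrightarrow> a \<in> carrier A \<Longrightarrow> X_action \<iota> A \<gamma> \<eta> a = \<gamma> (\<eta> a)"
  by (simp add: X_action_def compose_def)

lemma X_homs_eqI:
  assumes "\<eta> \<in> X_homs \<iota> A" "\<eta>' \<in> X_homs \<iota> A" "\<And>a. a \<in> carrier A \<Longrightarrow> \<eta> a = \<eta>' a"
  shows "\<eta> = \<eta>'"
  by (rule extensionalityI[OF X_homsD(4)[OF assms(1)] X_homsD(4)[OF assms(2)] assms(3)])

lemma X_group_action: "group_action (galois_group \<iota>) (X_homs \<iota> A) (X_action \<iota> A)"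
proof -
  let ?G = "galois_group \<iota>" and ?X = "X_homs \<iota> A" and ?act = "X_action \<iota> A"
  interpret G: group ?G by (rule galois_group_group)
  have mult: "g \<otimes>\<^bsub>?G\<^esub> g' = g \<circ> g'" for g g' by (simp add: galois_group_def)
  have comp: "?act (g \<otimes>\<^bsub>?G\<^esub> g') \<eta> = ?act g (?act g' \<eta>)"
    if "g \<in> carrier ?G" "g' \<in> carrier ?G" "\<eta> \<in> ?X" for g g' \<eta>
  proof (rule X_homs_eqI)
    show "?act (g \<otimes>\<^bsub>?G\<^esub> g') \<eta> \<in> ?X" "?act g (?act g' \<eta>) \<in> ?X"
      using that by (auto intro!: X_action_closed)
    show "?act (g \<otimes>\<^bsub>?G\<^esub> g') \<eta> a = ?act g (?act g' \<eta>) a" if "a \<in> carrier A" for a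
      using that \<open>g' \<in> carrier ?G\<close> \<open>\<eta> \<in> ?X\<close> by (simp add: X_action_closed X_action_apply mult)
  qed
  have one: "?act \<one>\<^bsub>?G\<^esub> \<eta> = \<eta>" if "\<eta> \<in> ?X" for \<eta>
    by (rule X_homs_eqI) (use that in \<open>auto simp: X_action_closed X_action_apply\<close>,
        simp add: galois_group_def)
  have bij: "?act g \<in> Bij ?X" if g: "g \<in> carrier ?G" for g
  proof -
    have "bij_betw (?act g) ?X ?X"
    proof (rule bij_betw_byWitness[where f' = "?act (inv\<^bsub>?G\<^esub> g)"])
      show "\<forall>\<eta>\<in>?X. ?act (inv\<^bsub>?G\<^esub> g) (?act g \<eta>) = \<eta>"
        using g by (simp add: one flip: comp)
      show "\<forall>\<eta>\<in>?X. ?act g (?act (inv\<^bsub>?G\<^esub> g) \<eta>) = \<eta>"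
        using g by (simp add: one flip: comp)
    qed (use g X_action_closed in auto)
    then show ?thesis by (simp add: Bij_def X_action_def)
  qed
  show ?thesis
    unfolding group_action_def group_hom_def group_hom_axioms_def
  proof (intro conjI galois_group_group group_BijGroup homI)
    show "?act g \<in> carrier (BijGroup ?X)" if "g \<in> carrier ?G" for g
      using bij[OF that] by (simp add: BijGroup_def)
    show "?act (g \<otimes>\<^bsub>?G\<^esub> g') = ?act g \<otimes>\<^bsub>BijGroup ?X\<^esub> ?act g'"
      if "g \<in> carrier ?G" "g' \<in> carrier ?G" for g g'
    proof -
      have "?act (g \<otimes>\<^bsub>?G\<^esub> g') = compose ?X (?act g) (?act g')"
      proof (rule extensionalityI[of _ ?X])
        show "?act (g \<otimes>\<^bsub>?G\<^esub> g') \<in> extensional ?X" by (simp add: X_action_def)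
        show "?act (g \<otimes>\<^bsub>?G\<^esub> g') \<eta> = compose ?X (?act g) (?act g') \<eta>" if "\<eta> \<in> ?X" for \<eta>
          using that comp[OF \<open>g \<in> carrier ?G\<close> \<open>g' \<in> carrier ?G\<close> that] by (simp add: compose_def)
      qed simp
      then show ?thesis using bij[OF that(1)] bij[OF that(2)] by (simp add: BijGroup_def)
    qed
  qed
qed

text \<open>
  Finitely many elements of \<open>A\<close> separate the homomorphisms, so an automorphism agreeing with \<open>\<gamma>\<close>
  on their images moves a homomorphism in the same way as \<open>\<gamma>\<close>.
\<close>

lemma X_continuous_action: "continuous_action \<iota> (X_homs \<iota> A) (X_action \<iota> A)"
  unfolding continuous_action_def
proof
  let ?G = "carrier (galois_group \<iota>)" and ?X = "X_homs \<iota> A" and ?act = "X_action \<iota> A"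
  let ?P = "prod_topology (krull_topology \<iota>) (discrete_topology ?X)"
  show "group_action (galois_group \<iota>) ?X ?act" by (rule X_group_action)
  have finX: "finite ?X" using X_homs_bij bij_betw_finite by blast
  have "\<exists>a\<in>carrier A. \<eta> a \<noteq> \<eta>' a" if "\<eta> \<in> ?X" "\<eta>' \<in> ?X" "\<eta> \<noteq> \<eta>'" for \<eta> \<eta>'
    using X_homs_eqI[OF that(1,2)] that(3) by blast
  then obtain sep where sep: "\<And>\<eta> \<eta>'. \<eta> \<in> ?X \<Longrightarrow> \<eta>' \<in> ?X \<Longrightarrow> \<eta> \<noteq> \<eta>' \<Longrightarrow>
      sep \<eta> \<eta>' \<in> carrier A \<and> \<eta> (sep \<eta> \<eta>') \<noteq> \<eta>' (sep \<eta> \<eta>')" by metis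
  define F where "F = (\<lambda>(\<eta>, \<eta>'). sep \<eta> \<eta>') ` {(\<eta>, \<eta>') \<in> ?X \<times> ?X. \<eta> \<noteq> \<eta>'}"
  have F: "finite F" "F \<subseteq> carrier A"
    using finX finite_subset[of "{(\<eta>, \<eta>') \<in> ?X \<times> ?X. \<eta> \<noteq> \<eta>'}" "?X \<times> ?X"] sep
    by (auto simp: F_def)
  have agree: "\<eta> = \<eta>'" if "\<eta> \<in> ?X" "\<eta>' \<in> ?X" "\<And>a. a \<in> F \<Longrightarrow> \<eta> a = \<eta>' a" for \<eta> \<eta>'
  proof (rule ccontr)
    assume "\<eta> \<noteq> \<eta>'"
    then have "sep \<eta> \<eta>' \<in> F" using that(1,2) by (force simp: F_def)
    with that(3) sep[OF that(1,2) \<open>\<eta> \<noteq> \<eta>'\<close>] show False by auto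
  qed
  have topG: "topspace (krull_topology \<iota>) = ?G"
    by (auto simp: krull_topology_def)
  have open_stab: "openin (krull_topology \<iota>) {\<gamma> \<in> ?G. ?act \<gamma> \<eta> \<in> U}" if \<eta>: "\<eta> \<in> ?X" for \<eta> U
  proof (subst openin_subopen, intro ballI)
    fix \<gamma>\<^sub>0 assume "\<gamma>\<^sub>0 \<in> {\<gamma> \<in> ?G. ?act \<gamma> \<eta> \<in> U}"
    then have g0: "\<gamma>\<^sub>0 \<in> ?G" "?act \<gamma>\<^sub>0 \<eta> \<in> U" by auto
    define W where "W = (\<Pi>\<^sub>E k\<in>UNIV. if k \<in> \<eta> ` F then {\<gamma>\<^sub>0 k} else UNIV)"
    have "openin (product_topology (\<lambda>_. discrete_topology UNIV) UNIV) W"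
      unfolding W_def openin_PiE_gen
      using F(1) by (auto intro!: finite_subset[OF _ finite_imageI[OF F(1), of \<eta>]] split: if_splits)
    then have "openin (krull_topology \<iota>) (W \<inter> ?G)"
      unfolding krull_topology_def openin_subtopology by blast
    moreover have "\<gamma>\<^sub>0 \<in> W \<inter> ?G" using g0 by (auto simp: W_def)
    moreover have "W \<inter> ?G \<subseteq> {\<gamma> \<in> ?G. ?act \<gamma> \<eta> \<in> U}"
    proof
      fix \<gamma> assume \<gamma>: "\<gamma> \<in> W \<inter> ?G"
      have "\<gamma> (\<eta> a) = \<gamma>\<^sub>0 (\<eta> a)" if "a \<in> F" for a
        using \<gamma> that by (auto simp: W_def PiE_iff dest!: spec[of _ "\<eta> a"] split: if_splits)
      then have "?act \<gamma> \<eta> = ?act \<gamma>\<^sub>0 \<eta>"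
        using \<gamma> g0(1) \<eta> F(2) by (intro agree X_action_closed) (auto simp: X_action_apply subset_iff)
      with g0(2) \<gamma> show "\<gamma> \<in> {\<gamma> \<in> ?G. ?act \<gamma> \<eta> \<in> U}" by simp
    qed
    ultimately show "\<exists>T. openin (krull_topology \<iota>) T \<and> \<gamma>\<^sub>0 \<in> T \<and> T \<subseteq> {\<gamma> \<in> ?G. ?act \<gamma> \<eta> \<in> U}"
      by blast
  qed
  show "continuous_map ?P (discrete_topology ?X)
      (\<lambda>(\<gamma>, y). ?act \<gamma> y)"
    unfolding continuous_map_def
  proof (intro conjI allI impI)
    show "(\<lambda>(\<gamma>, y). ?act \<gamma> y) \<in> topspace ?P \<rightarrow>
        topspace (discrete_topology ?X)"
      using X_action_closed by (auto simp: topG)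
    fix U
    have "{x \<in> topspace ?P.
        (case x of (\<gamma>, y) \<Rightarrow> ?act \<gamma> y) \<in> U} = (\<Union>\<eta>\<in>?X. {\<gamma> \<in> ?G. ?act \<gamma> \<eta> \<in> U} \<times> {\<eta>})"
      by (auto simp: topG)
    also have "openin ?P \<dots>"
      using open_stab by (intro openin_Union) (auto simp: openin_prod_Times_iff)
    finally show "openin ?P
        {x \<in> topspace ?P.
          (case x of (\<gamma>, y) \<Rightarrow> ?act \<gamma> y) \<in> U}" .
  qed
qed

end

section \<open>Equivariance and the embedding of quadrics\<close>

context embedding_data
begin

text \<open>Applying the Galois map to the defining equations for \<eta> gives those for the
  translate, since it fixes the images of \<open>L\<close> and acts on the scalars. This yields one
  inclusion for every automorphism; used for the inverse of \<gamma>, it yields the other.\<close>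

lemma induced_map_equivariant:
  assumes g: "\<gamma> \<in> carrier (galois_group \<iota>)" and \<eta>: "\<eta> \<in> X_homs \<iota> L"
  shows "\<epsilon>\<^sub>* (X_action \<iota> L \<gamma> \<eta>) = galois_map \<iota> A \<gamma> ` \<epsilon>\<^sub>* \<eta>"
proof -
  let ?G = "galois_group \<iota>" and ?act = "X_action \<iota> L" and ?gm = "galois_map \<iota> A"
  interpret G: group ?G by (rule galois_group_group)
  interpret X: group_action ?G "X_homs \<iota> L" ?act by (rule L.X_group_action)
  have sub: "?gm \<gamma> ` \<epsilon>\<^sub>* \<eta> \<subseteq> \<epsilon>\<^sub>* (?act \<gamma> \<eta>)"
    if g: "\<gamma> \<in> carrier ?G" and \<eta>: "\<eta> \<in> X_homs \<iota> L" for \<gamma> \<eta>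
  proof
    note p = g[unfolded galois_group_iff]
    have gm: "\<And>k l. \<gamma> (k + l) = \<gamma> k + \<gamma> l" "\<And>c k. \<gamma> (\<iota> c * k) = \<iota> c * \<gamma> k"
      "\<And>k l. \<gamma> (k * l) = \<gamma> k * \<gamma> l" and one: "\<gamma> 1 = 1" using p by auto
    fix y assume "y \<in> ?gm \<gamma> ` \<epsilon>\<^sub>* \<eta>"
    then obtain x where x: "x \<in> carrier A.S" "y = ?gm \<gamma> x"
      "\<And>l. l \<in> carrier L \<Longrightarrow> A.tens \<one>\<^bsub>A\<^esub> (\<eta> l) \<cdot> x = img l \<cdot> x"
      by (auto simp: induced_map_def)
    have "A.tens \<one>\<^bsub>A\<^esub> (?act \<gamma> \<eta> l) \<cdot> y = img l \<cdot> y"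
      if l: "l \<in> carrier L" for l
      using arg_cong[OF x(3)[OF l], of "?gm \<gamma>"] eps(1)[OF l]
        A.galois_map_mult[of \<gamma> x, OF gm x(1)]
      by (simp add: x(2) L.X_action_apply[OF \<eta> l] one)
    then show "y \<in> \<epsilon>\<^sub>* (?act \<gamma> \<eta>)"
      using A.galois_map(2)[of \<gamma>, OF gm(1,2) x(1)] by (simp add: induced_map_def x(2))
  qed
  show ?thesis
  proof
    let ?g' = "inv\<^bsub>galois_group \<iota>\<^esub> \<gamma>"
    have g': "?g' \<in> carrier ?G" using g by simp
    have cancel: "\<gamma> (?g' k) = k" for k
      using G.r_inv[OF g] by (simp add: galois_group_def fun_eq_iff)
    have gm: "\<And>k l. \<gamma> (k + l) = \<gamma> k + \<gamma> l" "\<And>c k. \<gamma> (\<iota> c * k) = \<iota> c * \<gamma> k"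
      using g unfolding galois_group_iff by auto
    have gm': "\<And>k l. ?g' (k + l) = ?g' k + ?g' l" "\<And>c k. ?g' (\<iota> c * k) = \<iota> c * ?g' k"
      using g' unfolding galois_group_iff by auto
    have undo: "?gm \<gamma> (?gm ?g' x) = x" if "x \<in> carrier A.S" for x
      using that by (induction rule: A.ext_induct)
        (simp_all add: A.galois_map[of \<gamma>, OF gm] A.galois_map[of "?g'", OF gm'] cancel)
    show "\<epsilon>\<^sub>* (?act \<gamma> \<eta>) \<subseteq> ?gm \<gamma> ` \<epsilon>\<^sub>* \<eta>"
    proof
      fix x assume x: "x \<in> \<epsilon>\<^sub>* (?act \<gamma> \<eta>)"
      have "?gm ?g' x \<in> \<epsilon>\<^sub>* (?act ?g' (?act \<gamma> \<eta>))"
        using sub[OF g' L.X_action_closed[OF g \<eta>]] x by blast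
      moreover have "?act ?g' (?act \<gamma> \<eta>) = \<eta>"
        using X.orbit_sym_aux[OF g \<eta> refl] .
      moreover have "x = ?gm \<gamma> (?gm ?g' x)"
        using undo x by (simp add: induced_map_def)
      ultimately show "x \<in> ?gm \<gamma> ` \<epsilon>\<^sub>* \<eta>"
        by (metis image_eqI)
    qed
  qed (rule sub[OF g \<eta>])
qed

lemma X_homs_image: "X_homs \<iota> L = L.\<xi> ` {..<2 * n}"
  using L.X_homs_bij by (simp add: bij_betw_def)

lemma thin_quadric: "thin_quadric \<iota> n (X_homs \<iota> L) (X_action \<iota> L) (X_involution L \<sigma>\<^sub>L)"
  unfolding thin_quadric_def
proof (intro conjI ballI)
  show "finite (X_homs \<iota> L)" by (simp add: X_homs_image)
  show "card (X_homs \<iota> L) = 2 * n" using bij_betw_same_card[OF L.X_homs_bij] by simp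
  show "bij_betw (X_involution L \<sigma>\<^sub>L) (X_homs \<iota> L) (X_homs \<iota> L)"
    by (rule bij_betw_byWitness[where f' = "X_involution L \<sigma>\<^sub>L"])
      (auto simp: X_involution_involutive X_involution_closed)
  fix \<gamma> \<eta> assume g: "\<gamma> \<in> carrier (galois_group \<iota>)" and \<eta>: "\<eta> \<in> X_homs \<iota> L"
  show "X_involution L \<sigma>\<^sub>L (X_action \<iota> L \<gamma> \<eta>) = X_action \<iota> L \<gamma> (X_involution L \<sigma>\<^sub>L \<eta>)"
  proof (rule L.X_homs_eqI)
    fix l assume "l \<in> carrier L"
    then show "X_involution L \<sigma>\<^sub>L (X_action \<iota> L \<gamma> \<eta>) l = X_action \<iota> L \<gamma> (X_involution L \<sigma>\<^sub>L \<eta>) l"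
      using L.X_action_apply[OF \<eta>] L.X_action_apply[OF X_involution_closed[OF \<eta>]]
      by (simp add: X_involution_def compose_def involution_L)
  qed (use g \<eta> in \<open>auto intro: X_involution_closed L.X_action_closed\<close>)
qed (auto simp: X_involution_involutive X_involution_free L.X_continuous_action)

lemma quadric_embedding:
  "quadric_embedding \<iota> n (X_homs \<iota> L) (X_action \<iota> L) (X_involution L \<sigma>\<^sub>L) A \<sigma> f (\<epsilon>\<^sub>*)"
  unfolding quadric_embedding_def
proof (intro conjI ballI allI impI)
  show "linear_variety \<iota> n A 1 (\<epsilon>\<^sub>* \<eta>)" if "\<eta> \<in> X_homs \<iota> L" for \<eta>
  proof -
    from that obtain i where "i < 2 * n" "\<eta> = L.\<xi> i" by (auto simp: X_homs_image)
    then show ?thesis using linear_variety_V[of "{i}"] by (simp add: induced_map_V)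
  qed
  show inj: "inj_on (\<epsilon>\<^sub>*) (X_homs \<iota> L)"
    unfolding X_homs_image by (rule induced_map_inj)
  show "card (\<epsilon>\<^sub>* ` X_homs \<iota> L) = 2 * n"
    using card_image[OF inj] bij_betw_same_card[OF L.X_homs_bij] by simp
  show "general_position \<iota> n A (\<epsilon>\<^sub>* ` X_homs \<iota> L)"
    unfolding X_homs_image by (rule general_position)
  fix P assume P: "thin_isotropic (X_homs \<iota> L) (X_involution L \<sigma>\<^sub>L) P"
  define T where "T = {i. i < 2 * n \<and> L.\<xi> i \<in> P}"
  have T: "T \<subseteq> {..<2 * n}" by (auto simp: T_def)
  have "P = L.\<xi> ` T"
    using P unfolding thin_isotropic_def X_homs_image T_def by auto
  moreover have "s i \<notin> T" if "i \<in> T" for i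
    using P that s[of i] by (auto simp: thin_isotropic_def T_def)
  ultimately show "isotropic \<iota> A \<sigma> f (spanned_variety \<iota> n A (\<epsilon>\<^sub>* ` P))"
    using isotropic_V[OF T] by (simp add: spanned_V[OF T])
qed (simp_all add: thin_quadric induced_map_equivariant)

end

theorem proposition3p8:
  fixes \<iota> :: "'f::field \<Rightarrow> 'k::field"
    and n :: nat
    and A :: "('f, 'a) module" and \<sigma> :: "'a \<Rightarrow> 'a" and f :: "'a \<Rightarrow> 'f"
    and L :: "('f, 'l) module" and \<sigma>\<^sub>L :: "'l \<Rightarrow> 'l"
    and \<epsilon> :: "'l \<Rightarrow> 'a"
  assumes "separable_closure \<iota>"
    and "n \<ge> 1"
    and "central_simple (2 * n) A"
    and "quadratic_pair \<iota> n A \<sigma> f"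
    and "etale_with_involution \<iota> (2 * n) L \<sigma>\<^sub>L"
    and "algebra_inv_embedding \<iota> L \<sigma>\<^sub>L A \<sigma> f \<epsilon>"
  shows "quadric_embedding \<iota> n (X_homs \<iota> L) (X_action \<iota> L) (X_involution L \<sigma>\<^sub>L) A \<sigma> f
           (induced_map \<iota> L A \<epsilon>)"
proof -
  from assms(5) obtain \<phi> where L: "assoc_algebra L" "cring L"
    and \<phi>: "algebra_iso (scalar_ext \<iota> L) (split_algebra (2 * n)) \<phi>"
    by (auto simp: etale_with_involution_def etale_def)
  have \<iota>: "field_hom \<iota>" using assms(1) by (simp add: separable_closure_def)
  have A: "assoc_algebra A" using assms(3) by (simp add: central_simple_def)
  have "embedding_data \<iota> A L n \<phi> \<sigma> f \<sigma>\<^sub>L \<epsilon>"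
    by (intro embedding_data.intro scalar_extension.intro etale_extension.intro
        etale_extension_axioms.intro embedding_data_axioms.intro \<iota> A L \<phi> assms(2-6))
  then show ?thesis by (rule embedding_data.quadric_embedding)
qed

end
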